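(* Let $q\in H^{-1}_{per}(\mathbb{R},\mathbb{R})$ with $\widehat{q}(0)=0$. Then the operator $S(q)$ on $L_2(\mathbb{R})$ has continuous spectrum (its point spectrum is empty) with a band and gap structure: there are real numbers $$-\infty<\lambda_0(q)<\lambda_1^-(q)\le\lambda_1^+(q)<\lambda_2^-(q)\le\lambda_2^+(q)<\dots$$ such that $\sigma(S(q))=[\lambda_0(q),\lambda_1^-(q)]\cup\bigcup_{k\ge1}[\lambda_k^+(q),\lambda_{k+1}^-(q)]$, the spectral gaps being $(-\infty,\lambda_0(q))$ and $(\lambda_k^-(q),\lambda_k^+(q))$, $k\in\mathbb{N}$. Moreover, the gap endpoints with even index ($\lambda_0(q)$ and $\lambda_{2k}^\pm(q)$, $k\in\mathbb{N}$) are eigenvalues of the periodic problem $S_+(q)$ on $[0,1]$, and the gap endpoints with odd index ($\lambda_{2k-1}^\pm(q)$, $k\in\mathbb{N}$) are eigenvalues of the semiperiodic problem $S_-(q)$ on $[0,1]$.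
   Context: $H^{-1}_{per}(\mathbb{R},\mathbb{R})$: real-valued $1$-periodic distributions $q=\sum_{k\in 2\mathbb{Z}}\widehat{q}(k)e^{ik\pi x}$ with $\sum_{k}(1+|k|)^{-2}|\widehat{q}(k)|^2<\infty$, $\widehat{q}(k)=\overline{\widehat{q}(-k)}$. With $\widehat{q}(0)=0$ let $Q(x)=\sum_{k\ne0}\frac{\widehat{q}(k)}{ik\pi}e^{ik\pi x}$ (real, $1$-periodic, $Q'=q$). $S(q)$ is the self-adjoint operator on $L_2(\mathbb{R})$, $S(q)u=l_Q[u]:=-(u'-Qu)'-Q(u'-Qu)-Q^2u$ on $\{u\in L_2(\mathbb{R}): u,\,u'-Qu\in W^1_{1,loc}(\mathbb{R}),\,l_Q[u]\in L_2(\mathbb{R})\}$ (it equals the form-sum operator $-d^2/dx^2\dotplus q$). $S_\pm(q)$ are the self-adjoint lower semibounded form-sum operators $\left(-\frac{d^2}{dx^2}\right)_\pm\dotplus q$ on $L_2(0,1)$, i.e. the operators associated with the closed lower semibounded forms $t_\pm[u,v]=\int_0^1\big(u'\overline{v'}-Qu\overline{v'}-Qu'\overline{v}\big)\,dx$ on $\{u\in H^1[0,1]: u(1)=\pm u(0)\}$ (periodic for $+$, semiperiodic for $-$); for smooth $q$ these are $-u''+qu$ with $u^{(j)}(0)=\pm u^{(j)}(1)$, $j=0,1$. *)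

theory Defs
  imports "HOL-Analysis.Analysis"
begin

text \<open>Potential data. A real 1-periodic distribution q in H^{-1}_{per} with zero mean
  coefficient is represented through its (unique) real, 1-periodic, mean-zero antiderivative
  Q in L_2(0,1), Q' = q (the Fourier series of Q in the context).\<close>

definition admissible_Q :: "(real \<Rightarrow> real) \<Rightarrow> bool" where
  "admissible_Q Q \<longleftrightarrow> Q \<in> borel_measurable lborel \<and> (\<forall>x. Q (x + 1) = Q x)
     \<and> set_integrable lborel {0..1} (\<lambda>x. (Q x)\<^sup>2)
     \<and> set_integrable lborel {0..1} Q \<and> (LINT x:{0..1}|lborel. Q x) = 0"

definition L2R :: "(real \<Rightarrow> complex) \<Rightarrow> bool" where
  "L2R u \<longleftrightarrow> u \<in> borel_measurable lborel \<and> integrable lborel (\<lambda>x. (cmod (u x))\<^sup>2)"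

definition L2R_norm :: "(real \<Rightarrow> complex) \<Rightarrow> real" where
  "L2R_norm u = sqrt (LINT x|lborel. (cmod (u x))\<^sup>2)"

definition loc_AC :: "(real \<Rightarrow> complex) \<Rightarrow> (real \<Rightarrow> complex) \<Rightarrow> bool" where
  "loc_AC u g \<longleftrightarrow> (\<forall>a b. set_integrable lborel {a..b} g)
     \<and> (\<forall>x. u x = u 0 + interval_lebesgue_integral lborel (ereal 0) (ereal x) g)"

text \<open>Graph of S(q): S(q) u = f, with
  dom = {u in L2 : u, u' - Q u in W^1_{1,loc}, l_Q[u] in L2},
  l_Q[u] = -(u'-Qu)' - Q (u'-Qu) - Q^2 u. Here g = u', w = u' - Q u (a.e.), h = w'.\<close>

definition S_graph :: "(real \<Rightarrow> real) \<Rightarrow> (real \<Rightarrow> complex) \<Rightarrow> (real \<Rightarrow> complex) \<Rightarrow> bool" where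
  "S_graph Q u f \<longleftrightarrow> L2R u \<and> L2R f \<and>
     (\<exists>g w h. loc_AC u g \<and> loc_AC w h \<and>
        (AE x in lborel. w x = g x - complex_of_real (Q x) * u x) \<and>
        (AE x in lborel. f x = - h x - complex_of_real (Q x) * w x
                                 - complex_of_real ((Q x)\<^sup>2) * u x))"

definition S_resolvent_set :: "(real \<Rightarrow> real) \<Rightarrow> complex set" where
  "S_resolvent_set Q = {z.
     (\<forall>f. L2R f \<longrightarrow> (\<exists>u. S_graph Q u (\<lambda>x. z * u x + f x))) \<and>
     (\<forall>u. S_graph Q u (\<lambda>x. z * u x) \<longrightarrow> (AE x in lborel. u x = 0)) \<and>
     (\<exists>C. \<forall>u f. L2R f \<longrightarrow> S_graph Q u (\<lambda>x. z * u x + f x) \<longrightarrow> L2R_norm u \<le> C * L2R_norm f)}"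

definition S_spectrum :: "(real \<Rightarrow> real) \<Rightarrow> complex set" where
  "S_spectrum Q = - S_resolvent_set Q"

definition S_point_spectrum :: "(real \<Rightarrow> real) \<Rightarrow> complex set" where
  "S_point_spectrum Q = {z. \<exists>u. S_graph Q u (\<lambda>x. z * u x) \<and> \<not> (AE x in lborel. u x = 0)}"

definition H1_01 :: "(real \<Rightarrow> complex) \<Rightarrow> (real \<Rightarrow> complex) \<Rightarrow> bool" where
  "H1_01 u g \<longleftrightarrow> g \<in> borel_measurable lborel \<and>
     set_integrable lborel {0..1} (\<lambda>x. (cmod (g x))\<^sup>2) \<and>
     set_integrable lborel {0..1} g \<and>
     (\<forall>x\<in>{0..1}. u x = u 0 + (LINT t:{0..x}|lborel. g t))"

definition form_dom :: "real \<Rightarrow> (real \<Rightarrow> complex) \<Rightarrow> (real \<Rightarrow> complex) \<Rightarrow> bool" where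
  "form_dom s u g \<longleftrightarrow> H1_01 u g \<and> u 1 = complex_of_real s * u 0"

definition t_form :: "(real \<Rightarrow> real) \<Rightarrow> (real \<Rightarrow> complex) \<Rightarrow> (real \<Rightarrow> complex)
                      \<Rightarrow> (real \<Rightarrow> complex) \<Rightarrow> (real \<Rightarrow> complex) \<Rightarrow> complex" where
  "t_form Q u u' v v' = (LINT x:{0..1}|lborel.
      u' x * cnj (v' x) - complex_of_real (Q x) * u x * cnj (v' x)
      - complex_of_real (Q x) * u' x * cnj (v x))"

text \<open>\<lambda> is an eigenvalue of the operator associated with the closed form t_s:
  there is a nonzero u in the form domain with t[u,v] = \<lambda> <u,v> for all v in the form domain.\<close>

definition form_eigenvalue :: "real \<Rightarrow> (real \<Rightarrow> real) \<Rightarrow> real \<Rightarrow> bool" where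
  "form_eigenvalue s Q lam \<longleftrightarrow> (\<exists>u u'. form_dom s u u' \<and> (\<exists>x\<in>{0..1}. u x \<noteq> 0) \<and>
     (\<forall>v v'. form_dom s v v' \<longrightarrow>
        t_form Q u u' v v' = complex_of_real lam * (LINT x:{0..1}|lborel. u x * cnj (v x))))"

abbreviation periodic_eigenvalue :: "(real \<Rightarrow> real) \<Rightarrow> real \<Rightarrow> bool" where
  "periodic_eigenvalue Q lam \<equiv> form_eigenvalue 1 Q lam"

abbreviation semiperiodic_eigenvalue :: "(real \<Rightarrow> real) \<Rightarrow> real \<Rightarrow> bool" where
  "semiperiodic_eigenvalue Q lam \<equiv> form_eigenvalue (-1) Q lam"

end

theory Submission
  imports Defs "HOL-Complex_Analysis.Complex_Analysis"
begin

text \<open>With E = exp (int Q), the substitution u = E a turns S(q) u = z u into a first order system with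
  continuous 1-periodic coefficients that is entire in z. Let Delta be the trace of its monodromy matrix.
  If a solution is square integrable near +infinity or -infinity, its Wronskian with its own translate
  vanishes, so it is a Floquet solution whose multiplier does not have modulus 1. Hence there are no
  eigenvalues; Green's function inverts S(q) - z when Delta(z) is outside [-2, 2], and S(q) - z is not onto
  when Delta(z) is in [-2, 2].

  The band structure follows without oscillation theory. By self-adjointness Delta takes values in [-2, 2]
  only at real points, so by the open mapping theorem it has no local extremum on the real line where
  |Delta| < 2. Along the negative axis it outgrows every polynomial, so by the great Picard theorem it
  takes infinitely many values infinitely often and therefore has infinitely many real zeros; each zero is
  a sign change and lies in exactly one band. At a band edge Delta = 2 or Delta = -2, and the Floquet
  solution with multiplier 1 or -1 is a periodic or semiperiodic eigenfunction.\<close>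

section \<open>Locally absolutely continuous functions\<close>

text \<open>Since \<open>Q\<close> is only square integrable, the quasi-derivative
  \<open>w = u' - Q u\<close> satisfies \<open>w' = - Q w - (Q^2 + z) u - f\<close> with merely
  integrable coefficients. The factor \<open>E\<close> removes the terms linear in \<open>Q\<close>:
  \<open>a' = w / E\<close> and \<open>(E w)' = - Q^2 E^2 a - z E^2 a - E f\<close>. The remaining
  rough coefficient \<open>Q^2 E^2\<close> is absorbed by the second unknown
  \<open>c = E w + F a\<close>, where \<open>F\<close> is an antiderivative of
  \<open>Q^2 E^2\<close> minus its mean; subtracting the mean makes \<open>F\<close> periodic, just
  as the zero mean of \<open>Q\<close> makes \<open>E\<close> periodic. What is left has continuous
  coefficients, so Picard iteration yields C1 solutions. The matrix has trace zero, hence Wronskians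
  are constant and the two Floquet multipliers are inverse to each other. Only the data
  \<open>f\<close> stay rough, which is why absolutely continuous functions are kept alongside. For
  the labelling of the edges, the sign of \<open>Delta\<close> between consecutive zeros alternates,
  starting from \<open>Delta > 2\<close> far to the left; its parity decides between the values 2
  and -2, and so between the two boundary conditions.\<close>

lemma loc_AC_int: "loc_AC u g \<Longrightarrow> set_integrable lborel {a..b} g"
  by (simp add: loc_AC_def)

text \<open>The definition integrates from 0 with orientation. This lemma and its converse
  \<open>loc_ACI\<close> replace that by integrals over ordered intervals, the form in which most
  later arguments work.\<close>

lemma loc_AC_diff:
  assumes "loc_AC u g" "a \<le> b"
  shows "u b - u a = (LINT x:{a..b}|lborel. g x)"
proof -
  have u: "u x = u 0 + (LBINT t=ereal 0..ereal x. g t)" for x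
    using assms(1) unfolding loc_AC_def by blast
  have si: "set_integrable lborel {a..b} g" for a b
    using assms(1) by (simp add: loc_AC_def)
  have ii: "interval_lebesgue_integrable lborel (min (ereal 0) (min (ereal a) (ereal b))) (max (ereal 0) (max (ereal a) (ereal b))) g"
    unfolding interval_lebesgue_integrable_def
    by (auto simp flip: ereal_min ereal_max intro: set_integrable_subset[OF si[of "min 0 (min a b)" "max 0 (max a b)"]])
  have "(LBINT t=ereal 0..ereal a. g t) + (LBINT t=ereal a..ereal b. g t) = (LBINT t=ereal 0..ereal b. g t)"
    by (rule interval_integral_sum[OF ii])
  then have "u b - u a = (LBINT t=ereal a..ereal b. g t)"
    using u[of a] u[of b] by (simp add: algebra_simps)
  then show ?thesis
    by (simp add: interval_integral_Icc[OF assms(2)])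
qed

lemma loc_ACI:
  assumes si: "\<And>a b. set_integrable lborel {a..b} g"
    and d: "\<And>a b. a \<le> b \<Longrightarrow> u b - u a = (LINT x:{a..b}|lborel. g x)"
  shows "loc_AC u g"
  unfolding loc_AC_def
proof (intro conjI allI)
  fix x :: real
  show "u x = u 0 + interval_lebesgue_integral lborel (ereal 0) (ereal x) g"
  proof (cases "0 \<le> x")
    case True
    then show ?thesis using d[of 0 x] by (simp add: interval_integral_Icc algebra_simps)
  next
    case False
    then show ?thesis using d[of x 0]
      by (subst interval_integral_endpoints_reverse) (simp add: interval_integral_Icc algebra_simps)
  qed
qed (rule si)

lemma loc_AC_continuous:
  assumes "loc_AC u g"
  shows "continuous_on S u"
proof -
  have "isCont u x" for x
  proof -
    have si: "set_integrable lborel {x-1..x+1} g" using assms by (simp add: loc_AC_def)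
    have gi: "g integrable_on {x-1..x+1}" using set_borel_integral_eq_integral(1)[OF si] .
    have "continuous_on {x-1..x+1} (\<lambda>t. u (x-1) + integral {x-1..t} g)"
      by (intro continuous_intros indefinite_integral_continuous_1 gi)
    moreover have "u t = u (x-1) + integral {x-1..t} g" if "t \<in> {x-1..x+1}" for t
    proof -
      have "set_integrable lborel {x-1..t} g" using assms by (simp add: loc_AC_def)
      then show ?thesis
        using loc_AC_diff[OF assms, of "x-1" t] that set_borel_integral_eq_integral(2)[of "{x-1..t}" g]
        by (simp add: algebra_simps)
    qed
    ultimately have "continuous_on {x-1..x+1} u"
      using continuous_on_cong by (metis (no_types, lifting))
    then show ?thesis
      by (rule continuous_on_interior) simp
  qed
  then show ?thesis by (simp add: continuous_at_imp_continuous_on)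
qed

text \<open>The definition gives integrability on compact intervals only, but \<open>g\<close> is
  the pointwise limit of its truncations to growing intervals, and these are measurable.\<close>

lemma loc_AC_measurable:
  assumes "loc_AC u g"
  shows "g \<in> borel_measurable lborel"
proof -
  have "(\<lambda>x. indicator {-real n..real n} x *\<^sub>R g x) \<in> borel_measurable lborel" for n
    using loc_AC_int[OF assms, of "-real n" "real n"] unfolding set_integrable_def
    by (rule borel_measurable_integrable)
  moreover have "(\<lambda>n. indicator {-real n..real n} x *\<^sub>R g x) \<longlonglongrightarrow> g x" for x
  proof (rule tendsto_eventually)
    show "\<forall>\<^sub>F n in sequentially. indicator {-real n..real n} x *\<^sub>R g x = g x"
      using eventually_ge_at_top[of "nat \<lceil>\<bar>x\<bar>\<rceil>"]
    proof eventually_elim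
      case (elim n)
      then have "\<bar>x\<bar> \<le> real n" by linarith
      then show ?case by (auto simp: indicator_def)
    qed
  qed
  ultimately show ?thesis
    by (rule borel_measurable_LIMSEQ_metric)
qed

text \<open>The equations in \<open>S_graph\<close> hold almost everywhere, so derivatives must be
  exchangeable off null sets. Measurability of \<open>g'\<close> is demanded separately because
  \<open>lborel\<close> is not complete.\<close>

lemma loc_AC_cong_AE:
  assumes "loc_AC u g" "AE x in lborel. g x = g' x" "g' \<in> borel_measurable lborel"
  shows "loc_AC u g'"
proof (rule loc_ACI)
  note [measurable] = loc_AC_measurable[OF assms(1)] assms(3)
  fix a b :: real
  have "set_integrable lborel {a..b} g" using assms by (simp add: loc_AC_def)
  then show "set_integrable lborel {a..b} g'"
    unfolding set_integrable_def
    by (rule integrable_cong_AE_imp) (use assms(2) in auto)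
  assume "a \<le> b"
  then show "u b - u a = (LINT x:{a..b}|lborel. g' x)"
    unfolding loc_AC_diff[OF assms(1) \<open>a \<le> b\<close>] set_lebesgue_integral_def
    by (intro integral_cong_AE) (use assms(2) in auto)
qed

lemma set_integrable_mult_continuous:
  fixes f g :: "real \<Rightarrow> complex"
  assumes "set_integrable lborel {a..b} g" "continuous_on {a..b} f"
  shows "set_integrable lborel {a..b} (\<lambda>x. f x * g x)"
proof -
  have "compact (f ` {a..b})" using assms(2) by (rule compact_continuous_image) simp
  then obtain B where B: "\<And>x. x \<in> {a..b} \<Longrightarrow> norm (f x) \<le> B"
    using compact_imp_bounded[of "f ` {a..b}"] unfolding bounded_iff by (metis imageI)
  have fm: "(\<lambda>x. indicator {a..b} x *\<^sub>R f x) \<in> borel_measurable lborel"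
    using borel_measurable_continuous_on_indicator[OF _ assms(2)] by simp
  have gi: "integrable lborel (\<lambda>x. indicator {a..b} x *\<^sub>R g x)"
    using assms(1) by (simp add: set_integrable_def)
  have "integrable lborel (\<lambda>x. (indicator {a..b} x *\<^sub>R f x) * (indicator {a..b} x *\<^sub>R g x))"
  proof (rule Bochner_Integration.integrable_bound[OF integrable_mult_right[OF integrable_norm[OF gi], of B]])
    show "(\<lambda>x. indicator {a..b} x *\<^sub>R f x * indicator {a..b} x *\<^sub>R g x) \<in> borel_measurable lborel"
      using borel_measurable_times[OF fm borel_measurable_integrable[OF gi]] by simp
    show "AE x in lborel. norm (indicator {a..b} x *\<^sub>R f x * indicator {a..b} x *\<^sub>R g x)
             \<le> norm (B * norm (indicator {a..b} x *\<^sub>R g x))"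
    proof (rule AE_I2)
      fix x
      show "norm (indicator {a..b} x *\<^sub>R f x * indicator {a..b} x *\<^sub>R g x)
             \<le> norm (B * norm (indicator {a..b} x *\<^sub>R g x))"
        using B[of x] by (auto simp: indicator_def norm_mult abs_mult intro!: mult_right_mono)
    qed
  qed
  then show ?thesis unfolding set_integrable_def
    by (rule back_subst[where P="integrable lborel"]) (auto simp: indicator_def)
qed

lemma lborel_integrable_pair_mult:
  fixes G H :: "real \<Rightarrow> complex"
  assumes "integrable lborel G" "integrable lborel H"
  shows "integrable (lborel \<Otimes>\<^sub>M lborel) (\<lambda>(s, t). G s * H t)"
proof (rule lborel_pair.Fubini_integrable)
  note [measurable] = borel_measurable_integrable[OF assms(1)] borel_measurable_integrable[OF assms(2)]
  show "(\<lambda>(s, t). G s * H t) \<in> borel_measurable (lborel \<Otimes>\<^sub>M lborel)" by measurable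
  show "integrable lborel (\<lambda>x. \<integral>y. norm (case (x, y) of (s, t) \<Rightarrow> G s * H t) \<partial>lborel)"
    using assms by (simp add: norm_mult)
  show "AE x in lborel. integrable lborel (\<lambda>y. case (x, y) of (s, t) \<Rightarrow> G s * H t)"
    using assms by simp
qed

text \<open>Integration by parts in measure form: the plane splits into the regions
  \<open>t <= s\<close> and \<open>s <= t\<close>, which overlap only in the diagonal, a null set on
  each line. Fubini exchanges the order in the second integral.\<close>

lemma integral_product_triangles:
  fixes G H :: "real \<Rightarrow> complex"
  assumes G: "integrable lborel G" and H: "integrable lborel H"
  shows "(\<integral>s. G s * (\<integral>t. indicator {..s} t *\<^sub>R H t \<partial>lborel) \<partial>lborel)
       + (\<integral>t. H t * (\<integral>s. indicator {..t} s *\<^sub>R G s \<partial>lborel) \<partial>lborel)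
       = (\<integral>s. G s \<partial>lborel) * (\<integral>t. H t \<partial>lborel)" (is "?I1 + ?I2 = _")
proof -
  note [measurable] = borel_measurable_integrable[OF G] borel_measurable_integrable[OF H]
  define A where "A s t = indicator {t..} s *\<^sub>R (G s * H t)" for s t :: real
  define B where "B s t = indicator {..t} s *\<^sub>R (G s * H t)" for s t :: real
  have GH: "integrable (lborel \<Otimes>\<^sub>M lborel) (\<lambda>(s, t). G s * H t)"
    by (rule lborel_integrable_pair_mult[OF G H])
  have mB: "(\<lambda>(s,t). B s t) \<in> borel_measurable (lborel \<Otimes>\<^sub>M lborel)"
    unfolding B_def indicator_def of_bool_def by (simp add: case_prod_beta')
  have mA: "(\<lambda>(s,t). A s t) \<in> borel_measurable (lborel \<Otimes>\<^sub>M lborel)"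
    unfolding A_def indicator_def of_bool_def by (simp add: case_prod_beta')
  have iA: "integrable (lborel \<Otimes>\<^sub>M lborel) (\<lambda>(s,t). A s t)"
    by (rule Bochner_Integration.integrable_bound[OF GH mA]) (auto simp: A_def indicator_def)
  have iB: "integrable (lborel \<Otimes>\<^sub>M lborel) (\<lambda>(s,t). B s t)"
    by (rule Bochner_Integration.integrable_bound[OF GH mB]) (auto simp: B_def indicator_def)
  have I1: "?I1 = (\<integral>s. \<integral>t. A s t \<partial>lborel \<partial>lborel)"
    unfolding integral_mult_right_zero[symmetric]
    by (intro Bochner_Integration.integral_cong) (auto simp: A_def indicator_def)
  have "?I2 = (\<integral>t. \<integral>s. B s t \<partial>lborel \<partial>lborel)"
    unfolding integral_mult_right_zero[symmetric]
    by (intro Bochner_Integration.integral_cong) (auto simp: B_def indicator_def mult.commute)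
  also have "\<dots> = (\<integral>s. \<integral>t. B s t \<partial>lborel \<partial>lborel)"
    by (rule lborel_pair.Fubini_integral[OF iB])
  finally have I2: "?I2 = (\<integral>s. \<integral>t. B s t \<partial>lborel \<partial>lborel)" .
  have fA: "integrable lborel (\<lambda>s. \<integral>t. A s t \<partial>lborel)" using lborel_pair.integrable_fst[OF iA] by simp
  have fB: "integrable lborel (\<lambda>s. \<integral>t. B s t \<partial>lborel)" using lborel_pair.integrable_fst[OF iB] by simp
  have inner: "(\<integral>t. A s t \<partial>lborel) + (\<integral>t. B s t \<partial>lborel) = G s * (\<integral>t. H t \<partial>lborel)" for s
  proof -
    have iAs: "integrable lborel (A s)"
      unfolding A_def by (rule Bochner_Integration.integrable_bound[OF integrable_mult_right[OF H, of "G s"]])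
        (auto simp: indicator_def)
    have iBs: "integrable lborel (B s)"
      unfolding B_def by (rule Bochner_Integration.integrable_bound[OF integrable_mult_right[OF H, of "G s"]])
        (auto simp: indicator_def)
    have "AE t in lborel. t \<noteq> s" by (rule AE_lborel_singleton)
    then have "AE t in lborel. A s t + B s t = G s * H t"
      by eventually_elim (auto simp: A_def B_def indicator_def)
    then have "(\<integral>t. A s t + B s t \<partial>lborel) = (\<integral>t. G s * H t \<partial>lborel)"
      by (intro integral_cong_AE) (use iAs iBs in auto)
    then show ?thesis using iAs iBs by simp
  qed
  show ?thesis unfolding I1 I2
    by (simp add: Bochner_Integration.integral_add[OF fA fB, symmetric] inner)
qed

text \<open>The product rule comes from \<open>integral_product_triangles\<close>, applied to the
  derivatives cut off outside \<open>{a..b}\<close>.\<close>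

lemma loc_AC_mult:
  assumes u: "loc_AC u g" and v: "loc_AC v h"
  shows "loc_AC (\<lambda>x. u x * v x) (\<lambda>x. g x * v x + u x * h x)"
proof (rule loc_ACI)
  fix a b :: real
  have gi: "set_integrable lborel {a..b} (\<lambda>x. g x * v x)" for a b
    using set_integrable_mult_continuous[OF loc_AC_int[OF u] loc_AC_continuous[OF v]]
    by (simp add: mult.commute)
  have hi: "set_integrable lborel {a..b} (\<lambda>x. u x * h x)" for a b
    using set_integrable_mult_continuous[OF loc_AC_int[OF v] loc_AC_continuous[OF u]] .
  show "set_integrable lborel {a..b} (\<lambda>x. g x * v x + u x * h x)"
    by (intro set_integral_add gi hi)
  assume ab: "a \<le> b"
  define G where "G = (\<lambda>x. indicator {a..b} x *\<^sub>R g x)"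
  define K where "K = (\<lambda>x. indicator {a..b} x *\<^sub>R h x)"
  have Gi: "integrable lborel G" and Ki: "integrable lborel K"
    using loc_AC_int[OF u] loc_AC_int[OF v] by (auto simp: G_def K_def set_integrable_def)
  have vs: "v s = v a + (\<integral>t. indicator {..s} t *\<^sub>R K t \<partial>lborel)" if "s \<in> {a..b}" for s
  proof -
    have "v s - v a = (LINT t:{a..s}|lborel. h t)" using loc_AC_diff[OF v] that by simp
    also have "\<dots> = (\<integral>t. indicator {..s} t *\<^sub>R K t \<partial>lborel)"
      unfolding set_lebesgue_integral_def using that
      by (intro Bochner_Integration.integral_cong) (auto simp: K_def indicator_def)
    finally show ?thesis by (simp add: algebra_simps)
  qed
  have us: "u s = u a + (\<integral>t. indicator {..s} t *\<^sub>R G t \<partial>lborel)" if "s \<in> {a..b}" for s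
  proof -
    have "u s - u a = (LINT t:{a..s}|lborel. g t)" using loc_AC_diff[OF u] that by simp
    also have "\<dots> = (\<integral>t. indicator {..s} t *\<^sub>R G t \<partial>lborel)"
      unfolding set_lebesgue_integral_def using that
      by (intro Bochner_Integration.integral_cong) (auto simp: G_def indicator_def)
    finally show ?thesis by (simp add: algebra_simps)
  qed
  have Gv: "integrable lborel (\<lambda>s. G s * v s)"
    using gi[of a b] unfolding set_integrable_def G_def by simp
  have Ku: "integrable lborel (\<lambda>s. K s * u s)"
    using hi[of a b] unfolding set_integrable_def K_def by (simp add: mult.commute)
  have IG: "(\<integral>s. G s \<partial>lborel) = u b - u a"
    unfolding loc_AC_diff[OF u ab] set_lebesgue_integral_def G_def ..
  have IK: "(\<integral>s. K s \<partial>lborel) = v b - v a"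
    unfolding loc_AC_diff[OF v ab] set_lebesgue_integral_def K_def ..
  \<comment> \<open>On \<open>{a..b}\<close> the inner integral is \<open>v s - v a\<close>;
    elsewhere the factor \<open>G s\<close> vanishes, so the identity holds for all
    \<open>s\<close>.\<close>
  have e1: "G s * (\<integral>t. indicator {..s} t *\<^sub>R K t \<partial>lborel) = G s * v s - G s * v a" for s
    using vs[of s] by (cases "s \<in> {a..b}") (auto simp: G_def algebra_simps)
  have e2: "K s * (\<integral>t. indicator {..s} t *\<^sub>R G t \<partial>lborel) = K s * u s - K s * u a" for s
    using us[of s] by (cases "s \<in> {a..b}") (auto simp: K_def algebra_simps)
  have "(\<integral>s. G s * v s - G s * v a \<partial>lborel) + (\<integral>s. K s * u s - K s * u a \<partial>lborel) = (u b - u a) * (v b - v a)"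
    using integral_product_triangles[OF Gi Ki] unfolding e1 e2 IG IK .
  then have "(\<integral>s. G s * v s \<partial>lborel) + (\<integral>s. K s * u s \<partial>lborel) = u b * v b - u a * v a"
    using Gv Ku Gi Ki by (simp add: IG IK algebra_simps)
  then show "u b * v b - u a * v a = (LINT x:{a..b}|lborel. g x * v x + u x * h x)"
    using Gv Ku
    unfolding set_lebesgue_integral_def G_def K_def
    by (simp add: scaleR_right_distrib mult.commute flip: Bochner_Integration.integral_add)
qed

section \<open>Linear combinations, powers and exponentials of absolutely continuous
  functions\<close>

lemma loc_AC_const: "loc_AC (\<lambda>x. k) (\<lambda>x. 0)"
  by (rule loc_ACI) (auto simp: set_integrable_def set_lebesgue_integral_def)

lemma loc_AC_add:
  assumes "loc_AC u g" "loc_AC v h"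
  shows "loc_AC (\<lambda>x. u x + v x) (\<lambda>x. g x + h x)"
proof (rule loc_ACI)
  fix a b :: real
  show "set_integrable lborel {a..b} (\<lambda>x. g x + h x)"
    by (intro set_integral_add loc_AC_int[OF assms(1)] loc_AC_int[OF assms(2)])
  assume "a \<le> b"
  then show "u b + v b - (u a + v a) = (LINT x:{a..b}|lborel. g x + h x)"
    using loc_AC_diff[OF assms(1), of a b] loc_AC_diff[OF assms(2), of a b]
      set_integral_add(2)[OF loc_AC_int[OF assms(1)] loc_AC_int[OF assms(2)], of a b]
    by (simp add: algebra_simps)
qed

lemma loc_AC_cmult:
  assumes "loc_AC u g"
  shows "loc_AC (\<lambda>x. k * u x) (\<lambda>x. k * g x)"
  using loc_AC_mult[OF loc_AC_const assms, of k] by simp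

lemma loc_AC_lincomb:
  assumes "loc_AC u g" "loc_AC v h"
  shows "loc_AC (\<lambda>x. k * u x + l * v x) (\<lambda>x. k * g x + l * h x)"
  by (intro loc_AC_add loc_AC_cmult assms)

lemma loc_AC_power:
  assumes "loc_AC u g"
  shows "loc_AC (\<lambda>x. u x ^ Suc n) (\<lambda>x. of_nat (Suc n) * (g x * u x ^ n))"
proof (induction n)
  case 0
  then show ?case using assms by simp
next
  case (Suc n)
  show ?case using loc_AC_mult[OF assms Suc] by (simp add: algebra_simps)
qed

text \<open>The exponential is reached through its Taylor polynomials: differentiating the sum up to
  \<open>n\<close> returns \<open>g\<close> times the sum below \<open>n\<close>, so the derivatives
  converge to \<open>g * exp u\<close>.\<close>

lemma loc_AC_exp_partial:
  assumes "loc_AC u g"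
  shows "loc_AC (\<lambda>x. \<Sum>i\<le>n. u x ^ i / fact i) (\<lambda>x. \<Sum>i<n. g x * (u x ^ i / fact i))"
proof (induction n)
  case 0
  then show ?case using loc_AC_const[of 1] by simp
next
  case (Suc n)
  have "loc_AC (\<lambda>x. 1 / fact (Suc n) * u x ^ Suc n) (\<lambda>x. 1 / fact (Suc n) * (of_nat (Suc n) * (g x * u x ^ n)))"
    by (rule loc_AC_cmult[OF loc_AC_power[OF assms]])
  also have "(\<lambda>x. 1 / fact (Suc n) * (of_nat (Suc n) * (g x * u x ^ n))) = (\<lambda>x. g x * (u x ^ n / fact n))"
    by (rule ext) (simp add: field_simps del: of_nat_Suc)
  finally show ?case using loc_AC_add[OF Suc] by simp
qed

lemma norm_exp_partial_le: "norm (\<Sum>i<n. (z::complex) ^ i / fact i) \<le> exp (norm z)"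
proof -
  have "norm (\<Sum>i<n. z ^ i / fact i) \<le> (\<Sum>i<n. norm z ^ i / fact i)"
    by (rule order_trans[OF norm_sum]) (simp add: norm_divide norm_power)
  also have "\<dots> \<le> exp (norm z)"
    unfolding exp_def
    using sum_le_suminf[OF summable_exp_generic[of "norm z"], of "{..<n}"]
    by (simp add: field_simps scaleR_conv_of_real)
  finally show ?thesis .
qed

lemma exp_partial_tendsto: "(\<lambda>n. \<Sum>i<n. (z::complex) ^ i / fact i) \<longlonglongrightarrow> exp z"
  using exp_converges[of z] by (simp add: sums_def scaleR_conv_of_real field_simps)

lemma loc_AC_exp:
  assumes u: "loc_AC u g"
  shows "loc_AC (\<lambda>x. exp (u x)) (\<lambda>x. g x * exp (u x))"
proof (rule loc_ACI)
  fix a b :: real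
  have eu: "continuous_on S (\<lambda>x. exp (u x))" for S
    by (intro continuous_intros loc_AC_continuous[OF u])
  show si: "set_integrable lborel {a..b} (\<lambda>x. g x * exp (u x))"
    using set_integrable_mult_continuous[OF loc_AC_int[OF u] eu] by (simp add: mult.commute)
  assume ab: "a \<le> b"
  note [measurable] = loc_AC_measurable[OF u] borel_measurable_continuous_onI[OF loc_AC_continuous[OF u]]
  have "compact ((\<lambda>x. u x) ` {a..b})" by (rule compact_continuous_image[OF loc_AC_continuous[OF u]]) simp
  then obtain B where B: "\<And>x. x \<in> {a..b} \<Longrightarrow> norm (u x) \<le> B"
    using compact_imp_bounded[of "u ` {a..b}"] unfolding bounded_iff by (metis imageI)
  define s where "s n x = indicator {a..b} x *\<^sub>R (\<Sum>i<n. g x * (u x ^ i / fact i))" for n x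
  have gi: "integrable lborel (\<lambda>x. indicator {a..b} x *\<^sub>R g x)"
    using loc_AC_int[OF u] by (simp add: set_integrable_def)
  have "(\<lambda>n. \<integral>x. s n x \<partial>lborel) \<longlonglongrightarrow> (\<integral>x. indicator {a..b} x *\<^sub>R (g x * exp (u x)) \<partial>lborel)"
  proof (rule integral_dominated_convergence)
    show "integrable lborel (\<lambda>x. exp B * norm (indicator {a..b} x *\<^sub>R g x))"
      by (intro integrable_mult_right integrable_norm gi)
    show "AE x in lborel. (\<lambda>n. s n x) \<longlonglongrightarrow> indicator {a..b} x *\<^sub>R (g x * exp (u x))"
      unfolding s_def sum_distrib_left[symmetric]
      by (intro AE_I2 tendsto_intros exp_partial_tendsto)
    show "AE x in lborel. norm (s n x) \<le> exp B * norm (indicator {a..b} x *\<^sub>R g x)" for n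
    proof (rule AE_I2)
      fix x
      have "norm (\<Sum>i<n. u x ^ i / fact i) \<le> exp B" if "x \<in> {a..b}"
        using norm_exp_partial_le[of "u x" n] B[OF that] by (meson exp_le_cancel_iff order_trans)
      then show "norm (s n x) \<le> exp B * norm (indicator {a..b} x *\<^sub>R g x)"
        unfolding s_def sum_distrib_left[symmetric]
        by (auto simp: indicator_def norm_mult mult.commute[of "exp B"] intro!: mult_left_mono)
    qed
  qed (auto simp: s_def)
  moreover have "(\<integral>x. s n x \<partial>lborel) = (\<Sum>i\<le>n. u b ^ i / fact i) - (\<Sum>i\<le>n. u a ^ i / fact i)" for n
    using loc_AC_diff[OF loc_AC_exp_partial[OF u, of n] ab]
    by (simp add: s_def set_lebesgue_integral_def)
  moreover have "(\<lambda>n. (\<Sum>i\<le>n. u b ^ i / fact i) - (\<Sum>i\<le>n. u a ^ i / fact i)) \<longlonglongrightarrow> exp (u b) - exp (u a)"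
    using LIMSEQ_Suc[OF exp_partial_tendsto]
    by (intro tendsto_diff) (simp_all add: lessThan_Suc_atMost)
  ultimately show "exp (u b) - exp (u a) = (LINT x:{a..b}|lborel. g x * exp (u x))"
    by (simp add: set_lebesgue_integral_def LIMSEQ_unique)
qed

section \<open>Passage between absolute continuity and classical derivatives\<close>

lemma set_integrable_continuous_Icc:
  fixes g :: "real \<Rightarrow> complex"
  assumes "continuous_on {a..b} g"
  shows "set_integrable lborel {a..b} g"
  unfolding set_integrable_def using assms by (rule borel_integrable_compact[OF compact_Icc])

lemma loc_AC_of_derivative:
  assumes d: "\<And>x. (u has_vector_derivative g x) (at x)" and c: "continuous_on UNIV g"
  shows "loc_AC u g"
proof (rule loc_ACI)
  fix a b :: real
  show si: "set_integrable lborel {a..b} g"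
    by (rule set_integrable_continuous_Icc[OF continuous_on_subset[OF c]]) simp
  assume "a \<le> b"
  then have "(g has_integral (u b - u a)) {a..b}"
    by (intro fundamental_theorem_of_calculus has_vector_derivative_at_within[OF d])
  then show "u b - u a = (LINT x:{a..b}|lborel. g x)"
    using set_borel_integral_eq_integral(2)[OF si] by (simp add: integral_unique)
qed

text \<open>Together with \<open>loc_AC_of_derivative\<close> this identifies homogeneous solutions
  in the integrated sense with C1 solutions (\<open>homsol_iff_insol\<close>), so Wronskian
  identities proved for rough data apply to both.\<close>

lemma loc_AC_derivative:
  assumes u: "loc_AC u g" and c: "continuous_on UNIV g"
  shows "(u has_vector_derivative g x) (at x)"
proof -
  have "((\<lambda>t. u (x-1) + integral {x-1..t} g) has_vector_derivative g x) (at x within {x-1..x+1})"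
    using integral_has_vector_derivative[OF continuous_on_subset[OF c], of "x-1" "x+1" x]
    by (auto intro!: derivative_eq_intros)
  moreover have "u t = u (x-1) + integral {x-1..t} g" if "t \<in> {x-1..x+1}" for t
    using loc_AC_diff[OF u, of "x-1" t] that set_borel_integral_eq_integral(2)[OF loc_AC_int[OF u], of "x-1" t]
    by (simp add: algebra_simps)
  ultimately have "(u has_vector_derivative g x) (at x within {x-1..x+1})"
    by (metis (no_types, lifting) has_vector_derivative_transform atLeastAtMost_iff add_increasing2 diff_le_eq le_add_same_cancel1 zero_le_one order_refl)
  then have "(u has_vector_derivative g x) (at x within {x-1<..<x+1})"
    by (rule has_vector_derivative_within_subset) auto
  then show ?thesis
    by (subst (asm) has_vector_derivative_within_open) auto
qed

lemma loc_AC_cnj: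
  assumes "loc_AC u g"
  shows "loc_AC (\<lambda>x. cnj (u x)) (\<lambda>x. cnj (g x))"
proof (rule loc_ACI)
  fix a b :: real
  have *: "indicator {a..b} x *\<^sub>R cnj (g x) = cnj (indicator {a..b} x *\<^sub>R g x)" for x
    by simp
  show "set_integrable lborel {a..b} (\<lambda>x. cnj (g x))"
    using loc_AC_int[OF assms, of a b] unfolding set_integrable_def * complex_integrable_cnj .
  assume "a \<le> b"
  then have "cnj (u b - u a) = cnj (LINT x:{a..b}|lborel. g x)"
    using loc_AC_diff[OF assms] by simp
  also have "\<dots> = (LINT x:{a..b}|lborel. cnj (g x))"
    unfolding set_lebesgue_integral_def * by (rule Bochner_Integration.integral_cnj[symmetric])
  finally show "cnj (u b) - cnj (u a) = (LINT x:{a..b}|lborel. cnj (g x))"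
    by simp
qed

section \<open>Linear systems with continuous periodic coefficients\<close>

text \<open>Termwise differentiation takes place on a ball around \<open>x\<close>. The majorant may
  depend on its radius because the Picard terms are bounded only locally in
  \<open>x\<close>.\<close>

lemma has_vector_derivative_series_real:
  fixes f :: "nat \<Rightarrow> real \<Rightarrow> complex"
  assumes d: "\<And>n x. (f n has_vector_derivative f' n x) (at x)"
    and b: "\<And>R. \<exists>M. summable M \<and> (\<forall>n x. \<bar>x\<bar> \<le> R \<longrightarrow> norm (f' n x) \<le> M n \<and> norm (f n x) \<le> M n)"
  shows "((\<lambda>x. \<Sum>n. f n x) has_vector_derivative (\<Sum>n. f' n x)) (at x)"
proof -
  define S where "S = ball (0::real) (\<bar>x\<bar> + 1)"
  obtain M where M: "summable M" "\<And>n y. y \<in> S \<Longrightarrow> norm (f' n y) \<le> M n" "\<And>n y. y \<in> S \<Longrightarrow> norm (f n y) \<le> M n"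
    using b[of "\<bar>x\<bar> + 1"] unfolding S_def by (auto simp: dist_norm)
  have sf: "summable (\<lambda>n. f n y)" if "y \<in> S" for y
    by (rule summable_comparison_test[OF _ M(1)]) (use M(3)[OF that] in auto)
  have ul: "uniform_limit S (\<lambda>n y. \<Sum>i<n. f' i y) (\<lambda>y. \<Sum>i. f' i y) sequentially"
    by (rule Weierstrass_m_test[OF M(2) M(1)])
  have x: "x \<in> S" by (simp add: S_def)
  have "\<exists>g. \<forall>y\<in>S. (\<lambda>n. f n y) sums (g y) \<and> (g has_derivative (\<lambda>h. h *\<^sub>R (\<Sum>i. f' i y))) (at y within S)"
  proof (rule has_derivative_series[where S=S and f'="\<lambda>n y h. h *\<^sub>R f' n y" and g'="\<lambda>y h. h *\<^sub>R (\<Sum>i. f' i y)" and x=x and l="\<Sum>n. f n x"])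
    show "convex S" by (simp add: S_def)
    show "(f n has_derivative (\<lambda>h. h *\<^sub>R f' n y)) (at y within S)" for n y
      using d[of n y] unfolding has_vector_derivative_def by (rule has_derivative_at_withinI)
    show "(\<lambda>n. f n x) sums (\<Sum>n. f n x)" using sf[OF x] by (rule summable_sums)
    fix e :: real assume "e > 0"
    have "\<forall>\<^sub>F n in sequentially. \<forall>y\<in>S. dist (\<Sum>i<n. f' i y) (\<Sum>i. f' i y) < e"
      using uniform_limitD[OF ul \<open>e > 0\<close>] .
    then show "\<forall>\<^sub>F n in sequentially. \<forall>y\<in>S. \<forall>h. norm ((\<Sum>i<n. h *\<^sub>R f' i y) - h *\<^sub>R (\<Sum>i. f' i y)) \<le> e * norm h"
    proof eventually_elim
      case (elim n)
      have "norm ((\<Sum>i<n. h *\<^sub>R f' i y) - h *\<^sub>R (\<Sum>i. f' i y)) \<le> e * norm h" if "y \<in> S" for y h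
      proof -
        have "norm ((\<Sum>i<n. h *\<^sub>R f' i y) - h *\<^sub>R (\<Sum>i. f' i y)) = norm h * norm ((\<Sum>i<n. f' i y) - (\<Sum>i. f' i y))"
          by (simp add: scaleR_sum_right[symmetric] scaleR_diff_right[symmetric])
        also have "\<dots> \<le> norm h * e"
          using elim that by (intro mult_left_mono) (auto simp: dist_norm intro: less_imp_le)
        finally show ?thesis by (simp add: mult.commute)
      qed
      then show ?case by blast
    qed
  qed (rule x)
  then obtain g where g: "\<And>y. y \<in> S \<Longrightarrow> (\<lambda>n. f n y) sums (g y)"
      "(g has_derivative (\<lambda>h. h *\<^sub>R (\<Sum>i. f' i x))) (at x within S)"
    using x by blast
  have "(g has_derivative (\<lambda>h. h *\<^sub>R (\<Sum>i. f' i x))) (at x)"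
    using g(2) x by (subst (asm) at_within_open) (auto simp: S_def)
  then have "((\<lambda>x. \<Sum>n. f n x) has_derivative (\<lambda>h. h *\<^sub>R (\<Sum>i. f' i x))) (at x)"
    by (rule has_derivative_transform_within_open[of _ _ _ _ S])
      (use g(1) x in \<open>auto simp: S_def sums_iff\<close>)
  then show ?thesis by (simp add: has_vector_derivative_def)
qed

text \<open>Each integration gains a factor \<open>|x| / (n + 1)\<close>; iterated, these factors
  produce the factorial in \<open>picard_bound\<close>. Negative \<open>x\<close> are handled by
  reflection.\<close>

lemma norm_le_of_derivative_power:
  fixes f :: "real \<Rightarrow> complex"
  assumes d: "\<And>x. (f has_vector_derivative f' x) (at x)" and "f 0 = 0"
    and b: "\<And>x. norm (f' x) \<le> D * \<bar>x\<bar> ^ n"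
  shows "norm (f x) \<le> D * \<bar>x\<bar> ^ Suc n / real (Suc n)"
proof -
  have pos: "norm (g x) \<le> D * x ^ Suc n / real (Suc n)"
    if d: "\<And>x. (g has_vector_derivative g' x) (at x)" and g0: "g 0 = 0"
      and b: "\<And>x. norm (g' x) \<le> D * \<bar>x\<bar> ^ n" and x: "x > 0" for g g' :: "real \<Rightarrow> complex" and x
  proof -
    have "norm (g x - g 0) \<le> D * x ^ Suc n / real (Suc n) - D * 0 ^ Suc n / real (Suc n)"
    proof (rule differentiable_bound_general[OF x, where f'=g' and \<phi>'="\<lambda>x. D * x ^ n"])
      show "continuous_on {0..x} g"
        by (intro continuous_at_imp_continuous_on ballI has_vector_derivative_continuous[OF d])
      show "continuous_on {0..x} (\<lambda>x. D * x ^ Suc n / real (Suc n))"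
        by (intro continuous_intros) auto
      show "((\<lambda>x. D * x ^ Suc n / real (Suc n)) has_vector_derivative D * y ^ n) (at y)" for y
        unfolding has_real_derivative_iff_has_vector_derivative[symmetric]
        by (auto intro!: derivative_eq_intros simp del: of_nat_Suc power_Suc)
      show "norm (g' y) \<le> D * y ^ n" if "0 < y" for y using b[of y] that by simp
    qed (rule d)
    then show ?thesis by (simp add: g0)
  qed
  consider "x > 0" | "x = 0" | "x < 0" by linarith
  then show ?thesis
  proof cases
    case 1
    then show ?thesis using pos[OF d \<open>f 0 = 0\<close> b, of x] by simp
  next
    case 2
    then show ?thesis by (simp add: \<open>f 0 = 0\<close>)
  next
    case 3
    have "((\<lambda>x. f (- x)) has_vector_derivative - f' (- x)) (at x)" for x
    proof -
      have "((\<lambda>x. - x) has_vector_derivative (-1::real)) (at x)"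
        by (auto intro!: derivative_eq_intros)
      from vector_diff_chain_at[OF this, of f "f' (- x)"] d[of "-x"] show ?thesis
        by (simp add: o_def)
    qed
    from pos[OF this, of "- x"] show ?thesis using 3 b[of "- _"] \<open>f 0 = 0\<close> by auto
  qed
qed

definition antider :: "(real \<Rightarrow> complex) \<Rightarrow> real \<Rightarrow> complex" where
  "antider f x = (LBINT t=ereal 0..ereal x. f t)"

lemma antider_0 [simp]: "antider f 0 = 0"
  by (simp add: antider_def)

lemma antider_derivative:
  assumes "continuous_on UNIV f"
  shows "(antider f has_vector_derivative f x) (at x)"
proof -
  have "((\<lambda>u. LBINT y=ereal 0..ereal u. f y) has_vector_derivative f x) (at x within {-\<bar>x\<bar>-1..\<bar>x\<bar>+1})"
    by (rule interval_integral_FTC2) (auto intro: continuous_on_subset[OF assms])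
  then have "((\<lambda>u. LBINT y=ereal 0..ereal u. f y) has_vector_derivative f x) (at x within {-\<bar>x\<bar>-1<..<\<bar>x\<bar>+1})"
    by (rule has_vector_derivative_within_subset) auto
  then have "((\<lambda>u. LBINT y=ereal 0..ereal u. f y) has_vector_derivative f x) (at x)"
    by (subst (asm) has_vector_derivative_within_open) auto
  moreover have "antider f = (\<lambda>u. LBINT y=ereal 0..ereal u. f y)" by (rule ext) (simp add: antider_def)
  ultimately show ?thesis by simp
qed

lemma continuous_of_derivative:
  assumes "\<And>x. (f has_vector_derivative f' x) (at x)"
  shows "continuous_on S f"
  by (intro continuous_at_imp_continuous_on ballI has_vector_derivative_continuous[OF assms])

lemma antider_continuous: "continuous_on UNIV f \<Longrightarrow> continuous_on S (antider f)"
  by (rule continuous_of_derivative[OF antider_derivative])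

lemma antider_unique:
  assumes d: "\<And>x. (F has_vector_derivative f x) (at x)" and "F 0 = 0" and c: "continuous_on UNIV f"
  shows "F = antider f"
proof
  fix x
  have "((\<lambda>x. F x - antider f x) has_vector_derivative 0) (at x)" for x
    using has_vector_derivative_diff[OF d[of x] antider_derivative[OF c, of x]] by simp
  then obtain k where "\<And>x. x \<in> UNIV \<Longrightarrow> F x - antider f x = k"
    using has_vector_derivative_zero_constant[of UNIV "\<lambda>x. F x - antider f x"] by auto
  then show "F x = antider f x" using \<open>F 0 = 0\<close> by (metis UNIV_I antider_0 eq_iff_diff_eq_0)
qed

text \<open>Polynomials in the spectral parameter whose coefficients are continuous functions of x:
  the Picard iterates belong to this class, which makes their holomorphy in the parameter immediate.\<close>

inductive polyfam :: "(complex \<Rightarrow> real \<Rightarrow> complex) \<Rightarrow> bool" where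
  coeff: "continuous_on UNIV C \<Longrightarrow> polyfam (\<lambda>z. C)"
| add: "polyfam f \<Longrightarrow> polyfam g \<Longrightarrow> polyfam (\<lambda>z x. f z x + g z x)"
| param: "polyfam f \<Longrightarrow> polyfam (\<lambda>z x. z * f z x)"

lemma polyfam_continuous: "polyfam f \<Longrightarrow> continuous_on S (f z)"
  by (induction rule: polyfam.induct) (auto intro!: continuous_intros intro: continuous_on_subset)

lemma polyfam_holomorphic: "polyfam f \<Longrightarrow> (\<lambda>z. f z x) holomorphic_on S"
  by (induction rule: polyfam.induct) (auto intro!: holomorphic_intros)

lemma polyfam_cmult:
  assumes "continuous_on UNIV (h :: real \<Rightarrow> real)" "polyfam f"
  shows "polyfam (\<lambda>z x. of_real (h x) * f z x)"
  using assms(2)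
proof induction
  case (coeff C)
  then show ?case using assms(1) by (intro polyfam.coeff continuous_intros)
next
  case (add f g)
  show ?case unfolding distrib_left by (rule polyfam.add[OF add.IH])
next
  case (param f)
  then show ?case using polyfam.param[OF param.IH] by (simp add: algebra_simps)
qed

lemma polyfam_antider: "polyfam f \<Longrightarrow> polyfam (\<lambda>z. antider (f z))"
proof (induction rule: polyfam.induct)
  case (coeff C)
  then show ?case by (intro polyfam.coeff antider_continuous)
next
  case (add f g)
  have "antider (\<lambda>x. f z x + g z x) = (\<lambda>x. antider (f z) x + antider (g z) x)" for z
    by (rule antider_unique[symmetric])
      (auto intro!: derivative_eq_intros antider_derivative polyfam_continuous[OF add.hyps(1)] polyfam_continuous[OF add.hyps(2)] continuous_intros)
  then show ?case using polyfam.add[OF add.IH] by simp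
next
  case (param f)
  have "antider (\<lambda>x. z * f z x) = (\<lambda>x. z * antider (f z) x)" for z
    by (rule antider_unique[symmetric])
      (auto intro!: derivative_eq_intros antider_derivative polyfam_continuous[OF param.hyps] continuous_intros)
  then show ?case using polyfam.param[OF param.IH] by simp
qed

lemma periodic_shift_int:
  fixes f :: "real \<Rightarrow> 'a"
  assumes "\<And>x. f (x + 1) = f x"
  shows "f (x + of_int n) = f x"
proof (induction n rule: int_induct[where k=0])
  case (step1 i)
  then show ?case using assms[of "x + of_int i"] by (simp add: add.assoc)
next
  case (step2 i)
  then show ?case using assms[of "x + of_int (i - 1)"] by (simp add: algebra_simps)
qed simp

lemma periodic_continuous_bounded:
  fixes f :: "real \<Rightarrow> real"
  assumes "\<And>x. f (x + 1) = f x" "continuous_on UNIV f"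
  obtains B where "\<And>x. \<bar>f x\<bar> \<le> B"
proof -
  have "compact (f ` {0..1})"
    by (rule compact_continuous_image[OF continuous_on_subset[OF assms(2)]]) auto
  then obtain B where B: "\<And>x. x \<in> {0..1} \<Longrightarrow> \<bar>f x\<bar> \<le> B"
    using compact_imp_bounded[of "f ` {0..1}"] unfolding bounded_iff by (metis imageI real_norm_def)
  have "\<bar>f x\<bar> \<le> B" for x
  proof -
    have "f x = f (frac x)"
      using periodic_shift_int[of f "frac x" "floor x", OF assms(1)] by (simp add: frac_def)
    moreover have "frac x \<in> {0..1}" using frac_lt_1[of x] by (simp add: less_imp_le)
    ultimately show ?thesis using B by simp
  qed
  then show thesis using that by blast
qed

text \<open>The system matrix has rows \<open>(al, be)\<close> and
  \<open>(ka - z * rh, - al)\<close>: its trace is zero and only one entry contains the parameter,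
  linearly. Floquet theory, Green's function and the discriminant rest on continuity and periodicity
  of the coefficients; a potential enters only when the locale is instantiated.\<close>

locale hill =
  fixes E al ka :: "real \<Rightarrow> real"
  assumes cont_E: "continuous_on UNIV E" and cont_al: "continuous_on UNIV al" and cont_ka: "continuous_on UNIV ka"
    and per_E: "E (x + 1) = E x" and per_al: "al (x + 1) = al x" and per_ka: "ka (x + 1) = ka x"
    and E_pos: "E x > 0"
begin

text \<open>\<open>be\<close> is the coefficient of \<open>c\<close> in
  \<open>a' = (c - F a) / E^2\<close>; \<open>rh\<close> is the weight with
  \<open>|u|^2 = rh |a|^2\<close> for \<open>u = E a\<close>.\<close>

definition be :: "real \<Rightarrow> real" where "be x = 1 / (E x)\<^sup>2"
definition rh :: "real \<Rightarrow> real" where "rh x = (E x)\<^sup>2"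

lemma be_pos: "be x > 0" and rh_pos: "rh x > 0"
  using E_pos[of x] by (auto simp: be_def rh_def)

lemma per_be: "be (x + 1) = be x" and per_rh: "rh (x + 1) = rh x"
  by (simp_all add: be_def rh_def per_E)

lemma cont_be: "continuous_on UNIV be"
  unfolding be_def[abs_def] using E_pos
  by (intro continuous_intros cont_E) (metis less_irrefl power_not_zero)

lemma cont_rh: "continuous_on UNIV rh"
  unfolding rh_def[abs_def] by (intro continuous_intros cont_E)

abbreviation rA :: "(real \<Rightarrow> complex) \<Rightarrow> (real \<Rightarrow> complex) \<Rightarrow> real \<Rightarrow> complex" where
  "rA a c x \<equiv> of_real (al x) * a x + of_real (be x) * c x"
abbreviation rC :: "complex \<Rightarrow> (real \<Rightarrow> complex) \<Rightarrow> (real \<Rightarrow> complex) \<Rightarrow> real \<Rightarrow> complex" where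
  "rC z a c x \<equiv> (of_real (ka x) - z * of_real (rh x)) * a x - of_real (al x) * c x"

definition homsol :: "complex \<Rightarrow> (real \<Rightarrow> complex) \<Rightarrow> (real \<Rightarrow> complex) \<Rightarrow> bool" where
  "homsol z a c \<longleftrightarrow>
     (\<forall>x. (a has_vector_derivative rA a c x) (at x)) \<and>
     (\<forall>x. (c has_vector_derivative rC z a c x) (at x))"

text \<open>\<open>R\<close> stands for a bound on \<open>norm z\<close>. Having one
  \<open>K\<close> for all such \<open>z\<close> makes the Picard series converge locally uniformly
  in the parameter.\<close>

lemma coefficient_bound:
  obtains K where "K \<ge> 0"
    "\<And>x. \<bar>al x\<bar> + \<bar>be x\<bar> \<le> K" "\<And>x. \<bar>ka x\<bar> + R * \<bar>rh x\<bar> + \<bar>al x\<bar> \<le> K"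
proof -
  obtain B1 where B1: "\<And>x. \<bar>\<bar>al x\<bar> + \<bar>be x\<bar>\<bar> \<le> B1"
    by (rule periodic_continuous_bounded[of "\<lambda>x. \<bar>al x\<bar> + \<bar>be x\<bar>"])
      (auto simp: per_al per_be intro!: continuous_intros cont_al cont_be)
  obtain B2 where B2: "\<And>x. \<bar>\<bar>ka x\<bar> + R * \<bar>rh x\<bar> + \<bar>al x\<bar>\<bar> \<le> B2"
    by (rule periodic_continuous_bounded[of "\<lambda>x. \<bar>ka x\<bar> + R * \<bar>rh x\<bar> + \<bar>al x\<bar>"])
      (auto simp: per_al per_rh per_ka intro!: continuous_intros cont_al cont_ka cont_rh)
  show thesis
  proof (rule that[of "max B1 B2"])
    show "0 \<le> max B1 B2" using B1[of 0] by linarith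
    show "\<bar>al x\<bar> + \<bar>be x\<bar> \<le> max B1 B2" for x using B1[of x] by linarith
    show "\<bar>ka x\<bar> + R * \<bar>rh x\<bar> + \<bar>al x\<bar> \<le> max B1 B2" for x using B2[of x] by linarith
  qed
qed

lemma rhs_bound:
  assumes K: "K \<ge> 0" "\<And>x. \<bar>al x\<bar> + \<bar>be x\<bar> \<le> K" "\<And>x. \<bar>ka x\<bar> + R * \<bar>rh x\<bar> + \<bar>al x\<bar> \<le> K"
    and z: "norm z \<le> R" and m: "norm (a x) \<le> m" "norm (c x) \<le> m"
  shows "norm (rA a c x) \<le> K * m" "norm (rC z a c x) \<le> K * m"
proof -
  have *: "norm (p * v + q * w) \<le> K * m" if "norm p + norm q \<le> K" "norm v \<le> m" "norm w \<le> m" for p q v w :: complex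
  proof -
    have m: "0 \<le> m" using that(2) norm_ge_zero order_trans by blast
    have "norm (p * v + q * w) \<le> norm p * norm v + norm q * norm w"
      by (metis norm_mult norm_triangle_ineq)
    also have "\<dots> \<le> norm p * m + norm q * m" using that by (intro add_mono mult_left_mono) auto
    also have "\<dots> \<le> K * m" unfolding distrib_right[symmetric] using that m by (intro mult_right_mono)
    finally show ?thesis .
  qed
  show "norm (rA a c x) \<le> K * m"
    using K(2)[of x] m by (intro *) auto
  have "norm (of_real (ka x) - z * of_real (rh x)) \<le> \<bar>ka x\<bar> + norm z * \<bar>rh x\<bar>"
    by (rule order_trans[OF norm_triangle_ineq4]) (simp add: norm_mult norm_power)
  also have "\<dots> \<le> \<bar>ka x\<bar> + R * \<bar>rh x\<bar>" using z by (intro add_left_mono mult_right_mono) auto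
  finally have "norm (of_real (ka x) - z * of_real (rh x)) + norm (- of_real (al x) :: complex) \<le> K"
    using K(3)[of x] by simp
  from *[OF this m] show "norm (rC z a c x) \<le> K * m" by simp
qed

section \<open>Picard iteration, uniform in the spectral parameter\<close>

context
  fixes s t :: complex
begin

text \<open>These are the terms of the Picard series, not its partial sums: only term 0 carries the
  initial values, all later ones vanish at 0.\<close>

primrec picard :: "complex \<Rightarrow> nat \<Rightarrow> (real \<Rightarrow> complex) \<times> (real \<Rightarrow> complex)" where
  "picard z 0 = (\<lambda>_. s, \<lambda>_. t)"
| "picard z (Suc n) =
    (antider (\<lambda>x. rA (fst (picard z n)) (snd (picard z n)) x),
     antider (\<lambda>x. rC z (fst (picard z n)) (snd (picard z n)) x))"

lemma picard_polyfam: "polyfam (\<lambda>z. fst (picard z n)) \<and> polyfam (\<lambda>z. snd (picard z n))"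
proof (induction n)
  case 0
  then show ?case by (auto intro!: polyfam.coeff continuous_intros)
next
  case (Suc n)
  have 1: "polyfam (\<lambda>z x. rA (fst (picard z n)) (snd (picard z n)) x)"
    by (intro polyfam.add polyfam_cmult cont_al cont_be conjunct1[OF Suc] conjunct2[OF Suc])
  have "polyfam (\<lambda>z x. (of_real (ka x) * fst (picard z n) x + z * (of_real (- rh x) * fst (picard z n) x))
          + of_real (- al x) * snd (picard z n) x)"
    by (intro polyfam.add polyfam.param polyfam_cmult continuous_intros cont_al cont_ka cont_rh
        conjunct1[OF Suc] conjunct2[OF Suc])
  then have 2: "polyfam (\<lambda>z x. rC z (fst (picard z n)) (snd (picard z n)) x)"
    by (rule back_subst[where P=polyfam]) (auto simp: fun_eq_iff algebra_simps)
  show ?case using polyfam_antider[OF 1] polyfam_antider[OF 2] by simp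
qed

lemma picard_rhs_continuous:
  "continuous_on UNIV (\<lambda>x. rA (fst (picard z n)) (snd (picard z n)) x)"
  "continuous_on UNIV (\<lambda>x. rC z (fst (picard z n)) (snd (picard z n)) x)"
  using polyfam_continuous[OF conjunct1[OF picard_polyfam]] polyfam_continuous[OF conjunct2[OF picard_polyfam]]
  by (auto intro!: continuous_intros cont_al cont_be cont_ka cont_rh)

lemma picard_bound:
  assumes K: "K \<ge> 0" "\<And>x. \<bar>al x\<bar> + \<bar>be x\<bar> \<le> K" "\<And>x. \<bar>ka x\<bar> + R * \<bar>rh x\<bar> + \<bar>al x\<bar> \<le> K"
    and z: "norm z \<le> R" and B: "norm s \<le> B" "norm t \<le> B"
  shows "norm (fst (picard z n) x) \<le> B * (K * \<bar>x\<bar>) ^ n / fact n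
       \<and> norm (snd (picard z n) x) \<le> B * (K * \<bar>x\<bar>) ^ n / fact n"
proof (induction n arbitrary: x)
  case 0
  then show ?case using B by simp
next
  case (Suc n)
  define D where "D = B * K ^ Suc n / fact n"
  have eqD: "K * (B * (K * \<bar>x\<bar>) ^ n / fact n) = D * \<bar>x\<bar> ^ n" for x
    by (simp add: D_def power_mult_distrib)
  have b1: "norm (rA (fst (picard z n)) (snd (picard z n)) x) \<le> D * \<bar>x\<bar> ^ n"
    and b2: "norm (rC z (fst (picard z n)) (snd (picard z n)) x) \<le> D * \<bar>x\<bar> ^ n" for x
    unfolding eqD[symmetric] using rhs_bound[where a="fst (picard z n)" and c="snd (picard z n)" and x=x, OF K z conjunct1[OF Suc[of x]] conjunct2[OF Suc[of x]]] by auto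
  have eqF: "D * \<bar>x\<bar> ^ Suc n / real (Suc n) = B * (K * \<bar>x\<bar>) ^ Suc n / fact (Suc n)"
    by (simp add: D_def power_mult_distrib field_simps del: of_nat_Suc)
  show ?case
    unfolding eqF[symmetric] picard.simps fst_conv snd_conv
    by (intro conjI norm_le_of_derivative_power[OF antider_derivative] picard_rhs_continuous b1 b2 antider_0)
qed

definition solA :: "complex \<Rightarrow> real \<Rightarrow> complex" where "solA z x = (\<Sum>n. fst (picard z n) x)"
definition solC :: "complex \<Rightarrow> real \<Rightarrow> complex" where "solC z x = (\<Sum>n. snd (picard z n) x)"

text \<open>The same majorant serves twice: for termwise differentiation in \<open>x\<close> and for
  uniform convergence on balls in \<open>z\<close>.\<close>

lemma picard_majorant:
  obtains M where "summable M" "\<And>n. M n \<ge> 0"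
    "\<And>z n x. norm z \<le> R \<Longrightarrow> \<bar>x\<bar> \<le> r \<Longrightarrow> norm (fst (picard z n) x) \<le> M n \<and> norm (snd (picard z n) x) \<le> M n"
proof -
  obtain K where K: "K \<ge> 0" "\<And>x. \<bar>al x\<bar> + \<bar>be x\<bar> \<le> K" "\<And>x. \<bar>ka x\<bar> + R * \<bar>rh x\<bar> + \<bar>al x\<bar> \<le> K"
    using coefficient_bound by blast
  define B where "B = max (norm s) (norm t)"
  show thesis
  proof (rule that[of "\<lambda>n. B * (K * \<bar>r\<bar>) ^ n / fact n"])
    show "summable (\<lambda>n. B * (K * \<bar>r\<bar>) ^ n / fact n)"
      using summable_mult[OF summable_exp[of "K * \<bar>r\<bar>"], of B] by (simp add: field_simps)
    have B0: "0 \<le> B" by (simp add: B_def le_max_iff_disj)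
    then show "0 \<le> B * (K * \<bar>r\<bar>) ^ n / fact n" for n
      using K(1) by (intro divide_nonneg_nonneg mult_nonneg_nonneg) auto
    fix z :: complex and n x assume z: "norm z \<le> R" and x: "\<bar>x\<bar> \<le> r"
    have "B * (K * \<bar>x\<bar>) ^ n / fact n \<le> B * (K * \<bar>r\<bar>) ^ n / fact n"
      using K(1) x B0 by (intro divide_right_mono mult_left_mono power_mono) auto
    with picard_bound[OF K z, of B n x]
    show "norm (fst (picard z n) x) \<le> B * (K * \<bar>r\<bar>) ^ n / fact n \<and> norm (snd (picard z n) x) \<le> B * (K * \<bar>r\<bar>) ^ n / fact n"
      by (auto simp: B_def)
  qed
qed

lemma picard_summable: "summable (\<lambda>n. fst (picard z n) x)" "summable (\<lambda>n. snd (picard z n) x)"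
proof -
  obtain M where M: "summable M" "\<And>n. norm (fst (picard z n) x) \<le> M n \<and> norm (snd (picard z n) x) \<le> M n"
    using picard_majorant[of "norm z" "\<bar>x\<bar>"] by (metis order_refl)
  show "summable (\<lambda>n. fst (picard z n) x)" "summable (\<lambda>n. snd (picard z n) x)"
    using M by (auto intro: summable_comparison_test[OF _ M(1)])
qed

lemma sol_initial: "solA z 0 = s" "solC z 0 = t"
proof -
  have "(\<lambda>n. fst (picard z n) 0) = (\<lambda>n. if n = 0 then s else 0)" "(\<lambda>n. snd (picard z n) 0) = (\<lambda>n. if n = 0 then t else 0)"
    by (auto simp: fun_eq_iff gr0_conv_Suc)
  then show "solA z 0 = s" "solC z 0 = t"
    using sums_unique[OF sums_single[of 0 "\<lambda>_. s"]] sums_unique[OF sums_single[of 0 "\<lambda>_. t"]]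
    by (simp_all add: solA_def solC_def)
qed

lemma sol_homsol: "homsol z (solA z) (solC z)"
proof -
  define fa where "fa n = (case n of 0 \<Rightarrow> \<lambda>x. 0 | Suc n \<Rightarrow> (\<lambda>x. rA (fst (picard z n)) (snd (picard z n)) x))" for n
  define fc where "fc n = (case n of 0 \<Rightarrow> \<lambda>x. 0 | Suc n \<Rightarrow> (\<lambda>x. rC z (fst (picard z n)) (snd (picard z n)) x))" for n
  have da: "(fst (picard z n) has_vector_derivative fa n x) (at x)" for n x
    by (cases n) (auto simp: fa_def intro!: antider_derivative picard_rhs_continuous)
  have dc: "(snd (picard z n) has_vector_derivative fc n x) (at x)" for n x
    by (cases n) (auto simp: fc_def intro!: antider_derivative picard_rhs_continuous)
  obtain K where K: "K \<ge> 0" "\<And>x. \<bar>al x\<bar> + \<bar>be x\<bar> \<le> K" "\<And>x. \<bar>ka x\<bar> + norm z * \<bar>rh x\<bar> + \<bar>al x\<bar> \<le> K"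
    using coefficient_bound by blast
  have maj: "\<exists>M. summable M \<and> (\<forall>n x. \<bar>x\<bar> \<le> R \<longrightarrow> (norm (fa n x) \<le> M n \<and> norm (fst (picard z n) x) \<le> M n)
      \<and> (norm (fc n x) \<le> M n \<and> norm (snd (picard z n) x) \<le> M n))" for R
  proof -
    obtain M where M: "summable M" "\<And>n. M n \<ge> 0"
        "\<And>n x. \<bar>x\<bar> \<le> R \<Longrightarrow> norm (fst (picard z n) x) \<le> M n \<and> norm (snd (picard z n) x) \<le> M n"
      using picard_majorant[of "norm z" R] by (metis order_refl)
    \<comment> \<open>The derivative of term \<open>n\<close> is the right-hand side at term
      \<open>n - 1\<close>, so the shifted sequence \<open>K * M (n - 1)\<close> is added; term 0 is
      constant.\<close>
    define N where "N n = M n + (case n of 0 \<Rightarrow> 0 | Suc m \<Rightarrow> K * M m)" for n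
    have "summable (\<lambda>n. K * M n)" using M(1) by (rule summable_mult)
    then have "summable (\<lambda>n. case n of 0 \<Rightarrow> 0 | Suc m \<Rightarrow> K * M m)"
      by (subst summable_Suc_iff[symmetric]) simp
    then have N: "summable N" unfolding N_def by (intro summable_add M(1))
    have KM: "0 \<le> K * M n" for n using K(1) M(2) by simp
    have "(norm (fa n x) \<le> N n \<and> norm (fst (picard z n) x) \<le> N n)
      \<and> (norm (fc n x) \<le> N n \<and> norm (snd (picard z n) x) \<le> N n)" if x: "\<bar>x\<bar> \<le> R" for n x
    proof (cases n)
      case 0
      then show ?thesis using M(3)[OF x, of 0] M(2)[of 0] by (simp add: N_def fa_def fc_def)
    next
      case (Suc m)
      have "norm (fa n x) \<le> K * M m" "norm (fc n x) \<le> K * M m"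
        unfolding Suc fa_def fc_def nat.case
        using rhs_bound[where a="fst (picard z m)" and c="snd (picard z m)" and x=x, OF K order_refl conjunct1[OF M(3)[OF x, of m]] conjunct2[OF M(3)[OF x, of m]]] by auto
      then show ?thesis using M(2)[of n] M(3)[OF x, of n] KM[of m] by (auto simp: N_def Suc)
    qed
    then show ?thesis using N by blast
  qed
  have 1: "(solA z has_vector_derivative (\<Sum>n. fa n x)) (at x)" for x
    unfolding solA_def[abs_def]
  proof (rule has_vector_derivative_series_real[OF da])
    fix R show "\<exists>M. summable M \<and> (\<forall>n x. \<bar>x\<bar> \<le> R \<longrightarrow> norm (fa n x) \<le> M n \<and> norm (fst (picard z n) x) \<le> M n)"
      using maj[of R] by blast
  qed
  have 2: "(solC z has_vector_derivative (\<Sum>n. fc n x)) (at x)" for x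
    unfolding solC_def[abs_def]
  proof (rule has_vector_derivative_series_real[OF dc])
    fix R show "\<exists>M. summable M \<and> (\<forall>n x. \<bar>x\<bar> \<le> R \<longrightarrow> norm (fc n x) \<le> M n \<and> norm (snd (picard z n) x) \<le> M n)"
      using maj[of R] by blast
  qed
  have sa: "(\<lambda>n. fa (Suc n) x) sums (of_real (al x) * solA z x + of_real (be x) * solC z x)" for x
    unfolding fa_def solA_def solC_def nat.case
    by (intro sums_add sums_mult summable_sums picard_summable)
  have sc: "(\<lambda>n. fc (Suc n) x) sums ((of_real (ka x) - z * of_real (rh x)) * solA z x - of_real (al x) * solC z x)" for x
    unfolding fc_def solA_def solC_def nat.case
    by (intro sums_diff sums_mult summable_sums picard_summable)
  have "(\<Sum>n. fa n x) = of_real (al x) * solA z x + of_real (be x) * solC z x" for x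
    using sums_Suc[OF sa[of x]] by (simp add: fa_def sums_iff)
  moreover have "(\<Sum>n. fc n x) = (of_real (ka x) - z * of_real (rh x)) * solA z x - of_real (al x) * solC z x" for x
    using sums_Suc[OF sc[of x]] by (simp add: fc_def sums_iff)
  ultimately show ?thesis unfolding homsol_def using 1 2 by metis
qed

lemma sol_holomorphic: "(\<lambda>z. solA z x) holomorphic_on UNIV" "(\<lambda>z. solC z x) holomorphic_on UNIV"
proof -
  have ul: "\<exists>d>0. cball z d \<subseteq> UNIV \<and> uniform_limit (cball z d) (\<lambda>n z. \<Sum>i<n. fst (picard z i) x) (\<lambda>z. solA z x) sequentially
       \<and> uniform_limit (cball z d) (\<lambda>n z. \<Sum>i<n. snd (picard z i) x) (\<lambda>z. solC z x) sequentially" for z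
  proof (intro exI[of _ 1] conjI)
    obtain M where M: "summable M"
        "\<And>w n. norm w \<le> norm z + 1 \<Longrightarrow> norm (fst (picard w n) x) \<le> M n \<and> norm (snd (picard w n) x) \<le> M n"
      using picard_majorant[of "norm z + 1" "\<bar>x\<bar>"] by (metis order_refl)
    have w: "norm w \<le> norm z + 1" if "w \<in> cball z 1" for w
      using that norm_triangle_sub[of w z] by (simp add: dist_norm norm_minus_commute)
    show "uniform_limit (cball z 1) (\<lambda>n z. \<Sum>i<n. fst (picard z i) x) (\<lambda>z. solA z x) sequentially"
      unfolding solA_def by (rule Weierstrass_m_test[OF _ M(1)]) (use M(2) w in blast)
    show "uniform_limit (cball z 1) (\<lambda>n z. \<Sum>i<n. snd (picard z i) x) (\<lambda>z. solC z x) sequentially"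
      unfolding solC_def by (rule Weierstrass_m_test[OF _ M(1)]) (use M(2) w in blast)
  qed auto
  have "(\<lambda>z. \<Sum>i<n. fst (picard z i) x) holomorphic_on UNIV" "(\<lambda>z. \<Sum>i<n. snd (picard z i) x) holomorphic_on UNIV" for n
    by (intro holomorphic_intros polyfam_holomorphic conjunct1[OF picard_polyfam] conjunct2[OF picard_polyfam])+
  note hol = this
  show "(\<lambda>z. solA z x) holomorphic_on UNIV"
    using ul by (intro holomorphic_uniform_sequence[OF open_UNIV hol(1), of "\<lambda>n. n"]) blast
  show "(\<lambda>z. solC z x) holomorphic_on UNIV"
    using ul by (intro holomorphic_uniform_sequence[OF open_UNIV hol(2), of "\<lambda>n. n"]) blast
qed

end

end

section \<open>Floquet solutions\<close>

lemma nullvector_2x2: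
  fixes p q r s :: complex
  assumes "p * s = q * r"
  obtains x y where "(x, y) \<noteq> (0, 0)" "p * x + q * y = 0" "r * x + s * y = 0"
proof (cases "p = 0 \<and> q = 0")
  case True
  show ?thesis
  proof (cases "r = 0 \<and> s = 0")
    case True
    then show ?thesis using \<open>p = 0 \<and> q = 0\<close> that[of 1 0] by simp
  next
    case False
    then show ?thesis using \<open>p = 0 \<and> q = 0\<close> that[of s "- r"] by auto
  qed
next
  case False
  then show ?thesis using assms that[of q "- p"] by (auto simp: algebra_simps)
qed

text \<open>For \<open>d = 2 * cos theta\<close> the roots are \<open>exp (i theta)\<close> and its
  conjugate, which coincide when \<open>d\<close> is 2 or -2. The last conclusion speaks of every
  root, as is needed to exclude decaying Floquet solutions in a band.\<close>

lemma unimodular_root: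
  fixes d :: real
  assumes "\<bar>d\<bar> \<le> 2"
  obtains r :: complex where "cmod r = 1" "r * r - of_real d * r + 1 = 0"
    "\<And>w. w * w - of_real d * w + 1 = 0 \<Longrightarrow> cmod w = 1"
proof -
  define h where "h = sqrt (4 - d\<^sup>2)"
  have "d\<^sup>2 \<le> 4" using assms abs_le_square_iff[of d 2] by simp
  then have h: "h\<^sup>2 = 4 - d\<^sup>2" by (simp add: h_def)
  define r where "r = Complex (d / 2) (h / 2)"
  have 1: "cmod r = 1" by (simp add: r_def cmod_def power_divide h field_simps)
  have fac: "w * w - of_real d * w + 1 = (w - r) * (w - cnj r)" for w
  proof -
    have "(w - r) * (w - cnj r) = w * w - (r + cnj r) * w + r * cnj r" by (simp add: algebra_simps)
    moreover have "r + cnj r = of_real d" by (simp add: r_def complex_add_cnj)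
    moreover have "r * cnj r = 1" using 1 by (simp add: complex_norm_square[symmetric])
    ultimately show ?thesis by simp
  qed
  show thesis
  proof (rule that[OF 1])
    show "r * r - of_real d * r + 1 = 0" by (simp add: fac)
    show "cmod w = 1" if "w * w - of_real d * w + 1 = 0" for w
      using that 1 by (auto simp: fac)
  qed
qed

lemma set_integral_unit_tendsto_0:
  fixes g :: "real \<Rightarrow> real"
  assumes "integrable lborel g"
  shows "(\<lambda>n. LINT x:{real n..real n + 1}|lborel. g x) \<longlonglongrightarrow> 0"
    and "(\<lambda>n. LINT x:{- real n..- real n + 1}|lborel. g x) \<longlonglongrightarrow> 0"
proof -
  have gm: "g \<in> borel_measurable lborel" using assms by (rule borel_measurable_integrable)
  have *: "(\<lambda>n. \<integral>x. indicator (A n) x *\<^sub>R g x \<partial>lborel) \<longlonglongrightarrow> integral\<^sup>L lborel (\<lambda>x::real. 0)"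
    if "\<And>n. A n \<in> sets lborel" "\<And>x. \<forall>\<^sub>F n in sequentially. x \<notin> A n" for A :: "nat \<Rightarrow> real set"
  proof (rule integral_dominated_convergence[where w="\<lambda>x. \<bar>g x\<bar>" and f="\<lambda>x. 0" and s="\<lambda>n x. indicator (A n) x *\<^sub>R g x"])
    show "AE x in lborel. (\<lambda>n. indicator (A n) x *\<^sub>R g x) \<longlonglongrightarrow> 0"
    proof (rule AE_I2, rule tendsto_eventually)
      fix x show "\<forall>\<^sub>F n in sequentially. indicator (A n) x *\<^sub>R g x = 0"
        using that(2)[of x] by eventually_elim simp
    qed
    show "(\<lambda>x. indicator (A n) x *\<^sub>R g x) \<in> borel_measurable lborel" for n
      using that(1) gm by (intro borel_measurable_scaleR borel_measurable_indicator)
    show "AE x in lborel. norm (indicator (A n) x *\<^sub>R g x) \<le> \<bar>g x\<bar>" for n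
      by (auto simp: indicator_def)
  qed (use assms in auto)
  have e: "\<forall>\<^sub>F n in sequentially. \<bar>x\<bar> + 1 < real n" for x :: real
    using filterlim_at_top_dense[THEN iffD1, OF filterlim_real_sequentially] by blast
  have e1: "\<forall>\<^sub>F n in sequentially. x \<notin> {real n..real n + 1}" for x :: real
    using e[of x] by eventually_elim auto
  have e2: "\<forall>\<^sub>F n in sequentially. x \<notin> {- real n..- real n + 1}" for x :: real
    using e[of x] by eventually_elim auto
  show "(\<lambda>n. LINT x:{real n..real n + 1}|lborel. g x) \<longlonglongrightarrow> 0"
    unfolding set_lebesgue_integral_def
    using *[of "\<lambda>n. {real n..real n + 1}", OF _ e1] by simp
  show "(\<lambda>n. LINT x:{- real n..- real n + 1}|lborel. g x) \<longlonglongrightarrow> 0"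
    unfolding set_lebesgue_integral_def
    using *[of "\<lambda>n. {- real n..- real n + 1}", OF _ e2] by simp
qed

context hill
begin

text \<open>First order form of \<open>S(q) u = z u + f\<close> for \<open>u = E a\<close>. The
  datum is multiplied by \<open>E\<close> because \<open>c\<close> contains \<open>E w\<close>; as
  \<open>f\<close> will only be square integrable, derivatives are taken in the sense of
  \<open>loc_AC\<close>.\<close>

definition insol :: "complex \<Rightarrow> (real \<Rightarrow> complex) \<Rightarrow> (real \<Rightarrow> complex) \<Rightarrow> (real \<Rightarrow> complex) \<Rightarrow> bool" where
  "insol z f a c \<longleftrightarrow>
     loc_AC a (\<lambda>x. rA a c x) \<and>
     loc_AC c (\<lambda>x. rC z a c x - of_real (E x) * f x)"

lemma rhs_continuous:
  assumes "continuous_on UNIV a" "continuous_on UNIV c"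
  shows "continuous_on UNIV (\<lambda>x. of_real (al x) * a x + of_real (be x) * (c x :: complex))"
    and "continuous_on UNIV (\<lambda>x. (of_real (ka x) - z * of_real (rh x)) * a x - of_real (al x) * (c x :: complex))"
  using assms by (intro continuous_intros cont_al cont_be cont_ka cont_rh; simp)+

lemma homsol_continuous:
  assumes "homsol z a c"
  shows "continuous_on S a" "continuous_on S c"
proof -
  show "continuous_on S a"
    by (rule continuous_of_derivative[of a "\<lambda>x. rA a c x"])
      (use assms in \<open>simp add: homsol_def\<close>)
  show "continuous_on S c"
    by (rule continuous_of_derivative[of c "\<lambda>x. rC z a c x"])
      (use assms in \<open>simp add: homsol_def\<close>)
qed

lemma homsol_iff_insol: "homsol z a c \<longleftrightarrow> insol z (\<lambda>_. 0) a c"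
proof
  assume h: "homsol z a c"
  show "insol z (\<lambda>_. 0) a c"
    unfolding insol_def mult_zero_right diff_0_right
    using h rhs_continuous(1)[OF homsol_continuous[OF h]] rhs_continuous(2)[OF homsol_continuous[OF h], of z]
    by (auto simp: homsol_def intro!: loc_AC_of_derivative)
next
  assume i: "insol z (\<lambda>_. 0) a c"
  then have "continuous_on UNIV a" "continuous_on UNIV c"
    by (auto simp: insol_def intro: loc_AC_continuous)
  note cs = rhs_continuous(1)[OF this] rhs_continuous(2)[OF this, of z]
  show "homsol z a c"
    using i cs unfolding insol_def homsol_def mult_zero_right diff_0_right
    by (auto intro!: loc_AC_derivative)
qed

text \<open>Green's identity for the system: all coefficient terms cancel because the matrix is
  trace free and both solutions share \<open>z\<close>, so only the data survive.\<close>

lemma wronskian: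
  assumes "insol z f a c" "insol z g b d"
  shows "loc_AC (\<lambda>x. a x * d x - c x * b x) (\<lambda>x. of_real (E x) * (f x * b x - g x * a x))"
proof -
  have "loc_AC (\<lambda>x. 1 * (a x * d x) + (- 1) * (c x * b x))
     (\<lambda>x. 1 * ((rA a c x) * d x
           + a x * (rC z b d x - of_real (E x) * g x))
        + (- 1) * ((rC z a c x - of_real (E x) * f x) * b x
           + c x * (rA b d x)))"
    using assms unfolding insol_def by (intro loc_AC_lincomb loc_AC_mult) auto
  then show ?thesis by (simp add: algebra_simps)
qed

lemma wronskian_homsol:
  assumes "homsol z a c" "homsol z b d"
  shows "a x * d x - c x * b x = a y * d y - c y * b y"
proof -
  have *: "a y * d y - c y * b y = a x * d x - c x * b x" if "x \<le> y" for x y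
    using loc_AC_diff[OF wronskian[OF assms[unfolded homsol_iff_insol]] that]
    by (simp add: set_lebesgue_integral_def)
  show ?thesis using *[of x y] *[of y x] by (cases "x \<le> y") auto
qed

section \<open>Fundamental matrix, monodromy and discriminant\<close>

definition thA where "thA = solA 1 0"
definition thC where "thC = solC 1 0"
definition phA where "phA = solA 0 1"
definition phC where "phC = solC 0 1"

lemma fundamental_homsol: "homsol z (thA z) (thC z)" "homsol z (phA z) (phC z)"
  by (simp_all add: thA_def thC_def phA_def phC_def sol_homsol)

lemma fundamental_initial [simp]: "thA z 0 = 1" "thC z 0 = 0" "phA z 0 = 0" "phC z 0 = 1"
  by (simp_all add: thA_def thC_def phA_def phC_def sol_initial)

lemma fundamental_det: "thA z x * phC z x - thC z x * phA z x = 1"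
  using wronskian_homsol[OF fundamental_homsol, of z x 0] by simp

text \<open>Cramer's rule for the fundamental matrix, which has determinant 1.\<close>
lemma fundamental_expand:
  fixes a c :: complex
  shows
  "a = (a * phC z x - c * phA z x) * thA z x + (c * thA z x - a * thC z x) * phA z x"
  "c = (a * phC z x - c * phA z x) * thC z x + (c * thA z x - a * thC z x) * phC z x"
  using fundamental_det[of z x] by algebra+

text \<open>Constant Wronskians with the two fundamental solutions recover the initial values from
  the values at \<open>x\<close>. Uniqueness for the initial value problem
  (\<open>homsol_eqI\<close>) follows from this.\<close>

lemma homsol_repr:
  assumes "homsol z a c"
  shows "a x = a 0 * thA z x + c 0 * phA z x" "c x = a 0 * thC z x + c 0 * phC z x"
proof -
  have 1: "a x * phC z x - c x * phA z x = a 0"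
    using wronskian_homsol[OF assms fundamental_homsol(2), of x 0] by simp
  have 2: "c x * thA z x - a x * thC z x = c 0"
    using wronskian_homsol[OF fundamental_homsol(1) assms, of x 0] by (simp add: algebra_simps)
  show "a x = a 0 * thA z x + c 0 * phA z x" "c x = a 0 * thC z x + c 0 * phC z x"
    using fundamental_expand[where a="a x" and c="c x" and z=z and x=x] unfolding 1 2 by auto
qed

lemma homsol_lincomb:
  assumes "homsol z a c" "homsol z b d"
  shows "homsol z (\<lambda>x. k * a x + l * b x) (\<lambda>x. k * c x + l * d x)"
proof -
  have "((\<lambda>x. k * a x + l * b x) has_vector_derivative k * (rA a c x) + l * (rA b d x)) (at x)"
    "((\<lambda>x. k * c x + l * d x) has_vector_derivative k * (rC z a c x)
       + l * (rC z b d x)) (at x)" for x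
    using assms unfolding homsol_def
    by (auto intro!: has_vector_derivative_add has_vector_derivative_mult_right)
  then show ?thesis unfolding homsol_def by (simp add: algebra_simps)
qed

lemma homsol_fundamental: "homsol z (\<lambda>x. s * thA z x + t * phA z x) (\<lambda>x. s * thC z x + t * phC z x)"
  by (intro homsol_lincomb fundamental_homsol)

lemma homsol_zero:
  assumes "homsol z a c" "a x = 0" "c x = 0"
  shows "a 0 = 0" "c 0 = 0"
  using wronskian_homsol[OF assms(1) fundamental_homsol(2), of x 0]
    wronskian_homsol[OF assms(1) fundamental_homsol(1), of x 0] assms(2,3) by simp_all

lemma homsol_shift:
  assumes "homsol z a c"
  shows "homsol z (\<lambda>x. a (x + of_int n)) (\<lambda>x. c (x + of_int n))"
proof -
  have p: "al (x + of_int n) = al x" "be (x + of_int n) = be x" "ka (x + of_int n) = ka x" "rh (x + of_int n) = rh x" for x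
    using periodic_shift_int[of al, OF per_al] periodic_shift_int[of be, OF per_be]
      periodic_shift_int[of ka, OF per_ka] periodic_shift_int[of rh, OF per_rh] by auto
  have sh: "((\<lambda>x. f (x + of_int n)) has_vector_derivative f') (at x)"
    if "(f has_vector_derivative f') (at (x + of_int n))" for f :: "real \<Rightarrow> complex" and f' x
  proof -
    have "((\<lambda>x. x + of_int n) has_vector_derivative (1::real)) (at x)"
      by (auto intro!: derivative_eq_intros)
    from vector_diff_chain_at[OF this that] show ?thesis by (simp add: o_def)
  qed
  show ?thesis
    unfolding homsol_def
  proof (intro conjI allI sh)
    fix x
    show "(a has_vector_derivative of_real (al x) * a (x + of_int n) + of_real (be x) * c (x + of_int n)) (at (x + of_int n))"
      using assms p[of x] unfolding homsol_def by metis
    show "(c has_vector_derivative (of_real (ka x) - z * of_real (rh x)) * a (x + of_int n) - of_real (al x) * c (x + of_int n)) (at (x + of_int n))"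
      using assms p[of x] unfolding homsol_def by metis
  qed
qed

lemma homsol_shift1:
  assumes "homsol z a c"
  shows "homsol z (\<lambda>x. a (x + 1)) (\<lambda>x. c (x + 1))"
  using homsol_shift[OF assms, of 1] by simp

lemma homsol_eqI:
  assumes "homsol z a c" "homsol z b d" "a 0 = b 0" "c 0 = d 0"
  shows "a x = b x" "c x = d x"
  using homsol_repr[OF assms(1), of x] homsol_repr[OF assms(2), of x] assms(3,4) by simp_all

definition Delta :: "complex \<Rightarrow> complex" where "Delta z = thA z 1 + phC z 1"

text \<open>Cayley-Hamilton for the monodromy matrix, which has determinant 1 and trace
  \<open>Delta z\<close>, applied to the values at consecutive integers.\<close>

lemma homsol_cayley:
  assumes "homsol z a c"
  shows "a (of_int n + 2) + a (of_int n) = Delta z * a (of_int n + 1)"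
    "c (of_int n + 2) + c (of_int n) = Delta z * c (of_int n + 1)"
proof -
  have s: "homsol z (\<lambda>x. a (x + of_int n)) (\<lambda>x. c (x + of_int n))" by (rule homsol_shift[OF assms])
  note 0 = homsol_repr[OF s, of 1, simplified]
  note 1 = homsol_repr[OF homsol_shift1[OF s], of 1, simplified]
  have d: "thA z 1 * phC z 1 - thC z 1 * phA z 1 = 1" by (rule fundamental_det)
  have *: "(u * p + v * q) * p + (u * r + v * s) * q + u = (p + s) * (u * p + v * q)"
    "(u * p + v * q) * r + (u * r + v * s) * s + v = (p + s) * (u * r + v * s)"
    if "p * s - r * q = 1" for p q r s u v :: complex
    using that by algebra+
  have e: "1 + (1 + of_int n) = (of_int n + 2 :: real)" "1 + of_int n = (of_int n + 1 :: real)" by simp_all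
  show "a (of_int n + 2) + a (of_int n) = Delta z * a (of_int n + 1)"
    "c (of_int n + 2) + c (of_int n) = Delta z * c (of_int n + 1)"
    using 0 1 *[OF d, of "a (of_int n)" "c (of_int n)"] unfolding Delta_def e
    by (simp_all add: add.commute)
qed

text \<open>The hypothesis says \<open>det (M - r) = 0\<close> for the monodromy matrix
  \<open>M\<close>. A null vector supplies the initial values, and uniqueness extends the multiplier
  relation from 0 to all \<open>x\<close>.\<close>

lemma floquet_solution:
  assumes "r * r - Delta z * r + 1 = 0"
  obtains a c where "homsol z a c" "(a 0, c 0) \<noteq> (0, 0)" "\<And>x. a (x + 1) = r * a x" "\<And>x. c (x + 1) = r * c x"
proof -
  have "(thA z 1 - r) * (phC z 1 - r) = phA z 1 * thC z 1"
    using assms fundamental_det[of z 1] unfolding Delta_def by algebra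
  then obtain s t where st: "(s, t) \<noteq> (0, 0)" "(thA z 1 - r) * s + phA z 1 * t = 0" "thC z 1 * s + (phC z 1 - r) * t = 0"
    by (rule nullvector_2x2)
  define a where "a = (\<lambda>x. s * thA z x + t * phA z x)"
  define c where "c = (\<lambda>x. s * thC z x + t * phC z x)"
  have h: "homsol z a c" unfolding a_def c_def by (rule homsol_fundamental)
  have "homsol z (\<lambda>x. r * a x + 0 * a x) (\<lambda>x. r * c x + 0 * c x)"
    by (rule homsol_lincomb[OF h h])
  then have h2: "homsol z (\<lambda>x. r * a x) (\<lambda>x. r * c x)" by simp
  have i: "a (0 + 1) = r * a 0" "c (0 + 1) = r * c 0"
    using st(2,3) by (simp_all add: a_def c_def algebra_simps)
  show thesis
  proof (rule that[OF h])
    show "(a 0, c 0) \<noteq> (0, 0)" using st(1) by (simp add: a_def c_def)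
    show "a (x + 1) = r * a x" "c (x + 1) = r * c x" for x
      using homsol_eqI[OF homsol_shift1[OF h] h2 i, of x] by auto
  qed
qed

lemma floquet_multiplier:
  assumes "homsol z a c" "(a 0, c 0) \<noteq> (0, 0)" "\<And>x. a (x + 1) = r * a x" "\<And>x. c (x + 1) = r * c x"
  shows "r * r - Delta z * r + 1 = 0"
proof -
  have "a 2 = r * (r * a 0)" "a 1 = r * a 0" "c 2 = r * (r * c 0)" "c 1 = r * c 0"
    using assms(3)[of 1] assms(3)[of 0] assms(4)[of 1] assms(4)[of 0] by simp_all
  then have "(r * r - Delta z * r + 1) * a 0 = 0" "(r * r - Delta z * r + 1) * c 0 = 0"
    using homsol_cayley[OF assms(1), of 0] by (simp_all add: algebra_simps)
  then show ?thesis using assms(2) by auto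
qed

lemma homsol_cnj:
  assumes "homsol z a c"
  shows "homsol (cnj z) (\<lambda>x. cnj (a x)) (\<lambda>x. cnj (c x))"
proof -
  have "((\<lambda>x. cnj (a x)) has_vector_derivative cnj (rA a c x)) (at x)"
    "((\<lambda>x. cnj (c x)) has_vector_derivative cnj (rC z a c x)) (at x)" for x
    using assms unfolding homsol_def by (auto intro!: has_vector_derivative_cnj simp del: complex_cnj_add complex_cnj_mult complex_cnj_diff)
  then show ?thesis unfolding homsol_def by simp
qed

lemma Delta_cnj: "Delta (cnj z) = cnj (Delta z)"
proof -
  have "cnj (thA z 1) = thA (cnj z) 1"
    by (rule homsol_eqI(1)[OF homsol_cnj[OF fundamental_homsol(1)] fundamental_homsol(1)]) auto
  moreover have "cnj (phC z 1) = phC (cnj z) 1"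
    by (rule homsol_eqI(2)[OF homsol_cnj[OF fundamental_homsol(2)] fundamental_homsol(2)]) auto
  ultimately show ?thesis by (simp add: Delta_def)
qed

lemma Delta_real: "Im (Delta (of_real l)) = 0"
  using Delta_cnj[of "of_real l"] by (simp add: complex_eq_iff)

lemma Delta_holomorphic: "Delta holomorphic_on S"
proof -
  have "(\<lambda>z. thA z 1 + phC z 1) holomorphic_on UNIV"
    unfolding thA_def phC_def by (intro holomorphic_intros sol_holomorphic)
  then show ?thesis unfolding Delta_def[abs_def] by (rule holomorphic_on_subset) simp
qed

text \<open>Lagrange's identity: \<open>al\<close>, \<open>be\<close> and \<open>ka\<close> are real
  and drop out of the imaginary part, leaving the parameter with its weight. This is where symmetry
  of the operator enters.\<close>

lemma homsol_deriv_Im: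
  assumes "homsol z a c"
  shows "((\<lambda>x. Im (a x * cnj (c x))) has_real_derivative Im z * rh x * (cmod (a x))\<^sup>2) (at x)"
proof -
  have a: "(a has_vector_derivative rA a c x) (at x)"
    and c: "(c has_vector_derivative rC z a c x) (at x)"
    using assms by (auto simp: homsol_def)
  have "((\<lambda>x. Im (a x * cnj (c x))) has_vector_derivative
      Im (a x * cnj (rC z a c x)
        + (rA a c x) * cnj (c x))) (at x)"
    by (intro bounded_linear.has_vector_derivative[OF bounded_linear_Im] has_vector_derivative_mult
        has_vector_derivative_cnj a c)
  moreover have "Im (a x * cnj (rC z a c x)
        + (rA a c x) * cnj (c x)) = Im z * rh x * (cmod (a x))\<^sup>2"
    unfolding cmod_power2 by (simp add: algebra_simps power2_eq_square)
  ultimately show ?thesis by (simp add: has_real_derivative_iff_has_vector_derivative)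
qed

text \<open>Where \<open>a\<close> vanishes on an interval so does its derivative, and
  \<open>be > 0\<close> then forces \<open>c\<close> to vanish as well.\<close>

lemma homsol_zero_of_interval:
  assumes h: "homsol z a c" and z: "\<And>x. x \<in> {0<..<1} \<Longrightarrow> a x = 0"
  shows "a 0 = 0" "c 0 = 0"
proof -
  have "(a has_vector_derivative of_real (al (1/2)) * a (1/2) + of_real (be (1/2)) * c (1/2)) (at (1/2))"
    using h by (simp add: homsol_def)
  moreover have "(a has_vector_derivative 0) (at (1/2))"
    by (rule has_vector_derivative_transform_within_open[of "\<lambda>_. 0" _ _ "{0<..<1}"]) (use z in auto)
  ultimately have "of_real (al (1/2)) * a (1/2) + of_real (be (1/2)) * c (1/2) = 0"
    by (rule vector_derivative_unique_at)
  then have "c (1/2) = 0" "a (1/2) = 0" using z[of "1/2"] be_pos[of "1/2"] by auto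
  then show "a 0 = 0" "c 0 = 0" using homsol_zero[OF h] by auto
qed

text \<open>For a Floquet solution with unimodular multiplier, \<open>Im (a * cnj c)\<close> agrees
  at 0 and 1. Divided by a nonzero \<open>Im z\<close> it would be nondecreasing with derivative
  \<open>rh |a|^2\<close>, hence constant, so that \<open>a\<close> would vanish on the
  cell.\<close>

lemma Delta_band_real:
  assumes "Delta z = of_real d" "\<bar>d\<bar> \<le> 2"
  shows "Im z = 0"
proof (rule ccontr)
  assume nz: "Im z \<noteq> 0"
  obtain r where r: "cmod r = 1" "r * r - Delta z * r + 1 = 0"
    using unimodular_root[OF assms(2)] assms(1) by metis
  obtain a c where h: "homsol z a c" and n: "(a 0, c 0) \<noteq> (0, 0)"
    and s: "\<And>x. a (x + 1) = r * a x" "\<And>x. c (x + 1) = r * c x"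
    using floquet_solution[OF r(2)] by metis
  define g where "g x = Im (a x * cnj (c x)) / Im z" for x
  have d: "(g has_real_derivative rh x * (cmod (a x))\<^sup>2) (at x)" for x
    using DERIV_cdivide[OF homsol_deriv_Im[OF h], of "Im z"] nz by (simp add: g_def[abs_def])
  have "a 1 * cnj (c 1) = (r * cnj r) * (a 0 * cnj (c 0))"
    using s[of 0] by (simp add: algebra_simps)
  moreover have "r * cnj r = 1" using r(1) by (simp add: complex_norm_square[symmetric])
  ultimately have g01: "g 1 = g 0" by (simp add: g_def)
  have mono: "g x \<le> g y" if "x \<le> y" for x y
    by (rule DERIV_nonneg_imp_nondecreasing[OF that]) (meson d rh_pos less_imp_le mult_nonneg_nonneg zero_le_power2)
  have const: "g x = g 0" if "x \<in> {0<..<1}" for x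
    using mono[of 0 x] mono[of x 1] that g01 by auto
  have "a x = 0" if x: "x \<in> {0<..<1}" for x
  proof -
    have "(g has_real_derivative 0) (at x)"
      by (rule has_field_derivative_transform_within_open[of "\<lambda>_. g 0" _ _ "{0<..<1}"]) (use const x in auto)
    from DERIV_unique[OF this d[of x]] show ?thesis using rh_pos[of x] by auto
  qed
  from homsol_zero_of_interval[OF h this] n show False by simp
qed

end

section \<open>Growth and decay\<close>

lemma periodic_continuous_lower_bound:
  fixes f :: "real \<Rightarrow> real"
  assumes "\<And>x. f (x + 1) = f x" "continuous_on UNIV f" "\<And>x. f x > 0"
  obtains m where "m > 0" "\<And>x. m \<le> f x"
proof -
  have "continuous_on UNIV (\<lambda>x. 1 / f x)"
    using assms(3) by (intro continuous_intros assms(2)) (metis less_irrefl)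
  then obtain B where B: "\<And>x. \<bar>1 / f x\<bar> \<le> B"
    using periodic_continuous_bounded[of "\<lambda>x. 1 / f x"] assms(1) by auto
  have "B > 0" using B[of 0] assms(3)[of 0] by (smt (verit) zero_less_divide_1_iff)
  moreover have "1 / B \<le> f x" for x
    using B[of x] assms(3)[of x] \<open>B > 0\<close> by (simp add: field_simps)
  ultimately show thesis using that[of "1 / B"] by simp
qed

context hill
begin

text \<open>For negative spectral parameter the product of the two components of the solution starting
  at (1, 1) grows exponentially, because the arithmetic-geometric mean inequality bounds its
  logarithmic derivative from below.\<close>
lemma Delta_growth:
  obtains k T where "k > 0" "\<And>t. t \<ge> T \<Longrightarrow> Re (Delta (of_real (- t))) \<ge> exp (k * sqrt t)"
proof -
  obtain b0 where b0: "b0 > 0" "\<And>x. b0 \<le> be x"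
    using periodic_continuous_lower_bound[of be, OF per_be cont_be be_pos] by auto
  obtain r0 where r0: "r0 > 0" "\<And>x. r0 \<le> rh x"
    using periodic_continuous_lower_bound[of rh, OF per_rh cont_rh rh_pos] by auto
  obtain K where K: "\<And>x. \<bar>ka x\<bar> \<le> K"
    using periodic_continuous_bounded[of ka, OF per_ka cont_ka] by auto
  have K0: "K \<ge> 0" using K[of 0] by linarith
  \<comment> \<open>\<open>k * sqrt t\<close> will be \<open>p * q\<close>, half the exponential
    rate \<open>m\<close> of \<open>P\<close>. The choice of \<open>T\<close> lets
    \<open>t * r0 / 2\<close> absorb \<open>K\<close>, so that
    \<open>ka + t * rh >= t * r0 / 2\<close>.\<close>
  define k where "k = sqrt (b0 * r0 / 2)"
  define T where "T = 2 * K / r0"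
  have "exp (k * sqrt t) \<le> Re (Delta (of_real (- t)))" if t: "t \<ge> T" for t
  proof -
    have "0 \<le> T" using K0 r0(1) by (simp add: T_def)
    then have t0: "t \<ge> 0" using t by linarith
    have tr: "K \<le> t * r0 / 2" using t r0(1) by (simp add: T_def field_simps)
    define z where "z = complex_of_real (- t)"
    define p where "p = sqrt b0"
    define q where "q = sqrt (t * r0 / 2)"
    define m where "m = 2 * p * q"
    have m: "m / 2 = k * sqrt t"
      by (simp add: m_def p_def q_def k_def flip: real_sqrt_mult)
    have pq: "p\<^sup>2 = b0" "q\<^sup>2 = t * r0 / 2"
      using b0(1) r0(1) t0 by (simp_all add: p_def q_def)
    define a where "a x = Re (1 * thA z x + 1 * phA z x)" for x
    define c where "c x = Re (1 * thC z x + 1 * phC z x)" for x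
    have h: "homsol z (\<lambda>x. 1 * thA z x + 1 * phA z x) (\<lambda>x. 1 * thC z x + 1 * phC z x)"
      by (rule homsol_fundamental)
    have da: "(a has_real_derivative al x * a x + be x * c x) (at x)" for x
    proof -
      have "(a has_vector_derivative Re (of_real (al x) * (1 * thA z x + 1 * phA z x) + of_real (be x) * (1 * thC z x + 1 * phC z x))) (at x)"
        unfolding a_def[abs_def] using h unfolding homsol_def
        by (intro bounded_linear.has_vector_derivative[OF bounded_linear_Re]) blast
      then show ?thesis by (simp add: a_def c_def has_real_derivative_iff_has_vector_derivative)
    qed
    have dc: "(c has_real_derivative (ka x + t * rh x) * a x - al x * c x) (at x)" for x
    proof -
      have "(c has_vector_derivative Re ((of_real (ka x) - z * of_real (rh x)) * (1 * thA z x + 1 * phA z x) - of_real (al x) * (1 * thC z x + 1 * phC z x))) (at x)"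
        unfolding c_def[abs_def] using h unfolding homsol_def
        by (intro bounded_linear.has_vector_derivative[OF bounded_linear_Re]) blast
      then show ?thesis by (simp add: a_def c_def z_def has_real_derivative_iff_has_vector_derivative)
    qed
    define P where "P x = a x * c x" for x
    define P' where "P' x = be x * (c x)\<^sup>2 + (ka x + t * rh x) * (a x)\<^sup>2" for x
    have dP: "(P has_real_derivative P' x) (at x)" for x
      unfolding P_def[abs_def] P'_def
      by (rule derivative_eq_intros da dc refl)+ (simp add: algebra_simps power2_eq_square)
    have P'_ge: "p\<^sup>2 * (c x)\<^sup>2 + q\<^sup>2 * (a x)\<^sup>2 \<le> P' x" for x
    proof -
      have "t * r0 \<le> t * rh x" using r0(2) t0 by (rule mult_left_mono)
      then have "t * r0 / 2 \<le> ka x + t * rh x" using K[of x] tr by linarith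
      then show ?thesis unfolding P'_def pq using b0(2)[of x]
        by (intro add_mono mult_right_mono) auto
    qed
    have P'_nonneg: "0 \<le> P' x" for x
      by (rule order_trans[OF _ P'_ge]) simp
    have P'_m: "m * P x \<le> P' x" for x
    proof -
      have "0 \<le> (p * c x - q * a x)\<^sup>2" by simp
      then show ?thesis using P'_ge[of x] by (simp add: m_def P_def power2_eq_square algebra_simps)
    qed
    have P0: "P 0 = 1" by (simp add: P_def a_def c_def)
    have P1: "1 \<le> P x" if "0 \<le> x" for x
      using DERIV_nonneg_imp_nondecreasing[OF that, of P] dP P'_nonneg P0 by metis
    have ca: "continuous_on S a" for S
      by (intro continuous_at_imp_continuous_on ballI DERIV_isCont[OF da])
    \<comment> \<open>Both components start at 1, and \<open>P >= 1\<close> keeps their product from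
      reaching 0, so neither can change sign.\<close>
    have apos: "a x > 0" if "0 \<le> x" for x
    proof (rule ccontr)
      assume "\<not> a x > 0"
      then have "\<exists>y. 0 \<le> y \<and> y \<le> x \<and> a y = 0"
        using that by (intro IVT2' ca) (auto simp: a_def)
      then show False using P1 unfolding P_def by fastforce
    qed
    have cpos: "c x > 0" if "0 \<le> x" for x
      using P1[OF that] apos[OF that] unfolding P_def by (smt (verit) mult_nonneg_nonpos)
    have "P 1 * exp (- m * 1) \<le> P 2 * exp (- m * 2)"
    proof (rule DERIV_nonneg_imp_nondecreasing[of 1 2 "\<lambda>x. P x * exp (- m * x)"])
      fix x :: real
      have "((\<lambda>x. P x * exp (- m * x)) has_real_derivative (P' x - m * P x) * exp (- m * x)) (at x)"
        by (rule derivative_eq_intros dP refl)+ (simp add: algebra_simps)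
      moreover have "0 \<le> (P' x - m * P x) * exp (- m * x)" using P'_m[of x] by simp
      ultimately show "\<exists>y. ((\<lambda>x. P x * exp (- m * x)) has_real_derivative y) (at x) \<and> 0 \<le> y" by blast
    qed simp
    then have "P 1 * exp (- m) * exp (2 * m) \<le> P 2 * exp (- (2 * m)) * exp (2 * m)"
      by (intro mult_right_mono) (auto simp: mult.commute)
    then have P2: "P 1 * exp m \<le> P 2"
      by (simp add: mult.assoc flip: exp_add)
    define D where "D = Re (Delta z)"
    have Dz: "Delta z = of_real D" using Delta_real[of "- t"] by (simp add: D_def z_def complex_eq_iff)
    \<comment> \<open>Cayley-Hamilton and positivity of the components give
      \<open>P 2 <= D^2 * P 1\<close>, while the growth of \<open>P\<close> over one period gives
      \<open>P 2 >= exp m * P 1\<close>. Hence \<open>D >= exp (m / 2)\<close>.\<close>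
    have Da: "a 2 + a 0 = D * a 1" and Dc: "c 2 + c 0 = D * c 1"
      using homsol_cayley[OF h, of 0] unfolding Dz a_def c_def
      by (auto dest!: arg_cong[where f=Re])
    have ge: "a 2 \<le> D * a 1" "c 2 \<le> D * c 1" using Da Dc apos[of 0] cpos[of 0] by linarith+
    have D0: "0 < D" using ge(1) apos[of 1] apos[of 2] by (smt (verit) mult_nonpos_nonneg)
    have "P 2 \<le> (D * a 1) * (D * c 1)"
      unfolding P_def using ge apos[of 2] cpos[of 2] by (intro mult_mono) auto
    then have "P 1 * exp m \<le> P 1 * D\<^sup>2" using P2 by (simp add: P_def power2_eq_square algebra_simps)
    then have "exp m \<le> D\<^sup>2" using P1[of 1] by simp
    then have "(exp (m / 2))\<^sup>2 \<le> D\<^sup>2" by (simp add: power2_eq_square flip: exp_add)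
    then have "exp (m / 2) \<le> D" by (rule power2_le_imp_le) (use D0 in simp)
    then show ?thesis by (simp add: m D_def z_def)
  qed
  moreover have "k > 0" using b0 r0 by (simp add: k_def)
  ultimately show thesis using that by blast
qed

section \<open>Cell energies and the decay of square integrable solutions\<close>

abbreviation energy :: "complex \<Rightarrow> complex \<Rightarrow> complex \<Rightarrow> real" where
  "energy z s t \<equiv> LINT x:{0..1}|lborel. rh x * (cmod (s * thA z x + t * phA z x))\<^sup>2"

text \<open>On the compact unit sphere of initial values the energy attains a minimum, which is
  positive because a solution vanishing on the cell is trivial; homogeneity of degree 2 does the
  rest.\<close>

lemma energy_lower_bound:
  obtains k where "k > 0"
    "\<And>s t. k * ((cmod s)\<^sup>2 + (cmod t)\<^sup>2) \<le> energy z s t"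
proof -
  define G where "G v x = rh x * (cmod (fst v * thA z x + snd v * phA z x))\<^sup>2" for v x
  define F where "F v = integral {0..1} (G v)" for v
  note ct = homsol_continuous(1)[OF fundamental_homsol(1)] homsol_continuous(1)[OF fundamental_homsol(2)]
  have cG: "continuous_on S (\<lambda>(v, x). G v x)" for S
    unfolding G_def split_beta
    by (intro continuous_intros continuous_on_compose2[OF cont_rh] continuous_on_compose2[OF ct(1)[of UNIV]]
        continuous_on_compose2[OF ct(2)[of UNIV]]) auto
  have cGv: "continuous_on S (G v)" for S v
    unfolding G_def by (intro continuous_intros continuous_on_subset[OF cont_rh] ct) auto
  have "continuous_on UNIV (\<lambda>v. integral (cbox 0 1) (G v))"
    by (rule integral_continuous_on_param) (rule cG)
  then have cF: "continuous_on (sphere 0 1) F"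
    unfolding F_def by (auto intro: continuous_on_subset)
  have Gnn: "0 \<le> G v x" for v x by (simp add: G_def rh_def)
  have Fint: "F v = (LINT x:{0..1}|lborel. rh x * (cmod (fst v * thA z x + snd v * phA z x))\<^sup>2)" for v
  proof -
    have "set_integrable lborel {0..1} (G v)"
      unfolding set_integrable_def by (rule borel_integrable_compact[OF compact_Icc cGv])
    from set_borel_integral_eq_integral(2)[OF this] show ?thesis by (simp add: F_def G_def)
  qed
  have ne: "sphere (0 :: complex \<times> complex) 1 \<noteq> {}" by (simp)
  obtain v0 where v0: "v0 \<in> sphere 0 1" "\<And>v. v \<in> sphere 0 1 \<Longrightarrow> F v0 \<le> F v"
    using continuous_attains_inf[OF compact_sphere ne cF] by blast
  have "F v0 \<noteq> 0"
  proof
    assume "F v0 = 0"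
    then have "\<forall>x\<in>{0..1}. G v0 x = 0"
      unfolding F_def using integral_eq_0_iff[of 0 1 "G v0"] cGv Gnn by auto
    then have "fst v0 * thA z x + snd v0 * phA z x = 0" if "x \<in> {0<..<1}" for x
      using that rh_pos[of x] less_imp_neq[OF rh_pos[of x]] by (force simp: G_def)
    from homsol_zero_of_interval[OF homsol_fundamental this]
    have "fst v0 = 0" "snd v0 = 0" by simp_all
    then have "v0 = 0" by (simp add: prod_eq_iff)
    then show False using v0(1) by simp
  qed
  moreover have "F v0 \<ge> 0" unfolding F_def
    by (intro integral_nonneg integrable_continuous_interval cGv Gnn)
  ultimately have pos: "F v0 > 0" by linarith
  have "F v0 * ((cmod s)\<^sup>2 + (cmod t)\<^sup>2) \<le> energy z s t" for s t
  proof -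
    define n where "n = norm (s, t)"
    have n2: "n\<^sup>2 = (cmod s)\<^sup>2 + (cmod t)\<^sup>2" by (simp add: n_def norm_Pair)
    show ?thesis
    proof (cases "n = 0")
      case True
      then have "s = 0 \<and> t = 0" by (simp add: n_def zero_prod_def)
      then show ?thesis by simp
    next
      case False
      define u where "u = (1 / n) *\<^sub>R (s, t)"
      have n0: "n > 0" using False by (simp add: n_def)
      then have u: "u \<in> sphere 0 1" by (simp add: u_def n_def del: scaleR_Pair)
      have st: "s = of_real n * fst u" "t = of_real n * snd u"
        using n0 by (simp_all add: u_def scaleR_conv_of_real)
      have e: "s * p + t * q = of_real n * (fst u * p + snd u * q)" for p q
        by (simp add: st algebra_simps)
      have "energy z s t = n\<^sup>2 * F u"
        unfolding Fint set_integral_mult_right[symmetric] e norm_mult power_mult_distrib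
        by (simp add: algebra_simps)
      then show ?thesis using v0(2)[OF u] n0 by (simp add: n2[symmetric] mult.commute)
    qed
  qed
  then show thesis using that pos by blast
qed

lemma energy_shift:
  assumes h: "homsol z a c"
  shows "(LINT x:{of_int n..of_int n + 1}|lborel. rh x * (cmod (a x))\<^sup>2)
     = energy z (a (of_int n)) (c (of_int n))"
proof -
  have rep: "a (of_int n + x) = a (of_int n) * thA z x + c (of_int n) * phA z x" for x
    using homsol_repr(1)[OF homsol_shift[OF h, of n], of x] by (simp add: add.commute)
  have rhp: "rh (of_int n + x) = rh x" for x
    using periodic_shift_int[of rh, OF per_rh, of x n] by (simp add: add.commute)
  have "(LINT x:{of_int n..of_int n + 1}|lborel. rh x * (cmod (a x))\<^sup>2)
    = (\<integral>x. indicator {of_int n..of_int n + 1} (of_int n + 1 * x) *\<^sub>R (rh (of_int n + 1 * x) * (cmod (a (of_int n + 1 * x)))\<^sup>2) \<partial>lborel)"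
    unfolding set_lebesgue_integral_def
    by (subst lborel_integral_real_affine[of 1 _ "of_int n"]) auto
  also have "\<dots> = energy z (a (of_int n)) (c (of_int n))"
    unfolding set_lebesgue_integral_def mult_1 rep rhp
    by (intro Bochner_Integration.integral_cong) (auto simp: indicator_def)
  finally show ?thesis .
qed

text \<open>Converts square integrability into pointwise decay: the energy of a cell controls both
  components of the solution at the left end of that cell.\<close>

lemma tendsto_0_of_energy:
  fixes s t :: "nat \<Rightarrow> complex"
  assumes "(\<lambda>n. energy z (s n) (t n)) \<longlonglongrightarrow> 0"
  shows "s \<longlonglongrightarrow> 0" "t \<longlonglongrightarrow> 0"
proof -
  obtain k where k: "k > 0"
    "\<And>s t. k * ((cmod s)\<^sup>2 + (cmod t)\<^sup>2) \<le> energy z s t"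
    using energy_lower_bound by blast
  have lim: "(\<lambda>n. sqrt (energy z (s n) (t n) / k)) \<longlonglongrightarrow> 0"
    using tendsto_real_sqrt[OF tendsto_divide[OF assms tendsto_const[of k]]] k(1) by simp
  have "cmod (s n) \<le> sqrt (energy z (s n) (t n) / k)"
    "cmod (t n) \<le> sqrt (energy z (s n) (t n) / k)" for n
  proof -
    have "(cmod (s n))\<^sup>2 + (cmod (t n))\<^sup>2 \<le> energy z (s n) (t n) / k"
      using k(2)[of "s n" "t n"] k(1) by (simp add: field_simps)
    then show "cmod (s n) \<le> sqrt (energy z (s n) (t n) / k)"
      "cmod (t n) \<le> sqrt (energy z (s n) (t n) / k)"
      by (auto intro!: real_le_rsqrt elim!: order_trans[rotated])
  qed
  then show "s \<longlonglongrightarrow> 0" "t \<longlonglongrightarrow> 0"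
    using Lim_null_comparison[OF always_eventually lim] by auto
qed

text \<open>One argument serves both half-lines. Cells are considered from \<open>n = 1\<close> on,
  since only then do \<open>[n, n + 1]\<close> and \<open>[-n, -n + 1]\<close> lie in
  \<open>{1..}\<close> and \<open>{..0}\<close>.\<close>

lemma L2_tendsto_0:
  assumes h: "homsol z a c"
    and m: "\<And>n. n \<ge> 1 \<Longrightarrow> {of_int (m n)..of_int (m n) + 1} \<subseteq> A"
    and lim: "(\<lambda>n. LINT x:{of_int (m n)..of_int (m n) + 1}|lborel. indicator A x *\<^sub>R (rh x * (cmod (a x))\<^sup>2)) \<longlonglongrightarrow> 0"
  shows "(\<lambda>n. a (of_int (m n))) \<longlonglongrightarrow> 0" "(\<lambda>n. c (of_int (m n))) \<longlonglongrightarrow> 0"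
proof -
  have "\<forall>\<^sub>F n in sequentially. (LINT x:{of_int (m n)..of_int (m n) + 1}|lborel. indicator A x *\<^sub>R (rh x * (cmod (a x))\<^sup>2))
      = energy z (a (of_int (m n))) (c (of_int (m n)))"
    using eventually_ge_at_top[of 1]
  proof eventually_elim
    case (elim n)
    have "(LINT x:{of_int (m n)..of_int (m n) + 1}|lborel. indicator A x *\<^sub>R (rh x * (cmod (a x))\<^sup>2))
      = (LINT x:{of_int (m n)..of_int (m n) + 1}|lborel. rh x * (cmod (a x))\<^sup>2)"
      by (rule set_lebesgue_integral_cong) (use m[OF elim] in auto)
    then show ?case using energy_shift[OF h, of "m n"] by simp
  qed
  from Lim_transform_eventually[OF lim this]
  show "(\<lambda>n. a (of_int (m n))) \<longlonglongrightarrow> 0" "(\<lambda>n. c (of_int (m n))) \<longlonglongrightarrow> 0"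
    by (rule tendsto_0_of_energy)+
qed

lemma L2_tendsto_right:
  assumes h: "homsol z a c" and i: "integrable lborel (\<lambda>x. indicator {1..} x *\<^sub>R (rh x * (cmod (a x))\<^sup>2))"
  shows "(\<lambda>n. a (real n)) \<longlonglongrightarrow> 0" "(\<lambda>n. c (real n)) \<longlonglongrightarrow> 0"
  using L2_tendsto_0[OF h, of int "{1..}"] set_integral_unit_tendsto_0(1)[OF i] by auto

lemma L2_tendsto_left:
  assumes h: "homsol z a c" and i: "integrable lborel (\<lambda>x. indicator {..0} x *\<^sub>R (rh x * (cmod (a x))\<^sup>2))"
  shows "(\<lambda>n. a (- real n)) \<longlonglongrightarrow> 0" "(\<lambda>n. c (- real n)) \<longlonglongrightarrow> 0"
  using L2_tendsto_0[OF h, of "\<lambda>n. - int n" "{..0}"] set_integral_unit_tendsto_0(2)[OF i] by auto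

text \<open>A vanishing Wronskian with the translate makes the values at 1 a multiple of those at 0;
  uniqueness transports the multiple to all \<open>x\<close>.\<close>

lemma floquet_of_parallel:
  assumes h: "homsol z a c" and nz: "(a 0, c 0) \<noteq> (0, 0)" and d: "a 0 * c 1 - c 0 * a 1 = 0"
  obtains r where "\<And>x. a (x + 1) = r * a x" "\<And>x. c (x + 1) = r * c x"
proof -
  obtain r where r: "a 1 = r * a 0" "c 1 = r * c 0"
  proof (cases "a 0 = 0")
    case True
    then show thesis using nz d that[of "c 1 / c 0"] by auto
  next
    case False
    then show thesis using d that[of "a 1 / a 0"] by (auto simp: field_simps)
  qed
  have "homsol z (\<lambda>x. r * a x + 0 * a x) (\<lambda>x. r * c x + 0 * c x)"
    by (rule homsol_lincomb[OF h h])
  then have h2: "homsol z (\<lambda>x. r * a x) (\<lambda>x. r * c x)" by simp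
  show thesis
  proof (rule that)
    show "a (x + 1) = r * a x" "c (x + 1) = r * c x" for x
      using homsol_eqI[OF homsol_shift1[OF h] h2, of x] r by auto
  qed
qed

text \<open>The Wronskian of the solution with its translate does not depend on \<open>x\<close>,
  yet tends to 0 along the integers. A multiplier of modulus at least 1 would keep the values at
  integers away from 0.\<close>

lemma decay_right:
  assumes h: "homsol z a c" and nz: "(a 0, c 0) \<noteq> (0, 0)"
    and l: "(\<lambda>n. a (real n)) \<longlonglongrightarrow> 0" "(\<lambda>n. c (real n)) \<longlonglongrightarrow> 0"
  obtains r where "cmod r < 1" "\<And>x. a (x + 1) = r * a x" "\<And>x. c (x + 1) = r * c x"
proof -
  have "(\<lambda>n. a (real n) * c (real (Suc n)) - c (real n) * a (real (Suc n))) \<longlonglongrightarrow> 0 * 0 - 0 * 0"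
    by (intro tendsto_intros l LIMSEQ_Suc[OF l(1)] LIMSEQ_Suc[OF l(2)])
  moreover have "a (real n) * c (real (Suc n)) - c (real n) * a (real (Suc n)) = a 0 * c 1 - c 0 * a 1" for n
    using wronskian_homsol[OF h homsol_shift1[OF h], of "real n" 0] by (simp add: add.commute)
  ultimately have "a 0 * c 1 - c 0 * a 1 = 0" by (simp add: LIMSEQ_const_iff)
  then obtain r where r: "\<And>x. a (x + 1) = r * a x" "\<And>x. c (x + 1) = r * c x"
    using floquet_of_parallel[OF h nz] by blast
  have pw: "a (real n) = r ^ n * a 0 \<and> c (real n) = r ^ n * c 0" for n
  proof (induction n)
    case (Suc n)
    then show ?case using r[of "real n"] by (simp add: add.commute)
  qed simp
  have "cmod r < 1"
  proof (rule ccontr)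
    assume "\<not> cmod r < 1"
    then have ge: "1 \<le> cmod r ^ n" for n by (simp add: one_le_power)
    have "cmod (a 0) \<le> cmod (a (real n))" "cmod (c 0) \<le> cmod (c (real n))" for n
      using pw[of n] mult_right_mono[OF ge[of n], of "cmod (a 0)"] mult_right_mono[OF ge[of n], of "cmod (c 0)"]
      by (simp_all add: norm_mult norm_power)
    then have "cmod (a 0) \<le> 0" "cmod (c 0) \<le> 0"
      using LIMSEQ_le_const[OF tendsto_norm_zero[OF l(1)], of "cmod (a 0)"]
        LIMSEQ_le_const[OF tendsto_norm_zero[OF l(2)], of "cmod (c 0)"] by blast+
    then show False using nz by simp
  qed
  then show thesis using that r by blast
qed

lemma decay_left:
  assumes h: "homsol z a c" and nz: "(a 0, c 0) \<noteq> (0, 0)"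
    and l: "(\<lambda>n. a (- real n)) \<longlonglongrightarrow> 0" "(\<lambda>n. c (- real n)) \<longlonglongrightarrow> 0"
  obtains r where "cmod r > 1" "\<And>x. a (x + 1) = r * a x" "\<And>x. c (x + 1) = r * c x"
proof -
  have "(\<lambda>n. a (- real (Suc n)) * c (- real n) - c (- real (Suc n)) * a (- real n)) \<longlonglongrightarrow> 0 * 0 - 0 * 0"
    by (intro tendsto_intros l LIMSEQ_Suc[OF l(1)] LIMSEQ_Suc[OF l(2)])
  moreover have "a (- real (Suc n)) * c (- real n) - c (- real (Suc n)) * a (- real n) = a 0 * c 1 - c 0 * a 1" for n
    using wronskian_homsol[OF h homsol_shift1[OF h], of "- real (Suc n)" 0] by simp
  ultimately have "a 0 * c 1 - c 0 * a 1 = 0" by (simp add: LIMSEQ_const_iff)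
  then obtain r where r: "\<And>x. a (x + 1) = r * a x" "\<And>x. c (x + 1) = r * c x"
    using floquet_of_parallel[OF h nz] by blast
  \<comment> \<open>Read backwards, the recursion expresses the fixed values at 0 by the decaying
    values at \<open>- n\<close>; a bounded \<open>r ^ n\<close> would force them to vanish.\<close>
  have pw: "a 0 = r ^ n * a (- real n) \<and> c 0 = r ^ n * c (- real n)" for n
  proof (induction n)
    case (Suc n)
    then show ?case using r[of "- real (Suc n)"] by simp
  qed simp
  have "cmod r > 1"
  proof (rule ccontr)
    assume "\<not> cmod r > 1"
    then have le: "cmod r ^ n \<le> 1" for n by (simp add: power_le_one)
    have "cmod (a 0) \<le> cmod (a (- real n))" "cmod (c 0) \<le> cmod (c (- real n))" for n
      using pw[of n] mult_right_mono[OF le[of n], of "cmod (a (- real n))"] mult_right_mono[OF le[of n], of "cmod (c (- real n))"]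
      by (metis norm_mult norm_power mult_1 norm_ge_zero)+
    then have "cmod (a 0) \<le> 0" "cmod (c 0) \<le> 0"
      using LIMSEQ_le_const[OF tendsto_norm_zero[OF l(1)], of "cmod (a 0)"]
        LIMSEQ_le_const[OF tendsto_norm_zero[OF l(2)], of "cmod (c 0)"] by blast+
    then show False using nz by simp
  qed
  then show thesis using that r by blast
qed

text \<open>Decay at the two ends would assign to the same solution multipliers of modulus below and
  above 1. Being valid for every complex \<open>z\<close>, this both excludes eigenvalues and gives
  uniqueness for the resolvent equation.\<close>

lemma no_L2_homsol:
  assumes h: "homsol z a c" and i: "integrable lborel (\<lambda>x. rh x * (cmod (a x))\<^sup>2)"
  shows "a x = 0"
proof (rule ccontr)
  assume "a x \<noteq> 0"
  then have nz: "(a 0, c 0) \<noteq> (0, 0)" using homsol_repr(1)[OF h, of x] by auto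
  have i1: "integrable lborel (\<lambda>x. indicator {1..} x *\<^sub>R (rh x * (cmod (a x))\<^sup>2))"
    "integrable lborel (\<lambda>x. indicator {..0} x *\<^sub>R (rh x * (cmod (a x))\<^sup>2))"
    by (intro integrable_mult_indicator i; simp)+
  obtain r where r: "cmod r < 1" "\<And>x. a (x + 1) = r * a x" "\<And>x. c (x + 1) = r * c x"
    using decay_right[OF h nz L2_tendsto_right[OF h i1(1)]] by blast
  obtain r' where r': "cmod r' > 1" "\<And>x. a (x + 1) = r' * a x" "\<And>x. c (x + 1) = r' * c x"
    using decay_left[OF h nz L2_tendsto_left[OF h i1(2)]] by blast
  have "r = r'" using r(2,3)[of 0] r'(2,3)[of 0] nz by auto
  then show False using r(1) r'(1) by simp
qed

text \<open>In a band every multiplier is unimodular, so decay at a single end is already impossible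
  for a nontrivial solution.\<close>

lemma no_halfline_L2_in_band:
  assumes h: "homsol z a c" and D: "Delta z = of_real d" "\<bar>d\<bar> \<le> 2"
    and i: "integrable lborel (\<lambda>x. indicator {1..} x *\<^sub>R (rh x * (cmod (a x))\<^sup>2))
        \<or> integrable lborel (\<lambda>x. indicator {..0} x *\<^sub>R (rh x * (cmod (a x))\<^sup>2))"
  shows "a 0 = 0" "c 0 = 0"
proof -
  have "(a 0, c 0) = (0, 0)"
  proof (rule ccontr)
    assume nz: "(a 0, c 0) \<noteq> (0, 0)"
    obtain r where r: "cmod r \<noteq> 1" "\<And>x. a (x + 1) = r * a x" "\<And>x. c (x + 1) = r * c x"
      using i
    proof
      assume "integrable lborel (\<lambda>x. indicator {1..} x *\<^sub>R (rh x * (cmod (a x))\<^sup>2))"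
      from decay_right[OF h nz L2_tendsto_right[OF h this]] show thesis using that by (metis less_irrefl)
    next
      assume "integrable lborel (\<lambda>x. indicator {..0} x *\<^sub>R (rh x * (cmod (a x))\<^sup>2))"
      from decay_left[OF h nz L2_tendsto_left[OF h this]] show thesis using that by (metis less_irrefl)
    qed
    have "r * r - of_real d * r + 1 = 0"
      using floquet_multiplier[OF h nz r(2,3)] D(1) by simp
    then have "cmod r = 1" using unimodular_root[OF D(2)] by metis
    then show False using r(1) by simp
  qed
  then show "a 0 = 0" "c 0 = 0" by auto
qed

end

section \<open>Green's function\<close>

lemma integrable_exp_abs:
  fixes k :: real
  assumes "k > 0"
  shows "integrable lborel (\<lambda>s. exp (- k * \<bar>s\<bar>))"
proof -
  have nn: "(\<integral>\<^sup>+s. ennreal (exp (- k * s)) * indicator {0..} s \<partial>lborel) = ennreal (0 - (- exp (- k * 0) / k))"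
  proof (rule nn_integral_FTC_atLeast)
    show "((\<lambda>s. - exp (- k * s) / k) \<longlongrightarrow> 0) at_top"
      using assms by real_asymp
    show "((\<lambda>s. - exp (- k * s) / k) has_real_derivative exp (- k * s)) (at s)" for s
      using assms by (auto intro!: derivative_eq_intros)
  qed auto
  have i: "integrable lborel (\<lambda>s. indicator {0..} s *\<^sub>R exp (- k * s))"
  proof (rule integrableI_nonneg)
    have "(\<integral>\<^sup>+s. ennreal (indicator {0..} s *\<^sub>R exp (- k * s)) \<partial>lborel) = (\<integral>\<^sup>+s. ennreal (exp (- k * s)) * indicator {0..} s \<partial>lborel)"
      by (intro nn_integral_cong) (auto simp: indicator_def)
    then show "(\<integral>\<^sup>+s. ennreal (indicator {0..} s *\<^sub>R exp (- k * s)) \<partial>lborel) < \<infinity>"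
      unfolding nn by simp
  qed (auto simp: indicator_def)
  have "integrable lborel (\<lambda>s. indicator {0..} (0 + (-1) * s) *\<^sub>R exp (- k * (0 + (-1) * s)))"
    by (rule lborel_integrable_real_affine[OF i]) simp
  from Bochner_Integration.integrable_add[OF i this] show ?thesis
    by (rule Bochner_Integration.integrable_bound) (auto simp: indicator_def)
qed

text \<open>Young's inequality for a function dominated by a convolution of an integrable kernel
  with a square integrable function. Cauchy-Schwarz is applied to \<open>w g\<close> split into
  \<open>sqrt w\<close> and \<open>sqrt w g\<close>; nonnegative integrals allow Tonelli before any
  integrability is known.\<close>

lemma Young_L2:
  fixes w g :: "real \<Rightarrow> real" and u :: "real \<Rightarrow> complex"
  assumes w: "integrable lborel w" "\<And>s. 0 \<le> w s" and g: "g \<in> borel_measurable lborel" "\<And>s. 0 \<le> g s"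
    and g2: "integrable lborel (\<lambda>s. (g s)\<^sup>2)" and u: "u \<in> borel_measurable lborel"
    and C: "C \<ge> 0" "\<And>x. ennreal (cmod (u x)) \<le> ennreal C * (\<integral>\<^sup>+t. ennreal (w (x - t) * g t) \<partial>lborel)"
  shows "integrable lborel (\<lambda>x. (cmod (u x))\<^sup>2)"
    and "(\<integral>x. (cmod (u x))\<^sup>2 \<partial>lborel) \<le> C\<^sup>2 * (\<integral>s. w s \<partial>lborel)\<^sup>2 * (\<integral>s. (g s)\<^sup>2 \<partial>lborel)"
proof -
  have wm[measurable]: "w \<in> borel_measurable borel" using borel_measurable_integrable[OF w(1)] by simp
  have gm[measurable]: "g \<in> borel_measurable borel" using g(1) by simp
  have um[measurable]: "u \<in> borel_measurable borel" using u by simp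
  define M where "M = (\<integral>\<^sup>+s. ennreal (w s) \<partial>lborel)"
  have M: "M = ennreal (\<integral>s. w s \<partial>lborel)"
    unfolding M_def by (rule nn_integral_eq_integral[OF w(1)]) (use w(2) in auto)
  have M1: "(\<integral>\<^sup>+t. ennreal (w (x - t)) \<partial>lborel) = M" for x
    unfolding M_def using nn_integral_real_affine[of "\<lambda>s. ennreal (w s)" "-1" x] by simp
  have M2: "(\<integral>\<^sup>+x. ennreal (w (x - t)) \<partial>lborel) = M" for t
    unfolding M_def using nn_integral_real_affine[of "\<lambda>s. ennreal (w s)" 1 "- t"] by simp
  have cs: "(\<integral>\<^sup>+t. ennreal (w (x - t) * g t) \<partial>lborel)\<^sup>2 \<le> M * (\<integral>\<^sup>+t. ennreal (w (x - t) * (g t)\<^sup>2) \<partial>lborel)" for x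
  proof -
    have "(\<integral>\<^sup>+t. ennreal (sqrt (w (x - t))) * ennreal (sqrt (w (x - t)) * g t) \<partial>lborel)\<^sup>2
      \<le> (\<integral>\<^sup>+t. (ennreal (sqrt (w (x - t))))\<^sup>2 \<partial>lborel) * (\<integral>\<^sup>+t. (ennreal (sqrt (w (x - t)) * g t))\<^sup>2 \<partial>lborel)"
      by (rule Cauchy_Schwarz_nn_integral) auto
    then show ?thesis
      using w(2) g(2) by (simp add: ennreal_power M1 power_mult_distrib mult.assoc[symmetric] flip: ennreal_mult)
  qed
  have "(\<integral>\<^sup>+x. ennreal ((cmod (u x))\<^sup>2) \<partial>lborel)
      \<le> (\<integral>\<^sup>+x. (ennreal C)\<^sup>2 * (M * (\<integral>\<^sup>+t. ennreal (w (x - t) * (g t)\<^sup>2) \<partial>lborel)) \<partial>lborel)"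
  proof (rule nn_integral_mono)
    fix x
    have "ennreal ((cmod (u x))\<^sup>2) = (ennreal (cmod (u x)))\<^sup>2" by (simp add: ennreal_power)
    also have "\<dots> \<le> (ennreal C * (\<integral>\<^sup>+t. ennreal (w (x - t) * g t) \<partial>lborel))\<^sup>2"
      by (rule power_mono[OF C(2)]) simp
    also have "\<dots> \<le> (ennreal C)\<^sup>2 * (M * (\<integral>\<^sup>+t. ennreal (w (x - t) * (g t)\<^sup>2) \<partial>lborel))"
      unfolding power_mult_distrib by (rule mult_left_mono[OF cs]) simp
    finally show "ennreal ((cmod (u x))\<^sup>2) \<le> (ennreal C)\<^sup>2 * (M * (\<integral>\<^sup>+t. ennreal (w (x - t) * (g t)\<^sup>2) \<partial>lborel))" .
  qed
  also have "\<dots> = (ennreal C)\<^sup>2 * M * (\<integral>\<^sup>+x. \<integral>\<^sup>+t. ennreal (w (x - t) * (g t)\<^sup>2) \<partial>lborel \<partial>lborel)"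
    by (simp add: nn_integral_cmult mult.assoc)
  also have "(\<integral>\<^sup>+x. \<integral>\<^sup>+t. ennreal (w (x - t) * (g t)\<^sup>2) \<partial>lborel \<partial>lborel)
      = (\<integral>\<^sup>+t. \<integral>\<^sup>+x. ennreal (w (x - t) * (g t)\<^sup>2) \<partial>lborel \<partial>lborel)"
    by (rule lborel_pair.Fubini'[symmetric]) measurable
  also have "\<dots> = (\<integral>\<^sup>+t. M * ennreal ((g t)\<^sup>2) \<partial>lborel)"
  proof (rule nn_integral_cong)
    fix t
    have "(\<integral>\<^sup>+x. ennreal (w (x - t) * (g t)\<^sup>2) \<partial>lborel) = (\<integral>\<^sup>+x. ennreal (w (x - t)) * ennreal ((g t)\<^sup>2) \<partial>lborel)"
      using w(2) by (simp add: ennreal_mult)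
    also have "\<dots> = M * ennreal ((g t)\<^sup>2)" by (simp add: nn_integral_multc M2)
    finally show "(\<integral>\<^sup>+x. ennreal (w (x - t) * (g t)\<^sup>2) \<partial>lborel) = M * ennreal ((g t)\<^sup>2)" .
  qed
  also have "\<dots> = M * ennreal (\<integral>s. (g s)\<^sup>2 \<partial>lborel)"
    by (simp add: nn_integral_cmult nn_integral_eq_integral[OF g2])
  also have "(ennreal C)\<^sup>2 * M * (M * ennreal (\<integral>s. (g s)\<^sup>2 \<partial>lborel))
      = ennreal (C\<^sup>2 * (\<integral>s. w s \<partial>lborel)\<^sup>2 * (\<integral>s. (g s)\<^sup>2 \<partial>lborel))"
  proof -
    have "0 \<le> (\<integral>s. w s \<partial>lborel)" "0 \<le> (\<integral>s. (g s)\<^sup>2 \<partial>lborel)" using w(2) by auto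
    then show ?thesis unfolding M using C(1)
      by (simp add: ennreal_power mult.assoc power2_eq_square flip: ennreal_mult)
  qed
  finally have le: "(\<integral>\<^sup>+x. ennreal ((cmod (u x))\<^sup>2) \<partial>lborel) \<le> ennreal (C\<^sup>2 * (\<integral>s. w s \<partial>lborel)\<^sup>2 * (\<integral>s. (g s)\<^sup>2 \<partial>lborel))" .
  show int: "integrable lborel (\<lambda>x. (cmod (u x))\<^sup>2)"
    by (rule integrableI_nonneg) (use le in \<open>auto simp: le_less_trans[OF _ ennreal_less_top]\<close>)
  have "0 \<le> C\<^sup>2 * (\<integral>s. w s \<partial>lborel)\<^sup>2 * (\<integral>s. (g s)\<^sup>2 \<partial>lborel)"
    by simp
  then show "(\<integral>x. (cmod (u x))\<^sup>2 \<partial>lborel) \<le> C\<^sup>2 * (\<integral>s. w s \<partial>lborel)\<^sup>2 * (\<integral>s. (g s)\<^sup>2 \<partial>lborel)"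
    using le unfolding nn_integral_eq_integral[OF int, simplified] by simp
qed

text \<open>\<open>s\<close> is 1 for \<open>{..x}\<close> and -1 for \<open>{x..}\<close>. The
  endpoints \<open>a\<close> and \<open>b\<close> are exempt: closed intervals count them
  inconsistently, but they form a null set.\<close>

lemma loc_AC_integral_family:
  fixes H :: "real \<Rightarrow> complex"
  assumes H: "\<And>x. set_integrable lborel (A x) H" and si: "\<And>a b. set_integrable lborel {a..b} H"
    and A: "\<And>a b t. a \<le> b \<Longrightarrow> t \<noteq> a \<Longrightarrow> t \<noteq> b \<Longrightarrow> indicator (A b) t - indicator (A a) t = s * (indicator {a..b} t :: real)"
  shows "loc_AC (\<lambda>x. LINT t:A x|lborel. H t) (\<lambda>x. s *\<^sub>R H x)"
proof (rule loc_ACI)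
  fix a b :: real
  show ss: "set_integrable lborel {a..b} (\<lambda>x. s *\<^sub>R H x)" using si by simp
  assume "a \<le> b"
  have "(LINT t:A b|lborel. H t) - (LINT t:A a|lborel. H t)
    = (\<integral>t. indicator (A b) t *\<^sub>R H t - indicator (A a) t *\<^sub>R H t \<partial>lborel)"
    unfolding set_lebesgue_integral_def using H unfolding set_integrable_def
    by (intro Bochner_Integration.integral_diff[symmetric])
  also have "\<dots> = (LINT t:{a..b}|lborel. s *\<^sub>R H t)"
    unfolding set_lebesgue_integral_def
  proof (rule integral_cong_AE)
    show "AE t in lborel. indicator (A b) t *\<^sub>R H t - indicator (A a) t *\<^sub>R H t = indicator {a..b} t *\<^sub>R (s *\<^sub>R H t)"
      using AE_lborel_singleton[of a] AE_lborel_singleton[of b]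
    proof eventually_elim
      case (elim t)
      then have "indicator (A b) t - indicator (A a) t = s * (indicator {a..b} t :: real)" by (rule A[OF \<open>a \<le> b\<close>])
      then show ?case by (simp only: scaleR_diff_left[symmetric] scaleR_scaleR mult.commute)
    qed
    show "(\<lambda>t. indicator (A b) t *\<^sub>R H t - indicator (A a) t *\<^sub>R H t) \<in> borel_measurable lborel"
      using H unfolding set_integrable_def by (intro borel_measurable_diff borel_measurable_integrable)
    show "(\<lambda>t. indicator {a..b} t *\<^sub>R (s *\<^sub>R H t)) \<in> borel_measurable lborel"
      using ss unfolding set_integrable_def by (rule borel_measurable_integrable)
  qed
  finally show "(LINT t:A b|lborel. H t) - (LINT t:A a|lborel. H t) = (LINT t:{a..b}|lborel. s *\<^sub>R H t)" .
qed

lemma loc_AC_integral_atMost: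
  assumes H: "\<And>x. set_integrable lborel {..x} H"
  shows "loc_AC (\<lambda>x. LINT t:{..x}|lborel. H t) H"
proof -
  have "set_integrable lborel {a..b} H" for a b by (rule set_integrable_subset[OF H[of b]]) auto
  from loc_AC_integral_family[of "\<lambda>x. {..x}" H 1, OF H this] show ?thesis by (simp add: indicator_def)
qed

lemma loc_AC_integral_atLeast:
  assumes H: "\<And>x. set_integrable lborel {x..} H"
  shows "loc_AC (\<lambda>x. LINT t:{x..}|lborel. H t) (\<lambda>x. - H x)"
proof -
  have "set_integrable lborel {a..b} H" for a b by (rule set_integrable_subset[OF H[of a]]) auto
  from loc_AC_integral_family[of "\<lambda>x. {x..}" H "-1", OF H this] show ?thesis by (simp add: indicator_def)
qed

text \<open>A root \<open>s\<close> of modulus 1 satisfies \<open>inverse s = cnj s\<close>, so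
  \<open>D = 2 * Re s\<close> would be real of modulus at most 2. The roots are mutually inverse,
  and the one inside the unit disc is returned.\<close>

lemma hyperbolic_root:
  fixes D :: complex
  assumes "\<And>d. D = of_real d \<Longrightarrow> \<bar>d\<bar> > 2"
  obtains r where "0 < cmod r" "cmod r < 1" "r * r - D * r + 1 = 0" "inverse r * inverse r - D * inverse r + 1 = 0"
proof -
  define w where "w = csqrt (D\<^sup>2 - 4)"
  have w: "w\<^sup>2 = D\<^sup>2 - 4" by (simp add: w_def)
  define s where "s = (D + w) / 2"
  have s: "s * s - D * s + 1 = 0"
    using w unfolding s_def by (simp add: field_simps power2_eq_square) algebra
  then have s0: "s \<noteq> 0" by auto
  have i: "inverse s * inverse s - D * inverse s + 1 = 0"
    using s s0 by (simp add: field_simps)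
  have "cmod s \<noteq> 1"
  proof
    assume "cmod s = 1"
    then have sc: "s * cnj s = 1" by (simp add: complex_norm_square[symmetric])
    have "D = s + inverse s" using s s0 by (simp add: field_simps)
    also have "inverse s = cnj s" using sc s0 by (simp add: field_simps)
    also have "s + cnj s = of_real (2 * Re s)" by (simp add: complex_add_cnj)
    finally have "\<bar>2 * Re s\<bar> > 2" by (rule assms)
    then show False using abs_Re_le_cmod[of s] \<open>cmod s = 1\<close> by simp
  qed
  then consider "cmod s < 1" | "cmod (inverse s) < 1"
    using s0 by (auto simp: norm_inverse) (metis linorder_neqE_linordered_idom inverse_less_1_iff zero_less_norm_iff)
  then show thesis
  proof cases
    case 1
    then show thesis using that[of s] s i s0 by simp
  next
    case 2
    then show thesis using that[of "inverse s"] s i s0 by simp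
  qed
qed

context hill
begin

section \<open>Failure of surjectivity in a band\<close>

lemma insol_homogeneous_on:
  assumes i: "insol z f a c" and f: "\<And>t. t \<in> closed_segment x y \<Longrightarrow> f t = 0"
    and h: "homsol z b d"
  shows "a y * d y - c y * b y = a x * d x - c x * b x"
proof -
  have *: "a v * d v - c v * b v = a u * d u - c u * b u" if "u \<le> v" "{u..v} = closed_segment x y" for u v
  proof -
    have "a v * d v - c v * b v - (a u * d u - c u * b u)
        = (LINT t:{u..v}|lborel. of_real (E t) * (f t * b t - 0 * a t))"
      by (rule loc_AC_diff[OF wronskian[OF i h[unfolded homsol_iff_insol]] that(1)])
    also have "\<dots> = (LINT t:{u..v}|lborel. 0)"
      by (rule set_lebesgue_integral_cong) (use f that(2) in auto)
    finally show ?thesis by simp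
  qed
  show ?thesis
    using *[of x y] *[of y x] by (cases "x \<le> y") (auto simp: closed_segment_eq_real_ivl)
qed

text \<open>\<open>b\<close> and \<open>d\<close> form the homogeneous solution through the values
  at \<open>x\<close>. Wronskians with the fundamental system stay constant as long as no data are
  met, so both solutions agree that far.\<close>

lemma insol_extend:
  assumes i: "insol z f a c"
  obtains b d where "homsol z b d" "b x = a x" "d x = c x"
    "\<And>y. (\<And>t. t \<in> closed_segment x y \<Longrightarrow> f t = 0) \<Longrightarrow> a y = b y \<and> c y = d y"
proof -
  define s where "s = a x * phC z x - c x * phA z x"
  define t where "t = c x * thA z x - a x * thC z x"
  have h: "homsol z (\<lambda>y. s * thA z y + t * phA z y) (\<lambda>y. s * thC z y + t * phC z y)"
    by (rule homsol_fundamental)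
  have eq: "a y = s * thA z y + t * phA z y \<and> c y = s * thC z y + t * phC z y"
    if "\<And>t. t \<in> closed_segment x y \<Longrightarrow> f t = 0" for y
  proof -
    have "a y * phC z y - c y * phA z y = s"
      unfolding s_def by (rule insol_homogeneous_on[OF i that fundamental_homsol(2)])
    moreover have "a y * thC z y - c y * thA z y = - t"
      unfolding t_def using insol_homogeneous_on[OF i that fundamental_homsol(1)] by simp
    then have "c y * thA z y - a y * thC z y = t" by (simp add: algebra_simps)
    ultimately show ?thesis
      using fundamental_expand[where a="a y" and c="c y" and z=z and x=y] by simp
  qed
  have "a x = s * thA z x + t * phA z x" "c x = s * thC z x + t * phC z x"
    unfolding s_def t_def by (rule fundamental_expand)+
  then show thesis using that[OF h] eq by auto
qed

text \<open>In a band a solution of the inhomogeneous equation with data supported in the unit cell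
  would have to vanish outside the cell, so the data would be orthogonal to all solutions.\<close>
lemma band_not_surjective:
  assumes D: "Delta z = of_real d" "\<bar>d\<bar> \<le> 2"
  obtains f where "L2R f" "\<And>a c. insol z f a c \<Longrightarrow> \<not> integrable lborel (\<lambda>x. rh x * (cmod (a x))\<^sup>2)"
proof -
  \<comment> \<open>The conjugate makes the pairing of the data with \<open>thA\<close> equal to the
    energy of \<open>thA\<close>. The interval is open so that \<open>f\<close> vanishes at 0 and 1
    themselves, as the closed segments in \<open>insol_extend\<close> require.\<close>
  define f where "f x = indicator {0<..<1} x *\<^sub>R cnj (of_real (E x) * thA z x)" for x
  have cth: "continuous_on S (thA z)" for S by (rule homsol_continuous[OF fundamental_homsol(1)])
  have cEt: "continuous_on S (\<lambda>x. cnj (of_real (E x) * thA z x))" for S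
    by (intro continuous_intros cth continuous_on_subset[OF cont_E]) auto
  have fm: "f \<in> borel_measurable lborel"
    unfolding f_def[abs_def] using borel_measurable_continuous_onI[OF cEt]
    by (intro borel_measurable_scaleR borel_measurable_indicator) auto
  have E2: "(cmod (cnj (of_real (E x) * thA z x)))\<^sup>2 = rh x * (cmod (thA z x))\<^sup>2" for x
    by (simp add: norm_mult power_mult_distrib rh_def)
  have crt: "continuous_on {0..1} (\<lambda>x. rh x * (cmod (thA z x))\<^sup>2)"
    by (intro continuous_intros cth continuous_on_subset[OF cont_rh]) auto
  have si: "set_integrable lborel {0..1} (\<lambda>x. rh x * (cmod (thA z x))\<^sup>2)"
    unfolding set_integrable_def by (rule borel_integrable_compact[OF compact_Icc crt])
  have "integrable lborel (\<lambda>x. (cmod (f x))\<^sup>2)"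
  proof (rule Bochner_Integration.integrable_bound[OF si[unfolded set_integrable_def]])
    show "(\<lambda>x. (cmod (f x))\<^sup>2) \<in> borel_measurable lborel"
      using fm by simp
    show "AE x in lborel. norm ((cmod (f x))\<^sup>2) \<le> norm (indicator {0..1} x *\<^sub>R (rh x * (cmod (thA z x))\<^sup>2))"
      unfolding f_def using E2 rh_pos by (intro AE_I2) (auto simp: indicator_def less_imp_le)
  qed
  then have "L2R f" using fm by (simp add: L2R_def)
  moreover have "\<not> integrable lborel (\<lambda>x. rh x * (cmod (a x))\<^sup>2)" if i: "insol z f a c" for a c
  proof
    assume int: "integrable lborel (\<lambda>x. rh x * (cmod (a x))\<^sup>2)"
    have int1: "integrable lborel (\<lambda>x. indicator {1..} x *\<^sub>R (rh x * (cmod (a x))\<^sup>2))"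
      by (rule integrable_mult_indicator[OF _ int]) simp
    have int2: "integrable lborel (\<lambda>x. indicator {..0} x *\<^sub>R (rh x * (cmod (a x))\<^sup>2))"
      by (rule integrable_mult_indicator[OF _ int]) simp
    have 1: "a 1 = 0 \<and> c 1 = 0"
    proof -
      obtain b d' where b: "homsol z b d'" "b 1 = a 1" "d' 1 = c 1"
        "\<And>y. (\<And>t. t \<in> closed_segment 1 y \<Longrightarrow> f t = 0) \<Longrightarrow> a y = b y \<and> c y = d' y"
        using insol_extend[OF i] by blast
      have "a y = b y" if "y \<ge> 1" for y
        using b(4)[of y] that by (auto simp: f_def closed_segment_eq_real_ivl)
      then have "(\<lambda>x. indicator {1..} x *\<^sub>R (rh x * (cmod (a x))\<^sup>2)) = (\<lambda>x. indicator {1..} x *\<^sub>R (rh x * (cmod (b x))\<^sup>2))"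
        by (auto simp: indicator_def fun_eq_iff)
      then have "b 0 = 0" "d' 0 = 0" using no_halfline_L2_in_band[OF b(1) D] int1 by auto
      then show ?thesis using homsol_repr[OF b(1), of 1] b(2,3) by simp
    qed
    have 0: "a 0 = 0 \<and> c 0 = 0"
    proof -
      obtain b d' where b: "homsol z b d'" "b 0 = a 0" "d' 0 = c 0"
        "\<And>y. (\<And>t. t \<in> closed_segment 0 y \<Longrightarrow> f t = 0) \<Longrightarrow> a y = b y \<and> c y = d' y"
        using insol_extend[OF i] by blast
      have "a y = b y" if "y \<le> 0" for y
      proof -
        have "f t = 0" if "t \<in> closed_segment 0 y" for t
          using that \<open>y \<le> 0\<close> by (auto simp: f_def closed_segment_eq_real_ivl indicator_def split: if_splits)
        then show ?thesis using b(4)[of y] by blast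
      qed
      then have "(\<lambda>x. indicator {..0} x *\<^sub>R (rh x * (cmod (a x))\<^sup>2)) = (\<lambda>x. indicator {..0} x *\<^sub>R (rh x * (cmod (b x))\<^sup>2))"
        by (auto simp: indicator_def fun_eq_iff)
      then show ?thesis using no_halfline_L2_in_band[OF b(1) D] int2 b(2,3) by auto
    qed
    \<comment> \<open>Green's identity over the cell: the boundary terms vanish, so the positive
      energy of \<open>thA\<close> would have to be 0.\<close>
    have "0 = (LINT t:{0..1}|lborel. of_real (E t) * (f t * thA z t - 0 * a t))"
      using loc_AC_diff[OF wronskian[OF i fundamental_homsol(1)[unfolded homsol_iff_insol]], of 0 1] 0 1 by simp
    also have "\<dots> = (LINT t:{0..1}|lborel. of_real (rh t * (cmod (thA z t))\<^sup>2))"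
      unfolding set_lebesgue_integral_def
    proof (rule integral_cong_AE)
      have fe: "of_real (E t) * (f t * thA z t - 0 * a t) = of_real (rh t * (cmod (thA z t))\<^sup>2)" if "0 < t" "t < 1" for t
        using that complex_norm_square[of "thA z t"] by (simp add: f_def rh_def power2_eq_square)
      show "AE t in lborel. indicator {0..1} t *\<^sub>R (of_real (E t) * (f t * thA z t - 0 * a t))
         = indicator {0..1} t *\<^sub>R complex_of_real (rh t * (cmod (thA z t))\<^sup>2)"
        using AE_lborel_singleton[of 0] AE_lborel_singleton[of 1]
        by eventually_elim (use fe in \<open>auto simp: indicator_def\<close>)
      show "(\<lambda>t. indicator {0..1} t *\<^sub>R (of_real (E t) * (f t * thA z t - 0 * a t))) \<in> borel_measurable lborel"
        using fm borel_measurable_continuous_onI[OF cth] borel_measurable_continuous_onI[OF cont_E] by simp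
      show "(\<lambda>t. indicator {0..1} t *\<^sub>R complex_of_real (rh t * (cmod (thA z t))\<^sup>2)) \<in> borel_measurable lborel"
        using borel_measurable_continuous_onI[OF cth] borel_measurable_continuous_onI[OF cont_rh] by simp
    qed
    also have "\<dots> = of_real (LINT t:{0..1}|lborel. rh t * (cmod (thA z t))\<^sup>2)"
      by (rule set_integral_complex_of_real)
    finally have "(LINT t:{0..1}|lborel. rh t * (cmod (thA z t))\<^sup>2) = 0" by (metis of_real_eq_0_iff)
    moreover obtain k where k: "k > 0" "\<And>s t. k * ((cmod s)\<^sup>2 + (cmod t)\<^sup>2) \<le> energy z s t"
      using energy_lower_bound[of z] by blast
    ultimately show False using k(2)[of 1 0] by simp
  qed
  ultimately show thesis using that by blast
qed


text \<open>By the choice of \<open>k\<close> the function \<open>cmod (a x) * exp (k * x)\<close>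
  is 1-periodic, hence bounded.\<close>

lemma floquet_envelope:
  assumes h: "homsol z a c" and s: "\<And>x. a (x + 1) = r * a x" and k: "exp k * cmod r = 1"
  obtains B where "B \<ge> 0" "\<And>x. cmod (a x) \<le> B * exp (- k * x)"
proof -
  define g where "g x = cmod (a x) * exp (k * x)" for x
  have "g (x + 1) = g x" for x
  proof -
    have "g (x + 1) = (exp k * cmod r) * (cmod (a x) * exp (k * x))"
      by (simp add: g_def s norm_mult distrib_left exp_add)
    then show ?thesis by (simp add: k g_def)
  qed
  moreover have "continuous_on UNIV g"
    unfolding g_def[abs_def] by (intro continuous_intros homsol_continuous(1)[OF h])
  ultimately obtain B where B: "\<And>x. \<bar>g x\<bar> \<le> B"
    using periodic_continuous_bounded by blast
  show thesis
  proof (rule that)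
    show "B \<ge> 0" using B[of 0] by linarith
    show "cmod (a x) \<le> B * exp (- k * x)" for x
      using B[of x] by (simp add: g_def exp_minus field_simps)
  qed
qed

lemma hyperbolic_solutions:
  assumes D: "\<And>d. Delta z = of_real d \<Longrightarrow> \<bar>d\<bar> > 2"
  obtains p q P Q k B where "homsol z p q" "homsol z P Q" "\<And>x. p x * Q x - q x * P x = 1" "k > 0" "B \<ge> 0"
    "\<And>x. cmod (p x) \<le> B * exp (- k * x)" "\<And>x. cmod (P x) \<le> B * exp (k * x)"
proof -
  obtain r where r: "0 < cmod r" "cmod r < 1" "r * r - Delta z * r + 1 = 0"
      "inverse r * inverse r - Delta z * inverse r + 1 = 0"
    by (rule hyperbolic_root[of "Delta z", OF D])
  obtain p q where p: "homsol z p q" "(p 0, q 0) \<noteq> (0, 0)" "\<And>x. p (x + 1) = r * p x" "\<And>x. q (x + 1) = r * q x"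
    using floquet_solution[OF r(3)] by metis
  obtain P Q where P: "homsol z P Q" "(P 0, Q 0) \<noteq> (0, 0)" "\<And>x. P (x + 1) = inverse r * P x" "\<And>x. Q (x + 1) = inverse r * Q x"
    using floquet_solution[OF r(4)] by metis
  define W where "W = p 0 * Q 0 - q 0 * P 0"
  have W: "p x * Q x - q x * P x = W" for x
    unfolding W_def by (rule wronskian_homsol[OF p(1) P(1)])
  \<comment> \<open>Proportional Floquet solutions would share their multiplier, giving
    \<open>inverse r = r\<close> against \<open>cmod r < 1\<close>.\<close>
  have "W \<noteq> 0"
  proof
    assume W0: "W = 0"
    obtain l where l: "P 0 = l * p 0" "Q 0 = l * q 0"
    proof (cases "p 0 = 0")
      case True
      then show thesis using p(2) W0 that[of "Q 0 / q 0"] by (auto simp: W_def)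
    next
      case False
      then show thesis using W0 that[of "P 0 / p 0"] by (auto simp: W_def field_simps)
    qed
    have "homsol z (\<lambda>x. l * p x + 0 * p x) (\<lambda>x. l * q x + 0 * q x)"
      by (rule homsol_lincomb[OF p(1) p(1)])
    then have h2: "homsol z (\<lambda>x. l * p x) (\<lambda>x. l * q x)" by simp
    have "P 1 = l * p 1" "Q 1 = l * q 1" using homsol_eqI[OF P(1) h2 l, of 1] by auto
    then have "(inverse r - r) * P 0 = 0" "(inverse r - r) * Q 0 = 0"
      using p(3,4)[of 0] P(3,4)[of 0] l by (auto simp: algebra_simps)
    then have "inverse r = r" using P(2) by auto
    then have "cmod r * cmod r = 1"
      using r(1) by (metis norm_mult norm_one right_inverse norm_zero less_irrefl)
    moreover have "cmod r * cmod r < 1 * 1" using r(1,2) by (intro mult_strict_mono) auto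
    ultimately show False by simp
  qed
  define k where "k = - ln (cmod r)"
  have k: "exp k * cmod r = 1" "exp (- k) * cmod (inverse r) = 1" "k > 0"
    using r(1,2) by (simp_all add: k_def exp_minus norm_inverse)
  have "homsol z (\<lambda>x. inverse W * P x + 0 * P x) (\<lambda>x. inverse W * Q x + 0 * Q x)"
    by (rule homsol_lincomb[OF P(1) P(1)])
  then have h': "homsol z (\<lambda>x. inverse W * P x) (\<lambda>x. inverse W * Q x)" by simp
  obtain B1 where B1: "B1 \<ge> 0" "\<And>x. cmod (p x) \<le> B1 * exp (- k * x)"
    using floquet_envelope[OF p(1,3) k(1)] by blast
  have s': "inverse W * P (x + 1) = inverse r * (inverse W * P x)" for x by (simp add: P(3))
  obtain B2 where B2: "B2 \<ge> 0" "\<And>x. cmod (inverse W * P x) \<le> B2 * exp (- (- k) * x)"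
    using floquet_envelope[OF h' s' k(2)] by blast
  show thesis
  proof (rule that[OF p(1) h' _ k(3), of "max B1 B2"])
    show "p x * (inverse W * Q x) - q x * (inverse W * P x) = 1" for x
      using W[of x] \<open>W \<noteq> 0\<close> by (simp add: field_simps)
    show "0 \<le> max B1 B2" using B1(1) by simp
    show "cmod (p x) \<le> max B1 B2 * exp (- k * x)" for x
      by (rule order_trans[OF B1(2) mult_right_mono]) auto
    show "cmod (inverse W * P x) \<le> max B1 B2 * exp (k * x)" for x
    proof -
      have "B2 * exp (k * x) \<le> max B1 B2 * exp (k * x)" by (intro mult_right_mono) auto
      with B2(2)[of x] show ?thesis by (metis minus_minus order_trans)
    qed
  qed
qed

text \<open>Variation of parameters: the derivatives of \<open>K\<close> and \<open>L\<close> cancel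
  in the equation for \<open>a\<close>, and by Wronskian 1 they combine to \<open>- E f\<close> in
  the equation for \<open>c\<close>.\<close>

lemma insol_green:
  assumes h: "homsol z p q" "homsol z P Q" and W: "\<And>x. p x * Q x - q x * P x = 1"
    and K: "loc_AC K (\<lambda>x. of_real (E x) * f x * P x)" and L: "loc_AC L (\<lambda>x. - (of_real (E x) * f x * p x))"
  shows "insol z f (\<lambda>x. p x * K x + P x * L x) (\<lambda>x. q x * K x + Q x * L x)"
proof -
  note h' = h[unfolded homsol_iff_insol insol_def mult_zero_right diff_0_right]
  have 1: "loc_AC (\<lambda>x. p x * K x + P x * L x) (\<lambda>x.
     (rA p q x) * K x + p x * (of_real (E x) * f x * P x)
     + ((rA P Q x) * L x + P x * (- (of_real (E x) * f x * p x))))"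
    using h' K L by (intro loc_AC_add loc_AC_mult) auto
  have 2: "loc_AC (\<lambda>x. q x * K x + Q x * L x) (\<lambda>x.
     (rC z p q x) * K x + q x * (of_real (E x) * f x * P x)
     + ((rC z P Q x) * L x + Q x * (- (of_real (E x) * f x * p x))))"
    using h' K L by (intro loc_AC_add loc_AC_mult) auto
  have e: "q x * (of_real (E x) * f x * P x) + Q x * (- (of_real (E x) * f x * p x)) = - (of_real (E x) * f x)" for x
  proof -
    have "q x * (of_real (E x) * f x * P x) + Q x * (- (of_real (E x) * f x * p x))
        = - (of_real (E x) * f x) * (p x * Q x - q x * P x)" by (simp add: algebra_simps)
    then show ?thesis by (simp add: W)
  qed
  have e2: "(rC z p q x) * K x + q x * (of_real (E x) * f x * P x)
     + ((rC z P Q x) * L x + Q x * (- (of_real (E x) * f x * p x)))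
    = (of_real (ka x) - z * of_real (rh x)) * (p x * K x + P x * L x) - of_real (al x) * (q x * K x + Q x * L x) - of_real (E x) * f x" for x
    using e[of x] by (simp add: algebra_simps)
  show ?thesis
    unfolding insol_def using 1 2 unfolding e2 by (simp add: algebra_simps)
qed

text \<open>Green's function is \<open>p\<close> at the larger argument times \<open>P\<close> at
  the smaller one, so a multiple of \<open>exp (- k * |x - t|)\<close> dominates it and Young's
  inequality bounds the solution operator.\<close>

lemma resolvent_exists:
  assumes D: "\<And>d. Delta z = of_real d \<Longrightarrow> \<bar>d\<bar> > 2"
  obtains C where "C \<ge> 0" "\<And>f. L2R f \<Longrightarrow> \<exists>a c. insol z f a c \<and> L2R (\<lambda>x. of_real (E x) * a x)
      \<and> L2R_norm (\<lambda>x. of_real (E x) * a x) \<le> C * L2R_norm f"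
proof -
  obtain p q P Q k B where h: "homsol z p q" "homsol z P Q" and W: "\<And>x. p x * Q x - q x * P x = 1"
    and k: "k > 0" and B: "B \<ge> 0"
    and pb: "\<And>x. cmod (p x) \<le> B * exp (- k * x)" and Pb: "\<And>x. cmod (P x) \<le> B * exp (k * x)"
    using hyperbolic_solutions[OF D] by metis
  obtain M where M: "\<And>x. \<bar>E x\<bar> \<le> M"
    using periodic_continuous_bounded[OF per_E cont_E] by blast
  have M0: "M \<ge> 0" using M[of 0] by linarith
  define w where "w s = exp (- k * \<bar>s\<bar>)" for s
  have wi: "integrable lborel w" unfolding w_def[abs_def] by (rule integrable_exp_abs[OF k])
  have w0: "0 \<le> w s" "w s \<le> 1" for s using k by (simp_all add: w_def)
  note [measurable] = borel_measurable_continuous_onI[OF homsol_continuous(1)[OF h(1)]]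
    borel_measurable_continuous_onI[OF homsol_continuous(1)[OF h(2)]] borel_measurable_continuous_onI[OF cont_E]
  \<comment> \<open>One \<open>M\<close> bounds \<open>E\<close> in front of the solution, the other
    \<open>E\<close> in front of the datum; each \<open>B\<close> bounds one of the two Floquet
    solutions.\<close>
  define C where "C = M * (M * B * B)"
  have C0: "C \<ge> 0" using M0 B by (simp add: C_def)
  have main: "\<exists>a c. insol z f a c \<and> L2R (\<lambda>x. of_real (E x) * a x)
      \<and> L2R_norm (\<lambda>x. of_real (E x) * a x) \<le> (C * (\<integral>s. w s \<partial>lborel)) * L2R_norm f" if f: "L2R f" for f
  proof -
    have fm[measurable]: "f \<in> borel_measurable borel" and f2: "integrable lborel (\<lambda>x. (cmod (f x))\<^sup>2)"
      using f by (auto simp: L2R_def)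
    \<comment> \<open>Integrability at fixed \<open>x\<close> comes from
      \<open>w |f| <= w + |f|^2\<close>, which uses \<open>w <= 1\<close>.\<close>
    have wf: "integrable lborel (\<lambda>t. w (x - t) * cmod (f t))" for x
    proof -
      have "integrable lborel (\<lambda>t. w (x + (-1) * t))" by (rule lborel_integrable_real_affine[OF wi]) simp
      from Bochner_Integration.integrable_add[OF this f2] show ?thesis
      proof (rule Bochner_Integration.integrable_bound)
        show "(\<lambda>t. w (x - t) * cmod (f t)) \<in> borel_measurable lborel" unfolding w_def by measurable
        show "AE t in lborel. norm (w (x - t) * cmod (f t)) \<le> norm (w (x + (-1) * t) + (cmod (f t))\<^sup>2)"
        proof (rule AE_I2)
          fix t
          have "0 \<le> (w (x - t) - cmod (f t))\<^sup>2" by simp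
          then have "2 * (w (x - t) * cmod (f t)) \<le> w (x - t) * w (x - t) + (cmod (f t))\<^sup>2"
            by (simp add: power2_eq_square algebra_simps)
          moreover have "w (x - t) * w (x - t) \<le> w (x - t) * 1" using w0 by (intro mult_left_mono) auto
          moreover have "0 \<le> w (x - t) * cmod (f t)" using w0 by simp
          ultimately show "norm (w (x - t) * cmod (f t)) \<le> norm (w (x + (-1) * t) + (cmod (f t))\<^sup>2)"
            by simp
        qed
      qed
    qed
    have MB: "0 \<le> M * B" using M0 B by simp
    have bP: "cmod (of_real (E t) * f t * P t) \<le> M * B * exp (k * x) * (w (x - t) * cmod (f t))" if "t \<le> x" for t x
    proof -
      have "cmod (of_real (E t) * f t * P t) \<le> M * cmod (f t) * (B * exp (k * t))"
        unfolding norm_mult using M[of t] Pb[of t] B M0 by (intro mult_mono) auto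
      also have "exp (k * t) = exp (k * x) * w (x - t)"
        using that by (simp add: w_def algebra_simps flip: exp_add)
      finally show ?thesis by (simp add: algebra_simps)
    qed
    have bp: "cmod (of_real (E t) * f t * p t) \<le> M * B * exp (- k * x) * (w (x - t) * cmod (f t))" if "x \<le> t" for t x
    proof -
      have "cmod (of_real (E t) * f t * p t) \<le> M * cmod (f t) * (B * exp (- k * t))"
        unfolding norm_mult using M[of t] pb[of t] B M0 by (intro mult_mono) auto
      also have "exp (- k * t) = exp (- k * x) * w (x - t)"
        using that by (simp add: w_def algebra_simps flip: exp_add)
      finally show ?thesis by (simp add: algebra_simps)
    qed
    have iP: "set_integrable lborel {..x} (\<lambda>t. of_real (E t) * f t * P t)" for x
      unfolding set_integrable_def
    proof (rule Bochner_Integration.integrable_bound[OF integrable_mult_right[OF wf[of x], of "M * B * exp (k * x)"]])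
      show "AE t in lborel. norm (indicator {..x} t *\<^sub>R (of_real (E t) * f t * P t)) \<le> norm (M * B * exp (k * x) * (w (x - t) * cmod (f t)))"
        using bP[of _ x] MB w0 by (intro AE_I2) (auto simp: indicator_def intro: order_trans[OF _ abs_ge_self])
    qed simp
    have ip: "set_integrable lborel {x..} (\<lambda>t. of_real (E t) * f t * p t)" for x
      unfolding set_integrable_def
    proof (rule Bochner_Integration.integrable_bound[OF integrable_mult_right[OF wf[of x], of "M * B * exp (- k * x)"]])
      show "AE t in lborel. norm (indicator {x..} t *\<^sub>R (of_real (E t) * f t * p t)) \<le> norm (M * B * exp (- k * x) * (w (x - t) * cmod (f t)))"
        using bp[of x] MB w0 by (intro AE_I2) (auto simp: indicator_def intro: order_trans[OF _ abs_ge_self])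
    qed simp
    define K where "K x = (LINT t:{..x}|lborel. of_real (E t) * f t * P t)" for x
    define L where "L x = (LINT t:{x..}|lborel. of_real (E t) * f t * p t)" for x
    have KL: "loc_AC K (\<lambda>x. of_real (E x) * f x * P x)" "loc_AC L (\<lambda>x. - (of_real (E x) * f x * p x))"
      unfolding K_def[abs_def] L_def[abs_def]
      by (rule loc_AC_integral_atMost[OF iP]) (rule loc_AC_integral_atLeast[OF ip])
    define a where "a x = p x * K x + P x * L x" for x
    have ins: "insol z f a (\<lambda>x. q x * K x + Q x * L x)"
      unfolding a_def[abs_def] by (rule insol_green[OF h W KL])
    have um: "(\<lambda>x. of_real (E x) * a x) \<in> borel_measurable lborel"
      using borel_measurable_continuous_onI[OF loc_AC_continuous[OF KL(1)]]
        borel_measurable_continuous_onI[OF loc_AC_continuous[OF KL(2)]]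
      unfolding a_def[abs_def] by simp
    have ub: "cmod (of_real (E x) * a x) \<le> C * (\<integral>t. w (x - t) * cmod (f t) \<partial>lborel)" for x
    proof -
      define V where "V = (\<lambda>A. \<integral>t. indicator A t * (w (x - t) * cmod (f t)) \<partial>lborel)"
      have iA: "integrable lborel (\<lambda>t. indicator A t * (w (x - t) * cmod (f t)))" if "A \<in> sets borel" for A
        using integrable_mult_indicator[OF _ wf[of x], of A] that by simp
      have "cmod (K x) \<le> (\<integral>t. cmod (indicator {..x} t *\<^sub>R (of_real (E t) * f t * P t)) \<partial>lborel)"
        unfolding K_def set_lebesgue_integral_def by (rule integral_norm_bound)
      also have "\<dots> \<le> (\<integral>t. M * B * exp (k * x) * (indicator {..x} t * (w (x - t) * cmod (f t))) \<partial>lborel)"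
        using bP[of _ x] by (intro integral_mono integrable_norm integrable_mult_right iA iP[unfolded set_integrable_def])
          (auto simp: indicator_def)
      finally have Kb: "cmod (K x) \<le> M * B * exp (k * x) * V {..x}"
        unfolding V_def by simp
      have "cmod (L x) \<le> (\<integral>t. cmod (indicator {x..} t *\<^sub>R (of_real (E t) * f t * p t)) \<partial>lborel)"
        unfolding L_def set_lebesgue_integral_def by (rule integral_norm_bound)
      also have "\<dots> \<le> (\<integral>t. M * B * exp (- k * x) * (indicator {x..} t * (w (x - t) * cmod (f t))) \<partial>lborel)"
        using bp[of x] by (intro integral_mono integrable_norm integrable_mult_right iA ip[unfolded set_integrable_def])
          (auto simp: indicator_def)
      finally have Lb: "cmod (L x) \<le> M * B * exp (- k * x) * V {x..}"
        unfolding V_def by simp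
      have "V {..x} + V {x..} = (\<integral>t. indicator {..x} t * (w (x - t) * cmod (f t)) + indicator {x..} t * (w (x - t) * cmod (f t)) \<partial>lborel)"
        unfolding V_def by (intro Bochner_Integration.integral_add[symmetric] iA) auto
      also have "\<dots> = (\<integral>t. w (x - t) * cmod (f t) \<partial>lborel)"
      proof (rule integral_cong_AE)
        show "AE t in lborel. indicator {..x} t * (w (x - t) * cmod (f t)) + indicator {x..} t * (w (x - t) * cmod (f t)) = w (x - t) * cmod (f t)"
          using AE_lborel_singleton[of x] by eventually_elim (auto simp: indicator_def)
      qed (use iA wf in \<open>auto intro!: borel_measurable_add borel_measurable_integrable[OF iA] borel_measurable_integrable[OF wf]\<close>)
      finally have Vs: "V {..x} + V {x..} = (\<integral>t. w (x - t) * cmod (f t) \<partial>lborel)" .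
      have "cmod (a x) \<le> cmod (p x) * cmod (K x) + cmod (P x) * cmod (L x)"
        unfolding a_def by (metis norm_mult norm_triangle_ineq)
      also have "\<dots> \<le> (B * exp (- k * x)) * (M * B * exp (k * x) * V {..x}) + (B * exp (k * x)) * (M * B * exp (- k * x) * V {x..})"
        using pb[of x] Pb[of x] Kb Lb B by (intro add_mono mult_mono) auto
      also have "\<dots> = M * B * B * ((exp (- k * x) * exp (k * x)) * V {..x} + (exp (k * x) * exp (- k * x)) * V {x..})"
        by (simp add: algebra_simps)
      also have "\<dots> = M * B * B * (V {..x} + V {x..})"
        by (simp flip: exp_add)
      finally have ab: "cmod (a x) \<le> M * B * B * (V {..x} + V {x..})" .
      have "cmod (of_real (E x) * a x) \<le> M * (M * B * B * (V {..x} + V {x..}))"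
        unfolding norm_mult using ab M[of x] M0 by (intro mult_mono) auto
      then show ?thesis unfolding C_def Vs by (simp add: mult.assoc)
    qed
    have ub': "ennreal (cmod (of_real (E x) * a x)) \<le> ennreal C * (\<integral>\<^sup>+t. ennreal (w (x - t) * cmod (f t)) \<partial>lborel)" for x
    proof -
      have "0 \<le> (\<integral>t. w (x - t) * cmod (f t) \<partial>lborel)"
        using w0 by (intro integral_nonneg_AE AE_I2) auto
      then show ?thesis using ub[of x] w0 C0
        by (subst nn_integral_eq_integral[OF wf]) (auto simp flip: ennreal_mult)
    qed
    have gm: "(\<lambda>t. cmod (f t)) \<in> borel_measurable lborel" by simp
    note Y = Young_L2[OF wi w0(1) gm _ f2 um C0 ub']
    have "L2R (\<lambda>x. of_real (E x) * a x)" using um Y(1) by (simp add: L2R_def)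
    moreover have "L2R_norm (\<lambda>x. of_real (E x) * a x) \<le> (C * (\<integral>s. w s \<partial>lborel)) * L2R_norm f"
    proof -
      have "0 \<le> (\<integral>s. w s \<partial>lborel)" using w0 by (intro integral_nonneg_AE AE_I2) auto
      then show ?thesis using real_sqrt_le_mono[OF Y(2)] C0
        by (simp add: L2R_norm_def real_sqrt_mult)
    qed
    ultimately show ?thesis using ins by blast
  qed
  have "0 \<le> C * (\<integral>s. w s \<partial>lborel)" using C0 w0 by (intro mult_nonneg_nonneg integral_nonneg_AE AE_I2) auto
  then show thesis using that main by blast
qed

end

section \<open>Band structure from the discriminant\<close>

text \<open>The properties of the discriminant that determine the band structure. Local openness relative to
  [-2, 2] is the open mapping theorem combined with the fact that a value in [-2, 2] is only attained
  at real points.\<close>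

locale discriminant =
  fixes D :: "real \<Rightarrow> real"
  assumes cont: "continuous_on UNIV D"
    and local_open: "\<lbrakk>\<bar>D l\<bar> \<le> 2; e > 0\<rbrakk> \<Longrightarrow> \<exists>d>0. \<forall>y. \<bar>y\<bar> \<le> 2 \<longrightarrow> \<bar>y - D l\<bar> < d \<longrightarrow> (\<exists>m. \<bar>m - l\<bar> < e \<and> D m = y)"
    and left_end: "\<exists>L. \<forall>l\<le>L. D l > 2"
    and zeros_finite: "finite {l. \<bar>l\<bar> \<le> R \<and> D l = 0}"
    and zeros_infinite: "infinite {l. D l = 0}"
begin

lemma cont_on: "continuous_on S D"
  using cont by (rule continuous_on_subset) simp

text \<open>Local openness can push the value slightly in the direction \<open>s\<close> without
  leaving [-2, 2]. The sign \<open>s\<close> treats maxima and minima of \<open>D\<close> at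
  once.\<close>

lemma nearby_value:
  assumes "\<bar>D l\<bar> \<le> 2" "e > 0" "\<bar>s\<bar> = 1" "s * D l < 2"
  obtains m where "\<bar>m - l\<bar> < e" "s * D m > s * D l"
proof -
  obtain d where d: "d > 0" "\<And>y. \<bar>y\<bar> \<le> 2 \<Longrightarrow> \<bar>y - D l\<bar> < d \<Longrightarrow> \<exists>m. \<bar>m - l\<bar> < e \<and> D m = y"
    using local_open[OF assms(1,2)] by blast
  \<comment> \<open>Half of \<open>d\<close> keeps the target value within reach of openness; half
    of \<open>2 - s * D l\<close> keeps it in [-2, 2].\<close>
  define t where "t = min (d / 2) ((2 - s * D l) / 2)"
  have t: "0 < t" "t \<le> d / 2" "t \<le> (2 - s * D l) / 2"
    using assms(4) d(1) unfolding t_def by (simp_all only: min_less_iff_conj min.cobounded1 min.cobounded2, simp_all)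
  consider "s = 1" | "s = -1" using assms(3) by linarith
  then obtain y where y: "\<bar>y\<bar> \<le> 2" "\<bar>y - D l\<bar> < d" "s * D l < s * y"
  proof cases
    case 1
    then show thesis using t assms(1) d(1) by (intro that[of "D l + t"]) auto
  next
    case 2
    then show thesis using t assms(1) d(1) by (intro that[of "D l - t"]) auto
  qed
  from d(2)[OF y(1,2)] y(3) show thesis using that by blast
qed

text \<open>An interior maximum with value in [-2, 2) would contradict \<open>nearby_value\<close>.
  The floor -2 is there because openness is assumed only where \<open>|D| <= 2\<close>; below it
  \<open>s * D\<close> may well have maxima.\<close>

lemma no_interior_max:
  assumes ab: "a \<le> b" and s: "\<bar>s\<bar> = 1" and lt: "\<And>x. x \<in> {a..b} \<Longrightarrow> s * D x < 2" and x: "x \<in> {a..b}"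
  shows "s * D x \<le> max (max (s * D a) (s * D b)) (-2)"
proof -
  have "continuous_on {a..b} (\<lambda>x. s * D x)" by (intro continuous_intros cont_on)
  then obtain m where m: "m \<in> {a..b}" "\<And>y. y \<in> {a..b} \<Longrightarrow> s * D y \<le> s * D m"
    using continuous_attains_sup[of "{a..b}" "\<lambda>x. s * D x"] ab by auto
  have "s * D m \<le> max (max (s * D a) (s * D b)) (-2)"
  proof (rule ccontr)
    assume c: "\<not> ?thesis"
    then have "m \<noteq> a" "m \<noteq> b" "s * D m > -2" by auto
    then have mi: "a < m" "m < b" using m(1) by auto
    have "\<bar>s * D m\<bar> \<le> 2" using lt[OF m(1)] \<open>s * D m > -2\<close> by linarith
    then have D2: "\<bar>D m\<bar> \<le> 2" using s by (simp add: abs_mult)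
    have "min (m - a) (b - m) > 0" "s * D m < 2" using mi s lt[OF m(1)] by auto
    from nearby_value[OF D2 this(1) s this(2)] obtain n where n: "\<bar>n - m\<bar> < min (m - a) (b - m)" "s * D n > s * D m"
      by metis
    then have "n \<in> {a..b}" by (auto simp: abs_less_iff)
    then show False using m(2)[of n] n(2) by simp
  qed
  then show ?thesis using m(2)[OF x] by linarith
qed

text \<open>\<open>no_interior_max\<close> gives the weak inequality; touching -2 inside would
  produce a nearby larger value. So no isolated spectral point can sit inside a gap.\<close>

lemma gap_strict:
  assumes s: "\<bar>s\<bar> = 1" and lt: "\<And>x. x \<in> {a..b} \<Longrightarrow> s * D x < 2" and ends: "s * D a \<le> -2" "s * D b \<le> -2"
    and x: "a < x" "x < b"
  shows "s * D x < -2"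
proof -
  have le: "s * D y \<le> -2" if "y \<in> {a..b}" for y
    using no_interior_max[OF _ s lt that] ends x by auto
  show ?thesis
  proof (rule ccontr)
    assume "\<not> ?thesis"
    then have eq: "s * D x = -2" using le[of x] x by auto
    then have "\<bar>s * D x\<bar> = 2" by simp
    then have D2: "\<bar>D x\<bar> \<le> 2" using s by (simp add: abs_mult)
    have "min (x - a) (b - x) > 0" "s * D x < 2" using x s eq by auto
    from nearby_value[OF D2 this(1) s this(2)] obtain n where n: "\<bar>n - x\<bar> < min (x - a) (b - x)" "s * D n > s * D x"
      by metis
    then have "n \<in> {a..b}" by (auto simp: abs_less_iff)
    then show False using le[of n] n(2) eq by simp
  qed
qed

section \<open>Enumeration of the zeros and the sign pattern between them\<close>

definition Z where "Z = {l. D l = 0}"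

lemma Z_bounded_below: "\<exists>L. \<forall>z\<in>Z. L < z"
proof -
  obtain L where L: "\<And>l. l \<le> L \<Longrightarrow> D l > 2" using left_end by blast
  have "L < z" if "z \<in> Z" for z
    using that L[of z] by (cases "z \<le> L") (auto simp: Z_def)
  then show ?thesis by blast
qed

lemma Z_finite_below: "finite {z \<in> Z. z \<le> R}"
proof -
  obtain L where L: "\<And>z. z \<in> Z \<Longrightarrow> L < z" using Z_bounded_below by blast
  have "{z \<in> Z. z \<le> R} \<subseteq> {l. \<bar>l\<bar> \<le> max \<bar>L\<bar> \<bar>R\<bar> \<and> D l = 0}"
    using L by (force simp: Z_def)
  then show ?thesis using zeros_finite finite_subset by blast
qed

lemma Z_unbounded: "\<exists>z\<in>Z. R < z"
proof (rule ccontr)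
  assume "\<not> ?thesis"
  then have "Z = {z \<in> Z. z \<le> R}" by force
  then have "finite Z" using Z_finite_below by metis
  then show False using zeros_infinite by (simp add: Z_def)
qed

lemma Z_next: "\<exists>z\<in>Z. R < z \<and> (\<forall>y\<in>Z. R < y \<longrightarrow> z \<le> y)"
proof -
  obtain z0 where z0: "z0 \<in> Z" "R < z0" using Z_unbounded by blast
  let ?F = "{z \<in> Z. z \<le> z0} \<inter> {R<..}"
  have F: "finite ?F" "?F \<noteq> {}" using Z_finite_below z0 by auto
  have "Min ?F \<in> ?F" using Min_in[OF F] .
  moreover have "Min ?F \<le> y" if "y \<in> Z" "R < y" for y
    using Min_le[OF F(1), of y] Min_le[OF F(1), of z0] that z0 by (cases "y \<le> z0") auto
  ultimately show ?thesis by auto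
qed

definition nxt where "nxt R = (SOME z. z \<in> Z \<and> R < z \<and> (\<forall>y\<in>Z. R < y \<longrightarrow> z \<le> y))"

lemma nxt: "nxt R \<in> Z" "R < nxt R" "\<And>y. y \<in> Z \<Longrightarrow> R < y \<Longrightarrow> nxt R \<le> y"
proof -
  have "nxt R \<in> Z \<and> R < nxt R \<and> (\<forall>y\<in>Z. R < y \<longrightarrow> nxt R \<le> y)"
    unfolding nxt_def by (rule someI_ex) (use Z_next in blast)
  then show "nxt R \<in> Z" "R < nxt R" "\<And>y. y \<in> Z \<Longrightarrow> R < y \<Longrightarrow> nxt R \<le> y" by auto
qed

definition L0 where "L0 = (SOME L. \<forall>l\<le>L. D l > 2)"

lemma L0: "l \<le> L0 \<Longrightarrow> D l > 2"
  unfolding L0_def using someI_ex[OF left_end] by blast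

text \<open>For k > 0, zs k is the zero of D in the k-th band; zs 0 is not a zero but a point to the left of all bands.\<close>
primrec zs :: "nat \<Rightarrow> real" where
  "zs 0 = L0"
| "zs (Suc n) = nxt (zs n)"

lemma zs_Suc_less: "zs n < zs (Suc n)"
  by (simp add: nxt)

lemma zs_zero: "k \<ge> 1 \<Longrightarrow> D (zs k) = 0"
  using nxt(1)[of "zs (k - 1)"] by (cases k) (auto simp: Z_def)

lemma zs_gap: "zs n < x \<Longrightarrow> x < zs (Suc n) \<Longrightarrow> D x \<noteq> 0"
  using nxt(3)[of x "zs n"] by (auto simp: Z_def)

lemma zs_mono: "m < n \<Longrightarrow> zs m < zs n"
  using lift_Suc_mono_less[of zs m n, OF zs_Suc_less] .

lemma zs_unbounded: "\<exists>n. R < zs n"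
proof (rule ccontr)
  assume "\<not> ?thesis"
  then have le: "zs n \<le> R" for n by (simp add: not_less)
  have "inj (\<lambda>n. zs (Suc n))"
    by (rule strict_mono_imp_inj_on) (simp add: strict_mono_def zs_mono del: zs.simps)
  then have "infinite (range (\<lambda>n. zs (Suc n)))" by (rule range_inj_infinite)
  moreover have "range (\<lambda>n. zs (Suc n)) \<subseteq> {z \<in> Z. z \<le> R}"
    using le zs_zero by (auto simp: Z_def simp del: zs.simps)
  ultimately show False using Z_finite_below finite_subset by blast
qed

lemma sign_const:
  assumes "zs n < x" "x < zs (Suc n)" "zs n < y" "y < zs (Suc n)"
  shows "sgn (D x) = sgn (D y)"
proof (rule ccontr)
  assume ne: "sgn (D x) \<noteq> sgn (D y)"
  have nz: "D t \<noteq> 0" if "t \<in> {min x y..max x y}" for t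
  proof (rule zs_gap)
    show "zs n < t" using that assms(1,3) by (auto simp: min_def split: if_splits)
    show "t < zs (Suc n)" using that assms(2,4) by (auto simp: max_def simp del: zs.simps split: if_splits)
  qed
  have "connected (D ` {min x y..max x y})"
    by (rule connected_continuous_image[OF cont_on]) simp
  moreover have "D x \<in> D ` {min x y..max x y}" "D y \<in> D ` {min x y..max x y}" by auto
  ultimately have "{min (D x) (D y)..max (D x) (D y)} \<subseteq> D ` {min x y..max x y}"
    by (metis (no_types, lifting) connected_contains_Icc max_def min_def)
  moreover have "0 \<in> {min (D x) (D y)..max (D x) (D y)}"
    using ne by (auto simp: sgn_if min_def max_def split: if_splits)
  ultimately show False using nz by force
qed

definition sg :: "nat \<Rightarrow> real" where "sg n = (-1) ^ n"

lemma sg: "\<bar>sg n\<bar> = 1" "sg (Suc n) = - sg n" "sg n * sg n = 1" "sg n \<noteq> 0"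
  by (simp_all add: sg_def flip: power_mult_distrib)

lemma sg_cases: "sg n = 1 \<or> sg n = -1"
  by (simp add: sg_def minus_one_power_iff)

text \<open>At a zero the discriminant takes values of both signs nearby, so it changes sign there.\<close>
lemma sign_alternates: "zs n < x \<Longrightarrow> x < zs (Suc n) \<Longrightarrow> sg n * D x > 0"
proof (induction n arbitrary: x)
  case 0
  show ?case
  proof (rule ccontr)
    assume "\<not> sg 0 * D x > 0"
    then have "D x \<le> 0" by (simp add: sg_def)
    moreover have "0 \<le> D (zs 0)" using L0[of L0] by simp
    ultimately have "\<exists>y\<ge>zs 0. y \<le> x \<and> D y = 0"
      using 0 by (intro IVT2' cont_on) auto
    then obtain y where y: "zs 0 \<le> y" "y \<le> x" "D y = 0" by blast
    moreover have "y \<noteq> zs 0" using y(3) L0[of L0] by auto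
    ultimately show False using zs_gap[of 0 y] 0 by auto
  qed
next
  case (Suc n)
  show ?case
  proof (rule ccontr)
    assume neg: "\<not> sg (Suc n) * D x > 0"
    \<comment> \<open>Without a sign change at \<open>zs (Suc n)\<close>, \<open>sg n * D\<close>
      would be positive on both sides of this zero, against the existence of nearby negative
      values.\<close>
    have pos: "sg n * D y > 0" if y: "zs (Suc n) < y" "y < zs (Suc (Suc n))" for y
    proof -
      have "sgn (D y) = sgn (D x)" by (rule sign_const[OF y Suc.prems])
      moreover have "sg n * D x \<ge> 0" using neg by (simp add: sg)
      ultimately have "sg n * D y \<ge> 0" using sg_cases[of n] by (auto simp: sgn_if split: if_splits)
      moreover have "sg n * D y \<noteq> 0" using zs_gap[OF y] sg(4) by simp
      ultimately show ?thesis by (metis less_eq_real_def)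
    qed
    have z0: "D (zs (Suc n)) = 0" by (rule zs_zero) simp
    have "min (zs (Suc n) - zs n) (zs (Suc (Suc n)) - zs (Suc n)) > 0"
      using zs_Suc_less[of n] zs_Suc_less[of "Suc n"] by (simp del: zs.simps)
    moreover have "\<bar>D (zs (Suc n))\<bar> \<le> 2" "\<bar>- sg n\<bar> = 1" "(- sg n) * D (zs (Suc n)) < 2"
      using z0 sg by (simp_all del: zs.simps)
    ultimately obtain m where m: "\<bar>m - zs (Suc n)\<bar> < min (zs (Suc n) - zs n) (zs (Suc (Suc n)) - zs (Suc n))"
        "(- sg n) * D m > (- sg n) * D (zs (Suc n))"
      using nearby_value by metis
    then have neg_m: "sg n * D m < 0" using z0 by (simp del: zs.simps)
    consider "m < zs (Suc n)" | "m = zs (Suc n)" | "m > zs (Suc n)" by linarith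
    then show False
    proof cases
      case 1
      then show False using Suc.IH[of m] m(1) neg_m by (auto simp: abs_less_iff simp del: zs.simps)
    next
      case 2
      then show False using neg_m z0 by simp
    next
      case 3
      then show False using pos[of m] m(1) neg_m by (auto simp: abs_less_iff simp del: zs.simps)
    qed
  qed
qed

text \<open>Otherwise \<open>no_interior_max\<close> would bound \<open>sg k * D\<close> on the
  interval by its value 0 at the two zeros, against its positive sign inside.\<close>

lemma large_between:
  assumes "k \<ge> 1"
  shows "\<exists>x. zs k < x \<and> x < zs (Suc k) \<and> sg k * D x \<ge> 2"
proof (rule ccontr)
  assume c: "\<not> ?thesis"
  have lt: "sg k * D x < 2" if "x \<in> {zs k..zs (Suc k)}" for x
  proof (cases "x = zs k \<or> x = zs (Suc k)")
    case True
    then have "D x = 0" using zs_zero assms by (auto simp del: zs.simps)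
    then show ?thesis by simp
  next
    case False
    then have "zs k < x" "x < zs (Suc k)" using that by auto
    then show ?thesis using c not_le by blast
  qed
  have lu: "zs k < zs (Suc k)" by (rule zs_Suc_less)
  define x where "x = (zs k + zs (Suc k)) / 2"
  have x: "zs k < x" "x < zs (Suc k)" using lu by (simp_all add: x_def field_simps del: zs.simps)
  have "sg k * D x \<le> max (max (sg k * D (zs k)) (sg k * D (zs (Suc k)))) (-2)"
    by (rule no_interior_max[OF _ sg(1) lt]) (use x lu in auto)
  also have "\<dots> = 0" using zs_zero[of k] zs_zero[of "Suc k"] assms by (simp del: zs.simps)
  finally show False using sign_alternates[OF x] by simp
qed

section \<open>Band edges as first and last crossings of the levels 2 and -2\<close>

lemma first_crossing:
  fixes f :: "real \<Rightarrow> real"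
  assumes "a \<le> b" "f a \<le> (v::real)" "v \<le> f b" "continuous_on {a..b} f"
  obtains x where "a \<le> x" "x \<le> b" "f x = v" "\<And>y. a \<le> y \<Longrightarrow> y < x \<Longrightarrow> f y < v"
proof -
  define S where "S = {x \<in> {a..b}. f x = v}"
  have "compact S"
  proof -
    have S: "S = {a..b} \<inter> f -` {v}" by (auto simp: S_def)
    have "closed S" unfolding S
      by (rule continuous_closed_preimage[OF assms(4)]) auto
    then show ?thesis using compact_Int_closed[of "{a..b}" S] S by (metis compact_Icc inf.absorb_iff2 inf_le1)
  qed
  moreover have "S \<noteq> {}" using IVT'[of f a v b] assms by (auto simp: S_def)
  ultimately obtain x where x: "x \<in> S" "\<And>y. y \<in> S \<Longrightarrow> x \<le> y"
    using compact_attains_inf[of S] by blast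
  show thesis
  proof (rule that)
    show "a \<le> x" "x \<le> b" "f x = v" using x(1) by (auto simp: S_def)
    fix y assume y: "a \<le> y" "y < x"
    show "f y < v"
    proof (rule ccontr)
      assume "\<not> f y < v"
      then obtain t where t: "a \<le> t" "t \<le> y" "f t = v"
        using IVT'[of f a v y] assms(2) y \<open>x \<le> b\<close> continuous_on_subset[OF assms(4), of "{a..y}"] by force
      then have "t \<in> S" using y \<open>x \<le> b\<close> by (auto simp: S_def)
      then show False using x(2)[of t] t y by simp
    qed
  qed
qed

lemma last_crossing:
  fixes f :: "real \<Rightarrow> real"
  assumes "a \<le> b" "v \<le> f a" "f b \<le> (v::real)" "continuous_on {a..b} f"
  obtains x where "a \<le> x" "x \<le> b" "f x = v" "\<And>y. x < y \<Longrightarrow> y \<le> b \<Longrightarrow> f y < v"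
proof -
  have c: "continuous_on {- b..- a} (\<lambda>x. f (- x))"
    by (rule continuous_on_compose2[OF assms(4)]) (auto intro!: continuous_intros)
  obtain x where x: "- b \<le> x" "x \<le> - a" "f (- x) = v" "\<And>y. - b \<le> y \<Longrightarrow> y < x \<Longrightarrow> f (- y) < v"
    using first_crossing[of "- b" "- a" "\<lambda>x. f (- x)" v, OF _ _ _ c] assms by auto
  show thesis
  proof (rule that[of "- x"])
    show "f y < v" if "- x < y" "y \<le> b" for y using x(4)[of "- y"] that by simp
  qed (use x in auto)
qed

text \<open>The last crossing before the zero \<open>zs (Suc n)\<close> starts the band around that
  zero. For \<open>n = 0\<close> the search begins at \<open>L0\<close>, where \<open>D > 2\<close>;
  otherwise at the point supplied by \<open>large_between\<close>.\<close>

lemma lower_edge: "\<exists>x. zs n < x \<and> x < zs (Suc n) \<and> sg n * D x = 2 \<and> (\<forall>y. x < y \<longrightarrow> y \<le> zs (Suc n) \<longrightarrow> sg n * D y < 2)"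
proof -
  obtain a where a: "zs n \<le> a" "a < zs (Suc n)" "2 \<le> sg n * D a" "n = 0 \<and> a = zs n \<or> zs n < a"
  proof (cases n)
    case 0
    then show thesis using that[of "zs 0"] L0[of L0] zs_Suc_less[of 0] by (simp add: sg_def less_imp_le)
  next
    case (Suc m)
    then show thesis using large_between[of n] that by (metis le_add1 less_imp_le plus_1_eq_Suc)
  qed
  have c: "continuous_on {a..zs (Suc n)} (\<lambda>x. sg n * D x)" by (intro continuous_intros cont_on)
  have "sg n * D (zs (Suc n)) \<le> 2" using zs_zero[of "Suc n"] by (simp del: zs.simps)
  then obtain x where x: "a \<le> x" "x \<le> zs (Suc n)" "sg n * D x = 2" "\<And>y. x < y \<Longrightarrow> y \<le> zs (Suc n) \<Longrightarrow> sg n * D y < 2"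
    using last_crossing[of a "zs (Suc n)" 2 "\<lambda>x. sg n * D x", OF _ _ _ c] a by (metis less_imp_le)
  have "x \<noteq> zs (Suc n)" using x(3) zs_zero[of "Suc n"] by (auto simp del: zs.simps)
  moreover have "x \<noteq> zs n"
  proof
    assume "x = zs n"
    then have "n = 0 \<and> x = L0" using a x(1) by auto
    then show False using x(3) L0[of L0] by (simp add: sg_def)
  qed
  ultimately show ?thesis using x a(1) by (intro exI[of _ x]) auto
qed

lemma upper_edge: "k \<ge> 1 \<Longrightarrow> \<exists>x. zs k < x \<and> x < zs (Suc k) \<and> sg k * D x = 2 \<and> (\<forall>y. zs k \<le> y \<longrightarrow> y < x \<longrightarrow> sg k * D y < 2)"
proof -
  assume k: "k \<ge> 1"
  obtain b where b: "zs k < b" "b < zs (Suc k)" "2 \<le> sg k * D b" using large_between[OF k] by blast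
  have c: "continuous_on {zs k..b} (\<lambda>x. sg k * D x)" by (intro continuous_intros cont_on)
  have z: "sg k * D (zs k) \<le> 2" using zs_zero[OF k] by simp
  obtain x where x: "zs k \<le> x" "x \<le> b" "sg k * D x = 2" "\<And>y. zs k \<le> y \<Longrightarrow> y < x \<Longrightarrow> sg k * D y < 2"
    using first_crossing[of "zs k" b "\<lambda>x. sg k * D x" 2, OF _ z b(3) c] b by (metis less_imp_le)
  moreover have "x \<noteq> zs k" using x(3) zs_zero[OF k] by auto
  ultimately show ?thesis using b by (intro exI[of _ x]) auto
qed

text \<open>The band around \<open>zs (Suc n)\<close> is \<open>{lpl n..lmi (Suc n)}\<close>:
  \<open>lpl 0\<close> is lambda_0, and for \<open>k >= 1\<close> the points \<open>lmi k\<close>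
  and \<open>lpl k\<close>, both between \<open>zs k\<close> and \<open>zs (Suc k)\<close>, are
  lambda_k^- and lambda_k^+.\<close>

definition lpl where "lpl n = (SOME x. zs n < x \<and> x < zs (Suc n) \<and> sg n * D x = 2 \<and> (\<forall>y. x < y \<longrightarrow> y \<le> zs (Suc n) \<longrightarrow> sg n * D y < 2))"
definition lmi where "lmi k = (SOME x. zs k < x \<and> x < zs (Suc k) \<and> sg k * D x = 2 \<and> (\<forall>y. zs k \<le> y \<longrightarrow> y < x \<longrightarrow> sg k * D y < 2))"

lemma lpl: "zs n < lpl n" "lpl n < zs (Suc n)" "sg n * D (lpl n) = 2"
    "\<And>y. lpl n < y \<Longrightarrow> y \<le> zs (Suc n) \<Longrightarrow> sg n * D y < 2"
  using someI_ex[OF lower_edge[of n]] unfolding lpl_def[symmetric] by blast+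

lemma lmi:
  assumes "k \<ge> 1"
  shows "zs k < lmi k" "lmi k < zs (Suc k)" "sg k * D (lmi k) = 2"
    "\<And>y. zs k \<le> y \<Longrightarrow> y < lmi k \<Longrightarrow> sg k * D y < 2"
  using someI_ex[OF upper_edge[OF assms]] unfolding lmi_def[symmetric] by blast+

lemma abs_D_le_2:
  assumes "sg n * D x < 2" "sg n * D x \<ge> 0"
  shows "\<bar>D x\<bar> \<le> 2"
proof -
  have "\<bar>D x\<bar> = \<bar>sg n * D x\<bar>" by (simp add: abs_mult sg)
  then show ?thesis using assms by simp
qed

lemma abs_D_eq_2: "sg n * D x = 2 \<Longrightarrow> \<bar>D x\<bar> = 2"
  using abs_mult[of "sg n" "D x"] sg(1) by simp

text \<open>These are the first and the last point between the same two zeros at which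
  \<open>sg k * D\<close> equals 2. They may coincide, which is a closed gap.\<close>

lemma lmi_le_lpl: "k \<ge> 1 \<Longrightarrow> lmi k \<le> lpl k"
  using lmi(4)[of k "lpl k"] lpl(1,3)[of k] by fastforce

lemma band_subset:
  assumes "x \<in> {lpl n..lmi (Suc n)}"
  shows "\<bar>D x\<bar> \<le> 2"
proof -
  consider "x = lpl n" | "lpl n < x" "x < zs (Suc n)" | "x = zs (Suc n)" | "zs (Suc n) < x" "x < lmi (Suc n)" | "x = lmi (Suc n)"
    using assms by fastforce
  then show ?thesis
  proof cases
    case 1
    then show ?thesis using abs_D_eq_2[OF lpl(3)[of n]] by simp
  next
    case 2
    then show ?thesis using lpl(1,4)[of n] sign_alternates[of n x]
      by (intro abs_D_le_2[of n]) (auto simp del: zs.simps)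
  next
    case 3
    then show ?thesis using zs_zero[of "Suc n"] by (simp del: zs.simps)
  next
    case 4
    then show ?thesis using lmi(2,4)[of "Suc n"] sign_alternates[of "Suc n" x]
      by (intro abs_D_le_2[of "Suc n"]) (auto simp del: zs.simps)
  next
    case 5
    then show ?thesis using abs_D_eq_2[OF lmi(3)[of "Suc n"]] by simp
  qed
qed

text \<open>\<open>gap_strict\<close> is used with reversed sign: between the two edges
  \<open>sg k * D\<close> is positive, so \<open>- sg k * D\<close> stays below 2, and it equals -2
  at both ends.\<close>

lemma gap_excluded:
  assumes k: "k \<ge> 1" and x: "lmi k < x" "x < lpl k"
  shows "\<bar>D x\<bar> > 2"
proof -
  have "- sg k * D x < -2"
  proof (rule gap_strict[of "- sg k" "lmi k" "lpl k"])
    show "- sg k * D y < 2" if "y \<in> {lmi k..lpl k}" for y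
    proof -
      have "zs k < y" "y < zs (Suc k)" using that lmi(1)[OF k] lpl(2)[of k] by auto
      then have "sg k * D y > 0" by (rule sign_alternates)
      then show ?thesis by simp
    qed
  qed (use sg lmi(3)[OF k] lpl(3)[of k] x in auto)
  then have "\<bar>sg k * D x\<bar> > 2" by simp
  then show ?thesis by (simp add: abs_mult sg)
qed

lemma below_excluded:
  assumes "x < lpl 0"
  shows "\<bar>D x\<bar> > 2"
proof (cases "x \<le> L0")
  case True
  then show ?thesis using L0 by fastforce
next
  case False
  have "- sg 0 * D x < -2"
  proof (rule gap_strict[of "- sg 0" L0 "lpl 0"])
    show "- sg 0 * D y < 2" if "y \<in> {L0..lpl 0}" for y
      using sign_alternates[of 0 y] lpl(2)[of 0] that L0[of y] by (cases "y = L0") (auto simp: sg_def)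
  qed (use sg lpl(3)[of 0] False assms L0[of L0] in \<open>auto simp: sg_def\<close>)
  then show ?thesis by (simp add: sg_def)
qed

theorem band_structure: "{l. \<bar>D l\<bar> \<le> 2} = {lpl 0..lmi 1} \<union> (\<Union>k\<in>{1..}. {lpl k..lmi (k + 1)})"
proof (intro equalityI subsetI)
  fix x assume "x \<in> {l. \<bar>D l\<bar> \<le> 2}"
  then have x: "\<bar>D x\<bar> \<le> 2" by simp
  define n where "n = (LEAST n. x < zs n)"
  have n: "x < zs n" unfolding n_def using zs_unbounded by (rule LeastI_ex)
  have n0: "n \<noteq> 0"
  proof
    assume "n = 0"
    then show False using n L0[of x] x by simp
  qed
  then obtain m where m: "n = Suc m" by (cases n) auto
  have zm: "zs m \<le> x" using not_less_Least[of m "\<lambda>n. x < zs n"] m by (simp add: n_def)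
  \<comment> \<open>Between \<open>zs m\<close> and \<open>zs (Suc m)\<close> lie only the tail of
    the band ending at \<open>lmi m\<close> and the head of the band starting at
    \<open>lpl m\<close>.\<close>
  have "x \<in> {lpl m..lmi (Suc m)} \<or> (m \<ge> 1 \<and> x \<in> {lpl (m - 1)..lmi m})"
  proof (cases "lpl m \<le> x")
    case True
    then show ?thesis using n m lmi(1)[of "Suc m"] by (simp del: zs.simps)
  next
    case False
    then have m1: "m \<ge> 1" using below_excluded[of x] x by (cases m) auto
    have "x \<le> lmi m" using gap_excluded[OF m1, of x] False x by force
    moreover have "lpl (m - 1) \<le> x" using lpl(2)[of "m - 1"] zm m1 by (simp del: zs.simps)
    ultimately show ?thesis using m1 by simp
  qed
  then consider "x \<in> {lpl m..lmi (Suc m)}" | "m \<ge> 1" "x \<in> {lpl (m - 1)..lmi m}" by blast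
  then obtain j where j: "x \<in> {lpl j..lmi (Suc j)}" by cases (auto intro: that[of m] that[of "m - 1"])
  show "x \<in> {lpl 0..lmi 1} \<union> (\<Union>k\<in>{1..}. {lpl k..lmi (k + 1)})"
  proof (cases "j = 0")
    case True
    then show ?thesis using j by simp
  next
    case False
    then show ?thesis using j by auto
  qed
next
  fix x assume "x \<in> {lpl 0..lmi 1} \<union> (\<Union>k\<in>{1..}. {lpl k..lmi (k + 1)})"
  then show "x \<in> {l. \<bar>D l\<bar> \<le> 2}" using band_subset[of x] by auto
qed

end

section \<open>The discriminant as an entire function\<close>

text \<open>Under \<open>x = k * sqrt t\<close> the claim becomes the decay of
  \<open>x ^ (2 * n) / exp x\<close>.\<close>

lemma exp_sqrt_not_polynomially_bounded:
  fixes k S T :: real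
  assumes "k > 0"
  shows "\<exists>t\<ge>T. t \<ge> 1 \<and> S * t ^ n < exp (k * sqrt t)"
proof -
  have "((\<lambda>x::real. S * inverse k ^ (2 * n) * (x ^ (2 * n) / exp x)) \<longlongrightarrow> S * inverse k ^ (2 * n) * 0) at_top"
    by (intro tendsto_mult tendsto_const tendsto_power_div_exp_0)
  then have "\<forall>\<^sub>F x in at_top. S * inverse k ^ (2 * n) * (x ^ (2 * n) / exp x) < 1"
    by (rule order_tendstoD) simp
  moreover have "filterlim (\<lambda>t. k * sqrt t) at_top at_top"
    using assms by real_asymp
  ultimately have "\<forall>\<^sub>F t in at_top. S * inverse k ^ (2 * n) * ((k * sqrt t) ^ (2 * n) / exp (k * sqrt t)) < 1"
    by (rule eventually_compose_filterlim)
  then have "\<forall>\<^sub>F t in at_top. T \<le> t \<and> 1 \<le> t \<and> S * t ^ n < exp (k * sqrt t)"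
    using eventually_ge_at_top[of T] eventually_ge_at_top[of 1]
  proof eventually_elim
    case (elim t)
    have "(k * sqrt t) ^ (2 * n) = k ^ (2 * n) * t ^ n"
      using elim by (simp add: power_mult_distrib power_mult)
    then have "S * inverse k ^ (2 * n) * ((k * sqrt t) ^ (2 * n) / exp (k * sqrt t)) = S * t ^ n / exp (k * sqrt t)"
      using assms by (simp add: field_simps)
    then show ?case using elim by (simp add: field_simps)
  qed
  then obtain t where "T \<le> t \<and> 1 \<le> t \<and> S * t ^ n < exp (k * sqrt t)"
    using eventually_happens[of _ at_top] by (metis (no_types, lifting) trivial_limit_at_top_linorder)
  then show ?thesis by blast
qed

context hill
begin

section \<open>Level sets of the discriminant\<close>

lemma Delta_not_polynomial: "\<not> (\<forall>z. Delta z = (\<Sum>i\<le>n. c i * z ^ i))"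
proof
  assume p: "\<forall>z. Delta z = (\<Sum>i\<le>n. c i * z ^ i)"
  obtain k T where kT: "k > 0" "\<And>t. t \<ge> T \<Longrightarrow> Re (Delta (of_real (- t))) \<ge> exp (k * sqrt t)"
    using Delta_growth by blast
  obtain t where t: "t \<ge> T" "t \<ge> 1" "(\<Sum>i\<le>n. cmod (c i)) * t ^ n < exp (k * sqrt t)"
    using exp_sqrt_not_polynomially_bounded[OF kT(1)] by blast
  have "Re (Delta (of_real (- t))) \<le> cmod (\<Sum>i\<le>n. c i * of_real (- t) ^ i)"
    using p complex_Re_le_cmod by metis
  also have "\<dots> \<le> (\<Sum>i\<le>n. cmod (c i) * t ^ n)"
  proof (rule order_trans[OF norm_sum sum_mono])
    fix i assume "i \<in> {..n}"
    then have "t ^ i \<le> t ^ n" using t(2) by (intro power_increasing) auto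
    then show "cmod (c i * of_real (- t) ^ i) \<le> cmod (c i) * t ^ n"
      using t(2) by (simp add: norm_mult norm_power mult_left_mono)
  qed
  also have "\<dots> = (\<Sum>i\<le>n. cmod (c i)) * t ^ n" by (simp add: sum_distrib_right)
  finally show False using kT(2)[OF t(1)] t(3) by linarith
qed

lemma Delta_not_constant: "\<exists>z. Delta z \<noteq> w"
  using Delta_not_polynomial[of "\<lambda>_. w" 0] by auto

lemma Delta_minus_not_constant_on: "\<not> (\<lambda>z. Delta z - w) constant_on UNIV"
proof
  assume "(\<lambda>z. Delta z - w) constant_on UNIV"
  then obtain v where "\<And>z. Delta z - w = v" unfolding constant_on_def by auto
  then have "Delta z = v + w" for z by (metis diff_add_cancel)
  then show False using Delta_not_constant[of "v + w"] by blast
qed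

lemma Delta_level_set_finite: "finite {l. \<bar>l\<bar> \<le> R \<and> Delta (of_real l) = w}"
proof -
  have "finite {z \<in> cball 0 R. Delta z - w = 0}"
    by (rule holomorphic_compact_finite_zeros[where S=UNIV])
      (use Delta_minus_not_constant_on in \<open>auto intro!: holomorphic_intros Delta_holomorphic\<close>)
  then have "finite (of_real -` {z \<in> cball 0 R. Delta z - w = 0} :: real set)"
    by (rule finite_vimageI) (simp add: inj_on_def)
  then show ?thesis by (rule finite_subset[rotated]) (auto simp: norm_of_real)
qed

text \<open>Great Picard is applied at 0 to \<open>Delta\<close> composed with inversion. The
  singularity is essential: a finite limit would make \<open>Delta\<close> constant by Liouville, a
  pole would make it a polynomial, and the growth along the negative axis excludes both.\<close>

lemma Delta_level_sets_infinite:
  obtains a where "\<And>w. w \<noteq> a \<Longrightarrow> infinite {z. Delta z = w}"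
proof -
  have nlim1: "\<not> ((Delta \<circ> inverse) \<longlongrightarrow> l) (at 0)" for l
  proof
    assume "((Delta \<circ> inverse) \<longlongrightarrow> l) (at 0)"
    then have "(Delta \<longlongrightarrow> l) at_infinity" by (simp add: lim_at_infinity_0)
    then have "Delta z = l" for z by (rule Liouville_weak[OF Delta_holomorphic])
    then show False using Delta_not_constant[of l] by blast
  qed
  have nlim2: "\<not> ((inverse \<circ> (Delta \<circ> inverse)) \<longlongrightarrow> l) (at 0)" for l
  proof
    assume "((inverse \<circ> (Delta \<circ> inverse)) \<longlongrightarrow> l) (at 0)"
    then have "((inverse \<circ> Delta) \<longlongrightarrow> l) at_infinity" by (simp add: lim_at_infinity_0 comp_assoc)
    then obtain c n where "\<And>z. Delta z = (\<Sum>i\<le>n. c i * z ^ i)"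
      using pole_at_infinity[OF Delta_holomorphic] by blast
    then show False using Delta_not_polynomial by blast
  qed
  have hol: "(Delta \<circ> inverse) holomorphic_on (UNIV - {0})"
    by (rule holomorphic_on_compose_gen[where t=UNIV]) (auto intro!: holomorphic_intros Delta_holomorphic)
  obtain a where a: "\<And>w. w \<noteq> a \<Longrightarrow> infinite {x. x \<in> UNIV - {0} \<and> (Delta \<circ> inverse) x = w}"
    using great_Picard_infinite[OF open_UNIV UNIV_I hol nlim1 nlim2] by blast
  have "infinite {z. Delta z = w}" if "w \<noteq> a" for w
  proof
    assume "finite {z. Delta z = w}"
    then have "finite (inverse ` {z. Delta z = w})" by (rule finite_imageI)
    then have "finite {x. x \<in> UNIV - {0} \<and> (Delta \<circ> inverse) x = w}"
    proof (rule finite_subset[rotated])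
      show "{x. x \<in> UNIV - {0} \<and> (Delta \<circ> inverse) x = w} \<subseteq> inverse ` {z. Delta z = w}"
        by (force intro: image_eqI[where x="inverse x" for x])
    qed
    then show False using a[OF that] by blast
  qed
  then show thesis using that by blast
qed

definition disc :: "real \<Rightarrow> real" where "disc l = Re (Delta (of_real l))"

lemma Delta_disc: "Delta (of_real l) = of_real (disc l)"
  using Delta_real[of l] by (simp add: disc_def complex_eq_iff)

lemma disc_continuous: "continuous_on UNIV disc"
proof -
  have "continuous_on UNIV Delta" by (rule holomorphic_on_imp_continuous_on[OF Delta_holomorphic])
  then have "continuous_on UNIV (\<lambda>l. Delta (of_real l))"
    by (rule continuous_on_compose2) (auto intro!: continuous_intros)
  then show ?thesis unfolding disc_def[abs_def] by (intro continuous_intros)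
qed

lemma disc_left_end: "\<exists>L. \<forall>l\<le>L. disc l > 2"
proof -
  obtain k T where kT: "k > 0" "\<And>t. t \<ge> T \<Longrightarrow> Re (Delta (of_real (- t))) \<ge> exp (k * sqrt t)"
    using Delta_growth by blast
  define t0 where "t0 = max T (4 / k\<^sup>2)"
  have "disc l > 2" if "l \<le> - t0" for l
  proof -
    have l: "- l \<ge> T" "- l \<ge> (2 / k)\<^sup>2" using that by (auto simp: t0_def power_divide)
    have "2 / k \<le> sqrt (- l)" using l(2) by (rule real_le_rsqrt)
    then have "2 \<le> k * sqrt (- l)" using kT(1) by (simp add: field_simps)
    moreover have "1 + k * sqrt (- l) \<le> exp (k * sqrt (- l))" by (rule exp_ge_add_one_self)
    moreover have "disc l \<ge> exp (k * sqrt (- l))" using kT(2)[OF l(1)] by (simp add: disc_def)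
    ultimately show ?thesis by linarith
  qed
  then show ?thesis by blast
qed

text \<open>All points of the level set are real and lie to the right of some \<open>L\<close>, and
  each bounded interval holds finitely many of them, so they must escape to the right.\<close>

lemma disc_level_unbounded:
  assumes inf: "infinite {z. Delta z = of_real w}" and w: "\<bar>w\<bar> \<le> 2"
  shows "\<exists>l>R. disc l = w"
proof (rule ccontr)
  assume c: "\<not> ?thesis"
  obtain L where L: "\<And>l. l \<le> L \<Longrightarrow> disc l > 2" using disc_left_end by blast
  have "{z. Delta z = of_real w} \<subseteq> of_real ` {l. \<bar>l\<bar> \<le> max \<bar>L\<bar> \<bar>R\<bar> \<and> Delta (of_real l) = of_real w}"
  proof
    fix z assume "z \<in> {z. Delta z = of_real w}"
    then have z: "Delta z = of_real w" by simp
    then have "Im z = 0" using Delta_band_real w by blast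
    then have zr: "z = of_real (Re z)" by (simp add: complex_eq_iff)
    then have dz: "disc (Re z) = w" using z Delta_disc[of "Re z"] by simp
    have "Re z \<le> R" using c dz by force
    moreover have "L \<le> Re z" using L[of "Re z"] dz w by (cases "Re z \<le> L") auto
    ultimately have "\<bar>Re z\<bar> \<le> max \<bar>L\<bar> \<bar>R\<bar>" by linarith
    then show "z \<in> of_real ` {l. \<bar>l\<bar> \<le> max \<bar>L\<bar> \<bar>R\<bar> \<and> Delta (of_real l) = of_real w}"
      using z zr by (metis (mono_tags, lifting) image_eqI mem_Collect_eq)
  qed
  then have "finite {z. Delta z = of_real w}"
    by (rule finite_subset[OF _ finite_imageI[OF Delta_level_set_finite]])
  then show False using inf by simp
qed

lemma disc_zeros_unbounded: "\<exists>l>R. disc l = 0"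
proof -
  obtain a where a: "\<And>w. w \<noteq> a \<Longrightarrow> infinite {z. Delta z = w}"
    using Delta_level_sets_infinite by blast
  show ?thesis
  proof (cases "a = 0")
    case False
    then show ?thesis using disc_level_unbounded[of 0 R] a[of 0] by auto
  next
    case True
    \<comment> \<open>If 0 is the exceptional value in Picard's theorem, then 1 and -1 are not, and
      a zero lies between points where these are taken.\<close>
    obtain l m where lm: "l > R" "disc l = 1" "m > R" "disc m = -1"
      using disc_level_unbounded[of 1 R] disc_level_unbounded[of "-1" R] a[of 1] a[of "-1"] True by auto
    have "connected (disc ` {R<..})"
      by (rule connected_continuous_image[OF continuous_on_subset[OF disc_continuous]]) auto
    moreover have "-1 \<in> disc ` {R<..}" "1 \<in> disc ` {R<..}"
      using lm by (metis greaterThan_iff image_eqI)+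
    ultimately have "0 \<in> disc ` {R<..}"
      by (rule connectedD_interval) auto
    then show ?thesis by auto
  qed
qed

lemma discriminant_disc: "discriminant disc"
proof
  show "continuous_on UNIV disc" by (rule disc_continuous)
  show "\<exists>L. \<forall>l\<le>L. disc l > 2" by (rule disc_left_end)
  show "finite {l. \<bar>l\<bar> \<le> R \<and> disc l = 0}" for R
    using Delta_level_set_finite[of R 0] by (simp add: Delta_disc)
  show "infinite {l. disc l = 0}"
  proof
    assume "finite {l. disc l = 0}"
    then obtain R where "\<And>l. disc l = 0 \<Longrightarrow> l \<le> R"
      by (metis (mono_tags) finite_has_maximal2 Max_ge mem_Collect_eq)
    then show False using disc_zeros_unbounded[of R] by force
  qed
  fix l e :: real assume l: "\<bar>disc l\<bar> \<le> 2" and e: "e > 0"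
  have "open (Delta ` ball (of_real l) e)"
  proof (rule open_mapping_thm[OF Delta_holomorphic[of UNIV]])
    show "\<not> Delta constant_on UNIV"
      using Delta_minus_not_constant_on[of 0] by simp
  qed auto
  moreover have "Delta (of_real l) \<in> Delta ` ball (of_real l) e" using e by simp
  ultimately obtain d where d: "d > 0" "ball (Delta (of_real l)) d \<subseteq> Delta ` ball (of_real l) e"
    by (metis openE)
  have "\<exists>m. \<bar>m - l\<bar> < e \<and> disc m = y" if y: "\<bar>y\<bar> \<le> 2" "\<bar>y - disc l\<bar> < d" for y
  proof -
    have "dist (Delta (of_real l)) (of_real y) = \<bar>y - disc l\<bar>"
      unfolding Delta_disc dist_of_real by (simp add: dist_real_def abs_minus_commute)
    then have "of_real y \<in> Delta ` ball (of_real l) e"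
      using d(2) y(2) by (metis mem_ball subsetD)
    then obtain z where z: "z \<in> ball (of_real l) e" "Delta z = of_real y" by (metis imageE)
    have "Im z = 0" by (rule Delta_band_real[OF z(2) y(1)])
    then have zr: "z = of_real (Re z)" by (simp add: complex_eq_iff)
    then have "dist (complex_of_real l) (complex_of_real (Re z)) < e" using z(1) by simp
    then have "\<bar>Re z - l\<bar> < e" unfolding dist_of_real by (simp add: dist_real_def abs_minus_commute)
    moreover have "disc (Re z) = y" using z(2) zr by (simp add: disc_def)
    ultimately show ?thesis by blast
  qed
  then show "\<exists>d>0. \<forall>y. \<bar>y\<bar> \<le> 2 \<longrightarrow> \<bar>y - disc l\<bar> < d \<longrightarrow> (\<exists>m. \<bar>m - l\<bar> < e \<and> disc m = y)"
    using d(1) by blast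
qed

theorem disc_bands:
  obtains lam0 :: real and lm lp :: "nat \<Rightarrow> real" where
    "lam0 < lm 1" "\<And>k. k \<ge> 1 \<Longrightarrow> lm k \<le> lp k" "\<And>k. k \<ge> 1 \<Longrightarrow> lp k < lm (k + 1)"
    "{l. \<bar>disc l\<bar> \<le> 2} = {lam0..lm 1} \<union> (\<Union>k\<in>{1..}. {lp k..lm (k + 1)})"
    "disc lam0 = 2" "\<And>k. k \<ge> 1 \<Longrightarrow> disc (lm k) = 2 * (-1) ^ k" "\<And>k. k \<ge> 1 \<Longrightarrow> disc (lp k) = 2 * (-1) ^ k"
proof -
  interpret discriminant disc by (rule discriminant_disc)
  have less: "lpl k < lmi (Suc k)" for k
    using lpl(2)[of k] lmi(1)[of "Suc k"] by (simp del: zs.simps)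
  have sgD: "disc x = 2 * (-1) ^ k" if "sg k * disc x = 2" for x k
    using that sg(3)[of k] by (metis mult.assoc mult.commute mult.left_neutral sg_def)
  show thesis
  proof (rule that)
    show "lpl 0 < lmi 1" using less[of 0] by simp
    show "{l. \<bar>disc l\<bar> \<le> 2} = {lpl 0..lmi 1} \<union> (\<Union>k\<in>{1..}. {lpl k..lmi (k + 1)})" by (rule band_structure)
    show "disc (lpl 0) = 2" using sgD[OF lpl(3)[of 0]] by simp
    show "lmi k \<le> lpl k" if "k \<ge> 1" for k by (rule lmi_le_lpl[OF that])
    show "lpl k < lmi (k + 1)" for k using less[of k] by simp
    show "disc (lmi k) = 2 * (-1) ^ k" if "k \<ge> 1" for k by (rule sgD[OF lmi(3)[OF that]])
    show "disc (lpl k) = 2 * (-1) ^ k" for k by (rule sgD[OF lpl(3)])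
  qed
qed

end

section \<open>Gauge transformation\<close>

lemma set_integrable_shift:
  fixes g :: "real \<Rightarrow> complex"
  assumes "set_integrable lborel {a + k..b + k} g"
  shows "set_integrable lborel {a..b} (\<lambda>x. g (x + k))"
    and "(LINT x:{a..b}|lborel. g (x + k)) = (LINT x:{a + k..b + k}|lborel. g x)"
proof -
  have e: "indicator {a + k..b + k} (k + 1 * x) *\<^sub>R g (k + 1 * x) = indicator {a..b} x *\<^sub>R g (x + k)" for x
    by (auto simp: indicator_def add.commute)
  show "set_integrable lborel {a..b} (\<lambda>x. g (x + k))"
    using lborel_integrable_real_affine[OF assms[unfolded set_integrable_def], of 1 k]
    unfolding e by (simp add: set_integrable_def)
  show "(LINT x:{a..b}|lborel. g (x + k)) = (LINT x:{a + k..b + k}|lborel. g x)"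
    unfolding set_lebesgue_integral_def
    by (subst (2) lborel_integral_real_affine[of 1 _ k]) (simp_all only: e, simp_all)
qed

lemma loc_AC_shift:
  assumes "loc_AC u g"
  shows "loc_AC (\<lambda>x. u (x + k)) (\<lambda>x. g (x + k))"
proof (rule loc_ACI)
  fix a b :: real
  show "set_integrable lborel {a..b} (\<lambda>x. g (x + k))"
    by (rule set_integrable_shift(1)[OF loc_AC_int[OF assms]])
  assume "a \<le> b"
  then show "u (b + k) - u (a + k) = (LINT x:{a..b}|lborel. g (x + k))"
    unfolding set_integrable_shift(2)[OF loc_AC_int[OF assms]]
    by (intro loc_AC_diff[OF assms]) simp
qed

text \<open>The increment over one period is independent of \<open>x\<close> and equals the mean of
  \<open>g\<close>. This is why \<open>Q\<close> must have mean zero and why \<open>G_mean\<close>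
  is subtracted from \<open>G\<close>.\<close>

lemma loc_AC_periodic:
  assumes u: "loc_AC u g" and g: "\<And>x. g (x + 1) = g x" and z: "(LINT x:{0..1}|lborel. g x) = 0"
  shows "u (x + 1) = u x"
proof -
  have "loc_AC (\<lambda>x. 1 * u (x + 1) + (-1) * u x) (\<lambda>x. 1 * g (x + 1) + (-1) * g x)"
    by (intro loc_AC_lincomb loc_AC_shift u)
  then have d: "loc_AC (\<lambda>x. u (x + 1) - u x) (\<lambda>x. 0)" by (simp add: g)
  have "u (x + 1) - u x = u (0 + 1) - u 0"
    using loc_AC_diff[OF d, of 0 x] loc_AC_diff[OF d, of x 0] by (cases "0 \<le> x") auto
  also have "\<dots> = 0" using loc_AC_diff[OF u, of 0 1] z by simp
  finally show ?thesis by simp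
qed

lemma loc_AC_indefinite:
  assumes "\<And>a b. set_integrable lborel {a..b} g"
  shows "loc_AC (\<lambda>x. k + (LBINT t=ereal 0..ereal x. g t)) g"
  unfolding loc_AC_def using assms by simp

lemma set_integrable_periodic:
  fixes g :: "real \<Rightarrow> complex"
  assumes i: "set_integrable lborel {0..1} g" and g: "\<And>x. g (x + 1) = g x"
  shows "set_integrable lborel {a..b} g"
proof -
  have n: "set_integrable lborel {of_int n..of_int n + 1} g" for n :: int
  proof -
    have "set_integrable lborel {of_int n + of_int (- n)..of_int n + 1 + of_int (- n)} g" using i by simp
    from set_integrable_shift(1)[OF this] show ?thesis
      using periodic_shift_int[of g, OF g, of _ "- n"] by simp
  qed
  have U: "set_integrable lborel (\<Union>n\<in>{\<lfloor>a\<rfloor>..\<lfloor>b\<rfloor>}. {of_int n..of_int n + 1}) g"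
    by (rule set_integrable_UN) (auto intro: n)
  have V: "{a..b} \<subseteq> (\<Union>n\<in>{\<lfloor>a\<rfloor>..\<lfloor>b\<rfloor>}. {of_int n..of_int n + 1})"
  proof
    fix x assume x: "x \<in> {a..b}"
    have "\<lfloor>x\<rfloor> \<in> {\<lfloor>a\<rfloor>..\<lfloor>b\<rfloor>}" using x by (auto intro: floor_mono)
    moreover have "x \<in> {of_int \<lfloor>x\<rfloor>..of_int \<lfloor>x\<rfloor> + 1}"
      using real_of_int_floor_add_one_ge[of x] by (simp)
    ultimately show "x \<in> (\<Union>n\<in>{\<lfloor>a\<rfloor>..\<lfloor>b\<rfloor>}. {of_int n..of_int n + 1})" by blast
  qed
  show ?thesis by (rule set_integrable_subset[OF U _ V]) simp
qed

lemma L2R_lincomb: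
  assumes u: "L2R u" and v: "L2R v"
  shows "L2R (\<lambda>x. k * u x + l * v x)"
proof -
  have m: "u \<in> borel_measurable borel" "v \<in> borel_measurable borel" using u v by (auto simp: L2R_def)
  have i: "integrable lborel (\<lambda>x. (cmod (u x))\<^sup>2)" "integrable lborel (\<lambda>x. (cmod (v x))\<^sup>2)"
    using u v by (auto simp: L2R_def)
  have "integrable lborel (\<lambda>x. (cmod (k * u x + l * v x))\<^sup>2)"
  proof (rule Bochner_Integration.integrable_bound)
    show "integrable lborel (\<lambda>x. 2 * (cmod k)\<^sup>2 * (cmod (u x))\<^sup>2 + 2 * (cmod l)\<^sup>2 * (cmod (v x))\<^sup>2)"
      by (intro Bochner_Integration.integrable_add integrable_mult_right i)
    show "(\<lambda>x. (cmod (k * u x + l * v x))\<^sup>2) \<in> borel_measurable lborel" using m by simp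
    have le: "(cmod (k * p + l * q))\<^sup>2 \<le> 2 * (cmod k)\<^sup>2 * (cmod p)\<^sup>2 + 2 * (cmod l)\<^sup>2 * (cmod q)\<^sup>2" for p q
    proof -
      have "(cmod (k * p + l * q))\<^sup>2 \<le> (cmod (k * p) + cmod (l * q))\<^sup>2"
        by (intro power_mono norm_triangle_ineq) auto
      also have "\<dots> \<le> 2 * (cmod (k * p))\<^sup>2 + 2 * (cmod (l * q))\<^sup>2"
        using zero_le_power2[of "cmod (k * p) - cmod (l * q)"] by (simp add: power2_eq_square algebra_simps)
      finally show ?thesis by (simp add: norm_mult power_mult_distrib)
    qed
    show "AE x in lborel. norm ((cmod (k * u x + l * v x))\<^sup>2)
        \<le> norm (2 * (cmod k)\<^sup>2 * (cmod (u x))\<^sup>2 + 2 * (cmod l)\<^sup>2 * (cmod (v x))\<^sup>2)"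
      using le by (intro AE_I2) (simp add: order_trans[OF le abs_ge_self])
  qed
  then show ?thesis using m by (simp add: L2R_def)
qed

text \<open>With E = exp (int Q) and F a periodic antiderivative of
  Q^2 E^2 minus its mean, the unknowns a = u / E and c = E (u' - Q u) + F a satisfy a
  first order system with continuous periodic coefficients.\<close>

locale potential =
  fixes Q :: "real \<Rightarrow> real"
  assumes adm: "admissible_Q Q"
begin

lemma Q_measurable [measurable]: "Q \<in> borel_measurable borel"
  using adm by (simp add: admissible_Q_def)

lemma Q_periodic: "Q (x + 1) = Q x"
  using adm by (simp add: admissible_Q_def)

lemma Q_integrable: "set_integrable lborel {a..b} (\<lambda>x. complex_of_real (Q x))"
proof (rule set_integrable_periodic)
  have "set_integrable lborel {0..1} Q" using adm by (simp add: admissible_Q_def)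
  then show "set_integrable lborel {0..1} (\<lambda>x. complex_of_real (Q x))"
    unfolding set_integrable_def by (auto dest: integrable_of_real[where 'a=complex] simp: scaleR_conv_of_real)
qed (simp add: Q_periodic)

lemma Q2_integrable: "set_integrable lborel {a..b} (\<lambda>x. complex_of_real ((Q x)\<^sup>2))"
proof (rule set_integrable_periodic)
  have "set_integrable lborel {0..1} (\<lambda>x. (Q x)\<^sup>2)" using adm by (simp add: admissible_Q_def)
  then show "set_integrable lborel {0..1} (\<lambda>x. complex_of_real ((Q x)\<^sup>2))"
    unfolding set_integrable_def
    by (auto dest: integrable_of_real[where 'a=complex] simp: scaleR_conv_of_real simp del: of_real_power)
qed (simp add: Q_periodic)

definition P :: "real \<Rightarrow> real" where "P x = (LBINT t=ereal 0..ereal x. Q t)"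

lemma P_AC: "loc_AC (\<lambda>x. complex_of_real (P x)) (\<lambda>x. complex_of_real (Q x))"
proof -
  have "complex_of_real (P x) = 0 + (LBINT t=ereal 0..ereal x. complex_of_real (Q t))" for x
    by (simp add: P_def interval_lebesgue_integral_of_real)
  then show ?thesis using loc_AC_indefinite[OF Q_integrable, of 0] by simp
qed

lemma P_periodic: "P (x + 1) = P x"
proof -
  have "(LINT x:{0..1}|lborel. complex_of_real (Q x)) = 0"
    using adm by (simp add: set_integral_complex_of_real admissible_Q_def)
  then have "complex_of_real (P (x + 1)) = complex_of_real (P x)"
    by (intro loc_AC_periodic[OF P_AC]) (simp_all add: Q_periodic)
  then show ?thesis by simp
qed

definition E :: "real \<Rightarrow> real" where "E x = exp (P x)"

lemma E_AC: "loc_AC (\<lambda>x. complex_of_real (E x)) (\<lambda>x. complex_of_real (Q x) * complex_of_real (E x))"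
  using loc_AC_exp[OF P_AC] by (simp add: E_def exp_of_real)

lemma E_inverse_AC: "loc_AC (\<lambda>x. inverse (complex_of_real (E x))) (\<lambda>x. - complex_of_real (Q x) * inverse (complex_of_real (E x)))"
  using loc_AC_exp[OF loc_AC_cmult[OF P_AC, of "-1"]] by (simp add: E_def exp_minus flip: exp_of_real)

lemma continuous_of_complex:
  fixes f :: "real \<Rightarrow> real"
  assumes "continuous_on S (\<lambda>x. complex_of_real (f x))"
  shows "continuous_on S f"
  using continuous_on_Re[OF assms] by simp

lemma E_continuous: "continuous_on S E"
  by (rule continuous_of_complex[OF loc_AC_continuous[OF E_AC]])

lemma E_positive: "E x > 0" by (simp add: E_def)

lemma E_periodic: "E (x + 1) = E x" by (simp add: E_def P_periodic)

definition G :: "real \<Rightarrow> real" where "G x = (Q x)\<^sup>2 * (E x)\<^sup>2"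

lemma G_integrable: "set_integrable lborel {a..b} (\<lambda>x. complex_of_real (G x))"
proof -
  have "continuous_on {a..b} (\<lambda>x. complex_of_real ((E x)\<^sup>2))"
    by (intro continuous_intros E_continuous)
  from set_integrable_mult_continuous[OF Q2_integrable this] show ?thesis
    by (simp add: G_def mult.commute)
qed

definition G_mean :: real where "G_mean = (LINT x:{0..1}|lborel. G x)"

definition F :: "real \<Rightarrow> real" where "F x = (LBINT t=ereal 0..ereal x. G t - G_mean)"

lemma G_centred_integrable: "set_integrable lborel {a..b} (\<lambda>x. complex_of_real (G x - G_mean))"
  unfolding of_real_diff
  by (intro set_integral_diff(1) G_integrable set_integrable_continuous_Icc continuous_intros)

lemma F_AC: "loc_AC (\<lambda>x. complex_of_real (F x)) (\<lambda>x. complex_of_real (G x - G_mean))"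
proof -
  have "complex_of_real (F x) = 0 + (LBINT t=ereal 0..ereal x. complex_of_real (G t - G_mean))" for x
    unfolding F_def interval_lebesgue_integral_of_real by simp
  then show ?thesis using loc_AC_indefinite[OF G_centred_integrable, of 0] by simp
qed

lemma F_periodic: "F (x + 1) = F x"
proof -
  have c: "set_integrable lborel {0..1::real} (\<lambda>x. complex_of_real G_mean)"
    by (intro set_integrable_continuous_Icc continuous_intros)
  have "(LINT x:{0..1::real}|lborel. complex_of_real G_mean) = complex_of_real G_mean"
    by (simp add: set_lebesgue_integral_def)
  moreover have "(LINT x:{0..1}|lborel. complex_of_real (G x)) = complex_of_real G_mean"
    unfolding G_mean_def by (rule set_integral_complex_of_real)
  ultimately have "(LINT x:{0..1}|lborel. complex_of_real (G x - G_mean)) = 0"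
    unfolding of_real_diff set_integral_diff(2)[OF G_integrable c] by simp
  then have "complex_of_real (F (x + 1)) = complex_of_real (F x)"
    by (intro loc_AC_periodic[OF F_AC]) (simp_all add: G_def Q_periodic E_periodic)
  then show ?thesis by simp
qed

lemma F_continuous: "continuous_on S F"
  by (rule continuous_of_complex[OF loc_AC_continuous[OF F_AC]])

text \<open>Read off from \<open>a' = (c - F a) / E^2\<close> and
  \<open>c' = - G_mean a - z E^2 a + F a' - E f\<close> by inserting the first equation into the
  second; the rough function \<open>G\<close> has cancelled.\<close>

definition al :: "real \<Rightarrow> real" where "al x = - F x / (E x)\<^sup>2"
definition ka :: "real \<Rightarrow> real" where "ka x = - G_mean - (F x)\<^sup>2 / (E x)\<^sup>2"

sublocale hill E al ka
proof
  have nz: "(E x)\<^sup>2 \<noteq> 0" for x using E_positive[of x] by simp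
  show "continuous_on UNIV E" by (rule E_continuous)
  show "continuous_on UNIV al" unfolding al_def[abs_def]
    by (intro continuous_intros E_continuous F_continuous) (use nz in simp)
  show "continuous_on UNIV ka" unfolding ka_def[abs_def]
    by (intro continuous_intros E_continuous F_continuous) (use nz in simp)
qed (simp_all add: E_periodic F_periodic al_def ka_def E_positive)

text \<open>Undoes the substitution: \<open>w\<close> is the quasi-derivative
  \<open>u' - Q u\<close>, and the \<open>Q^2\<close> in its equation reappears through the
  derivative \<open>G - G_mean\<close> of \<open>F\<close>.\<close>

lemma insol_quasi_derivative:
  assumes i: "insol z f a c"
  defines "u \<equiv> \<lambda>x. of_real (E x) * a x" and "w \<equiv> \<lambda>x. inverse (of_real (E x)) * (c x - of_real (F x) * a x)"
  shows "loc_AC u (\<lambda>x. of_real (Q x) * u x + w x)"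
    and "loc_AC w (\<lambda>x. - of_real (Q x) * w x - (of_real ((Q x)\<^sup>2) + z) * u x - f x)"
proof -
  have E0: "complex_of_real (E x) \<noteq> 0" for x using E_positive[of x] by simp
  have a: "loc_AC a (\<lambda>x. rA a c x)"
    and c: "loc_AC c (\<lambda>x. rC z a c x - of_real (E x) * f x)"
    using i by (auto simp: insol_def)
  have 1: "of_real (Q x) * of_real (E x) * a x + of_real (E x) * (rA a c x)
      = of_real (Q x) * u x + w x" for x
    using E0[of x] by (simp add: u_def w_def al_def be_def field_simps power2_eq_square)
  show "loc_AC u (\<lambda>x. of_real (Q x) * u x + w x)"
    using loc_AC_mult[OF E_AC a] unfolding 1 unfolding u_def .
  have Fa: "loc_AC (\<lambda>x. 1 * c x + (-1) * (of_real (F x) * a x))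
     (\<lambda>x. 1 * (rC z a c x - of_real (E x) * f x)
        + (-1) * (of_real (G x - G_mean) * a x + of_real (F x) * (rA a c x)))"
    by (intro loc_AC_lincomb loc_AC_mult c F_AC a)
  have 2: "- complex_of_real (Q x) * inverse (complex_of_real (E x)) * (1 * c x + (-1) * (of_real (F x) * a x))
      + inverse (complex_of_real (E x)) * (1 * (rC z a c x - of_real (E x) * f x)
        + (-1) * (of_real (G x - G_mean) * a x + of_real (F x) * (rA a c x)))
      = - of_real (Q x) * w x - (of_real ((Q x)\<^sup>2) + z) * u x - f x" for x
    using E0[of x] by (simp add: u_def w_def al_def be_def ka_def rh_def G_def field_simps power2_eq_square)
  show "loc_AC w (\<lambda>x. - of_real (Q x) * w x - (of_real ((Q x)\<^sup>2) + z) * u x - f x)"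
    using loc_AC_mult[OF E_inverse_AC Fa] unfolding 2 unfolding w_def by simp
qed

lemma S_graph_of_insol:
  assumes i: "insol z f a c" and u: "L2R (\<lambda>x. of_real (E x) * a x)" and f: "L2R f"
  shows "S_graph Q (\<lambda>x. of_real (E x) * a x) (\<lambda>x. z * (of_real (E x) * a x) + f x)"
proof -
  have "L2R (\<lambda>x. z * (of_real (E x) * a x) + 1 * f x)" by (rule L2R_lincomb[OF u f])
  then show ?thesis
    unfolding S_graph_def using u insol_quasi_derivative[OF i]
    by (intro conjI exI[of _ "\<lambda>x. of_real (Q x) * (of_real (E x) * a x) + inverse (of_real (E x)) * (c x - of_real (F x) * a x)"]
        exI[of _ "\<lambda>x. inverse (of_real (E x)) * (c x - of_real (F x) * a x)"]
        exI[of _ "\<lambda>x. - of_real (Q x) * (inverse (of_real (E x)) * (c x - of_real (F x) * a x)) - (of_real ((Q x)\<^sup>2) + z) * (of_real (E x) * a x) - f x"])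
      (auto simp: algebra_simps)
qed

text \<open>In \<open>S_graph\<close> the functions \<open>u\<close> and \<open>w\<close> are
  themselves absolutely continuous, so the substitution holds at every point; the almost-everywhere
  identities only exchange derivatives, through \<open>loc_AC_cong_AE\<close>.\<close>

lemma insol_of_S_graph:
  assumes S: "S_graph Q u (\<lambda>x. z * u x + f x)" and fm: "f \<in> borel_measurable lborel"
  obtains a c where "insol z f a c" "u = (\<lambda>x. of_real (E x) * a x)"
proof -
  have E0: "complex_of_real (E x) \<noteq> 0" for x using E_positive[of x] by simp
  obtain g w h where u: "loc_AC u g" and w: "loc_AC w h"
    and wq: "AE x in lborel. w x = g x - of_real (Q x) * u x"
    and hq: "AE x in lborel. z * u x + f x = - h x - of_real (Q x) * w x - of_real ((Q x)\<^sup>2) * u x"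
    using S unfolding S_graph_def by blast
  define a where "a = (\<lambda>x. inverse (of_real (E x)) * u x)"
  define c where "c = (\<lambda>x. of_real (E x) * w x + of_real (F x) * a x)"
  have a0: "loc_AC a (\<lambda>x. - of_real (Q x) * inverse (of_real (E x)) * u x + inverse (of_real (E x)) * g x)"
    unfolding a_def by (rule loc_AC_mult[OF E_inverse_AC u])
  have c0: "loc_AC c (\<lambda>x. (of_real (Q x) * of_real (E x) * w x + of_real (E x) * h x)
     + (of_real (G x - G_mean) * a x + of_real (F x) * (- of_real (Q x) * inverse (of_real (E x)) * u x + inverse (of_real (E x)) * g x)))"
    unfolding c_def by (intro loc_AC_add loc_AC_mult E_AC w F_AC a0)
  have ca: "continuous_on UNIV a" by (rule loc_AC_continuous[OF a0])
  have cc: "continuous_on UNIV c" by (rule loc_AC_continuous[OF c0])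
  have ue: "u x = of_real (E x) * a x" for x using E0[of x] by (simp add: a_def)
  have we: "w x = inverse (of_real (E x)) * (c x - of_real (F x) * a x)" for x using E0[of x] by (simp add: c_def)
  have "loc_AC a (\<lambda>x. rA a c x)"
  proof (rule loc_AC_cong_AE[OF a0])
    show "AE x in lborel. - of_real (Q x) * inverse (of_real (E x)) * u x + inverse (of_real (E x)) * g x
        = rA a c x"
      using wq
    proof eventually_elim
      case (elim x)
      then have g: "g x = w x + of_real (Q x) * u x" by simp
      show ?case unfolding g unfolding we ue using E0[of x]
        by (simp add: al_def be_def field_simps power2_eq_square)
    qed
    show "(\<lambda>x. rA a c x) \<in> borel_measurable lborel"
      using borel_measurable_continuous_onI[OF rhs_continuous(1)[OF ca cc]] by simp
  qed
  moreover have "loc_AC c (\<lambda>x. rC z a c x - of_real (E x) * f x)"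
  proof (rule loc_AC_cong_AE[OF c0])
    show "AE x in lborel. (of_real (Q x) * of_real (E x) * w x + of_real (E x) * h x)
       + (of_real (G x - G_mean) * a x + of_real (F x) * (- of_real (Q x) * inverse (of_real (E x)) * u x + inverse (of_real (E x)) * g x))
       = rC z a c x - of_real (E x) * f x"
      using wq hq
    proof eventually_elim
      case (elim x)
      have g: "g x = w x + of_real (Q x) * u x" using elim(1) by simp
      have h: "h x = - (z * u x) - f x - of_real (Q x) * w x - of_real ((Q x)\<^sup>2) * u x"
        using elim(2) by algebra
      show ?case unfolding g h unfolding we ue using E0[of x]
        by (simp add: al_def be_def ka_def rh_def G_def field_simps power2_eq_square)
    qed
    show "(\<lambda>x. rC z a c x - of_real (E x) * f x) \<in> borel_measurable lborel"
      using borel_measurable_continuous_onI[OF rhs_continuous(2)[OF ca cc, of z]] fm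
        borel_measurable_continuous_onI[OF E_continuous] by simp
  qed
  ultimately have "insol z f a c" by (simp add: insol_def)
  then show thesis using that ue by blast
qed

lemma L2R_weighted_integrable:
  assumes "L2R (\<lambda>x. of_real (E x) * a x)"
  shows "integrable lborel (\<lambda>x. rh x * (cmod (a x))\<^sup>2)"
  using assms by (simp add: L2R_def rh_def norm_mult power_mult_distrib)

section \<open>Spectrum, resolvent set and eigenfunctions at the band edges\<close>

lemma S_graph_kernel:
  assumes "S_graph Q u (\<lambda>x. z * u x)"
  shows "u x = 0"
proof -
  have "S_graph Q u (\<lambda>x. z * u x + 0)" using assms by simp
  then obtain a c where a: "insol z (\<lambda>_. 0) a c" "u = (\<lambda>x. of_real (E x) * a x)"
    by (rule insol_of_S_graph) simp
  have "L2R u" using assms by (simp add: S_graph_def)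
  then have "integrable lborel (\<lambda>x. rh x * (cmod (a x))\<^sup>2)" unfolding a(2) by (rule L2R_weighted_integrable)
  then have "a x = 0" using no_L2_homsol a(1) unfolding homsol_iff_insol[symmetric] by blast
  then show ?thesis by (simp add: a(2))
qed

theorem point_spectrum_empty: "S_point_spectrum Q = {}"
  using S_graph_kernel by (fastforce simp: S_point_spectrum_def)

lemma insol_diff:
  assumes "insol z f a c" "insol z f b d"
  shows "homsol z (\<lambda>x. a x - b x) (\<lambda>x. c x - d x)"
proof -
  have "loc_AC (\<lambda>x. 1 * a x + (-1) * b x) (\<lambda>x. 1 * (rA a c x) + (-1) * (rA b d x))"
    "loc_AC (\<lambda>x. 1 * c x + (-1) * d x) (\<lambda>x. 1 * (rC z a c x - of_real (E x) * f x)
       + (-1) * (rC z b d x - of_real (E x) * f x))"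
    using assms unfolding insol_def by (intro loc_AC_lincomb; simp)+
  then show ?thesis unfolding homsol_iff_insol insol_def by (simp add: algebra_simps)
qed

lemma resolvent_set_iff: "z \<in> S_resolvent_set Q \<longleftrightarrow> (\<forall>d. Delta z = of_real d \<longrightarrow> \<bar>d\<bar> > 2)"
proof
  assume z: "z \<in> S_resolvent_set Q"
  show "\<forall>d. Delta z = of_real d \<longrightarrow> \<bar>d\<bar> > 2"
  proof (intro allI impI, rule ccontr)
    fix d assume d: "Delta z = of_real d" and "\<not> \<bar>d\<bar> > 2"
    then have "\<bar>d\<bar> \<le> 2" by simp
    then obtain f where f: "L2R f" "\<And>a c. insol z f a c \<Longrightarrow> \<not> integrable lborel (\<lambda>x. rh x * (cmod (a x))\<^sup>2)"
      using band_not_surjective[OF d] by blast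
    then obtain u where u: "S_graph Q u (\<lambda>x. z * u x + f x)" using z by (auto simp: S_resolvent_set_def)
    have fm: "f \<in> borel_measurable lborel" using f(1) by (simp add: L2R_def)
    obtain a c where a: "insol z f a c" "u = (\<lambda>x. of_real (E x) * a x)"
      using insol_of_S_graph[OF u fm] by blast
    have "L2R u" using u by (simp add: S_graph_def)
    then show False using f(2)[OF a(1)] L2R_weighted_integrable a(2) by blast
  qed
next
  assume "\<forall>d. Delta z = of_real d \<longrightarrow> \<bar>d\<bar> > 2"
  then have D: "\<And>d. Delta z = of_real d \<Longrightarrow> \<bar>d\<bar> > 2" by blast
  obtain C where C: "C \<ge> 0" "\<And>f. L2R f \<Longrightarrow> \<exists>a c. insol z f a c \<and> L2R (\<lambda>x. of_real (E x) * a x)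
      \<and> L2R_norm (\<lambda>x. of_real (E x) * a x) \<le> C * L2R_norm f"
    using resolvent_exists[OF D] by blast
  show "z \<in> S_resolvent_set Q"
    unfolding S_resolvent_set_def
  proof (intro CollectI conjI allI impI exI)
    fix f assume f: "L2R f"
    then obtain a c where "insol z f a c" "L2R (\<lambda>x. of_real (E x) * a x)" using C(2) by blast
    then show "S_graph Q (\<lambda>x. of_real (E x) * (SOME a. \<exists>c. insol z f a c \<and> L2R (\<lambda>x. of_real (E x) * a x)) x)
       (\<lambda>x. z * (of_real (E x) * (SOME a. \<exists>c. insol z f a c \<and> L2R (\<lambda>x. of_real (E x) * a x)) x) + f x)"
      using someI[of "\<lambda>a. \<exists>c. insol z f a c \<and> L2R (\<lambda>x. of_real (E x) * a x)" a] S_graph_of_insol f by blast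
  next
    fix u assume "S_graph Q u (\<lambda>x. z * u x)"
    then show "AE x in lborel. u x = 0" using S_graph_kernel by blast
  next
    \<comment> \<open>Any solution \<open>u\<close> coincides with the one built from Green's
      function, because their difference is a square integrable homogeneous solution; so the norm
      bound holds for it too.\<close>
    fix u f assume f: "L2R f" and u: "S_graph Q u (\<lambda>x. z * u x + f x)"
    have fm: "f \<in> borel_measurable lborel" using f by (simp add: L2R_def)
    obtain a c where a: "insol z f a c" "u = (\<lambda>x. of_real (E x) * a x)"
      using insol_of_S_graph[OF u fm] by blast
    obtain b d where b: "insol z f b d" "L2R (\<lambda>x. of_real (E x) * b x)" "L2R_norm (\<lambda>x. of_real (E x) * b x) \<le> C * L2R_norm f"
      using C(2)[OF f] by blast
    have "L2R u" using u by (simp add: S_graph_def)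
    then have "L2R (\<lambda>x. 1 * (of_real (E x) * a x) + (-1) * (of_real (E x) * b x))"
      unfolding a(2) by (rule L2R_lincomb[OF _ b(2)])
    then have "L2R (\<lambda>x. of_real (E x) * (a x - b x))" by (simp add: algebra_simps)
    then have "a x - b x = 0" for x
      by (rule no_L2_homsol[OF insol_diff[OF a(1) b(1)] L2R_weighted_integrable])
    then have "a = b" by (simp add: fun_eq_iff)
    then show "L2R_norm u \<le> C * L2R_norm f" using b(3) a(2) by simp
  qed
qed

theorem spectrum_eq: "S_spectrum Q = complex_of_real ` {l. \<bar>disc l\<bar> \<le> 2}"
proof (intro equalityI subsetI)
  fix z assume "z \<in> S_spectrum Q"
  then obtain d where d: "Delta z = of_real d" "\<bar>d\<bar> \<le> 2"
    unfolding S_spectrum_def Compl_iff resolvent_set_iff by (auto simp: not_less)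
  have "Im z = 0" by (rule Delta_band_real[OF d])
  then have z: "z = of_real (Re z)" by (simp add: complex_eq_iff)
  then have "disc (Re z) = d" using d(1) by (simp add: disc_def)
  then show "z \<in> complex_of_real ` {l. \<bar>disc l\<bar> \<le> 2}" using z d(2) by blast
next
  fix z assume "z \<in> complex_of_real ` {l. \<bar>disc l\<bar> \<le> 2}"
  then obtain l where "z = of_real l" "\<bar>disc l\<bar> \<le> 2" by blast
  then show "z \<in> S_spectrum Q"
    unfolding S_spectrum_def Compl_iff resolvent_set_iff using Delta_disc[of l] by (auto simp: not_less)
qed


text \<open>With \<open>w\<close> the quasi-derivative of the Floquet solution, the form integrand
  is \<open>(w * cnj v)' + z * u * cnj v\<close>. Both \<open>w\<close> and \<open>v\<close> pick up
  the factor \<open>s\<close> across the cell, so the boundary terms cancel by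
  \<open>s * s = 1\<close>.\<close>

theorem form_eigenvalue_of_disc:
  assumes s: "s = 1 \<or> s = -1" and D: "disc l = 2 * s"
  shows "form_eigenvalue s Q l"
proof -
  define z where "z = complex_of_real l"
  have "of_real s * of_real s - Delta z * of_real s + 1 = 0"
    using s D Delta_disc[of l] by (auto simp: z_def)
  then obtain a c where h: "homsol z a c" and nz: "(a 0, c 0) \<noteq> (0, 0)"
    and per: "\<And>x. a (x + 1) = of_real s * a x" "\<And>x. c (x + 1) = of_real s * c x"
    by (rule floquet_solution) blast
  define u where "u = (\<lambda>x. of_real (E x) * a x)"
  define w where "w = (\<lambda>x. inverse (of_real (E x)) * (c x - of_real (F x) * a x))"
  define g where "g x = of_real (Q x) * u x + w x" for x
  define k where "k x = - of_real (Q x) * w x - (of_real ((Q x)\<^sup>2) + z) * u x - 0" for x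
  have u: "loc_AC u g" and w: "loc_AC w k"
    using insol_quasi_derivative[OF h[unfolded homsol_iff_insol]]
    unfolding u_def w_def g_def[abs_def] k_def[abs_def] by auto
  have cu: "continuous_on S u" and cw: "continuous_on S w" for S
    by (rule loc_AC_continuous[OF u], rule loc_AC_continuous[OF w])
  have u1: "u 1 = of_real s * u 0" and w1: "w 1 = of_real s * w 0"
    using per[of 0] E_periodic[of 0] F_periodic[of 0] by (simp_all add: u_def w_def algebra_simps)
  have "H1_01 u g"
    unfolding H1_01_def
  proof (intro conjI ballI)
    show gm: "g \<in> borel_measurable lborel" by (rule loc_AC_measurable[OF u])
    show "set_integrable lborel {0..1} g" by (rule loc_AC_int[OF u])
    show "u x = u 0 + (LINT t:{0..x}|lborel. g t)" if "x \<in> {0..1}" for x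
      using loc_AC_diff[OF u, of 0 x] that by (simp add: algebra_simps)
    \<comment> \<open>These prepare the majorant in
      \<open>|g|^2 <= 2 * |u|^2 * Q^2 + 2 * |w|^2\<close>, kept complex-valued so that
      \<open>Q2_integrable\<close> applies.\<close>
    have "continuous_on {0..1} (\<lambda>x. complex_of_real (2 * (cmod (u x))\<^sup>2))"
      "continuous_on {0..1} (\<lambda>x. complex_of_real (2 * (cmod (w x))\<^sup>2))"
      by (intro continuous_intros cu cw)+
    from set_integral_add(1)[OF set_integrable_mult_continuous[OF Q2_integrable this(1)] set_integrable_continuous_Icc[OF this(2)]]
    have "integrable lborel (\<lambda>x. indicator {0..1} x *\<^sub>R (complex_of_real (2 * (cmod (u x))\<^sup>2) * complex_of_real ((Q x)\<^sup>2) + complex_of_real (2 * (cmod (w x))\<^sup>2)))"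
      by (simp add: set_integrable_def)
    then show "set_integrable lborel {0..1} (\<lambda>x. (cmod (g x))\<^sup>2)"
      unfolding set_integrable_def
    proof (rule Bochner_Integration.integrable_bound)
      show "(\<lambda>x. indicator {0..1} x *\<^sub>R (cmod (g x))\<^sup>2) \<in> borel_measurable lborel" using gm by simp
      show "AE x in lborel. norm (indicator {0..1} x *\<^sub>R (cmod (g x))\<^sup>2)
         \<le> norm (indicator {0..1} x *\<^sub>R (complex_of_real (2 * (cmod (u x))\<^sup>2) * complex_of_real ((Q x)\<^sup>2) + complex_of_real (2 * (cmod (w x))\<^sup>2)))"
      proof (rule AE_I2)
        fix x
        have "(cmod (g x))\<^sup>2 \<le> (\<bar>Q x\<bar> * cmod (u x) + cmod (w x))\<^sup>2"
          unfolding g_def by (intro power_mono) (auto simp: norm_mult intro: order_trans[OF norm_triangle_ineq])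
        also have "\<dots> \<le> 2 * (cmod (u x))\<^sup>2 * (Q x)\<^sup>2 + 2 * (cmod (w x))\<^sup>2"
          using zero_le_power2[of "\<bar>Q x\<bar> * cmod (u x) - cmod (w x)"]
          by (simp add: power2_eq_square algebra_simps)
        also have "\<dots> = cmod (complex_of_real (2 * (cmod (u x))\<^sup>2 * (Q x)\<^sup>2 + 2 * (cmod (w x))\<^sup>2))"
          unfolding norm_of_real by simp
        finally have le: "(cmod (g x))\<^sup>2 \<le> cmod (complex_of_real (2 * (cmod (u x))\<^sup>2) * complex_of_real ((Q x)\<^sup>2) + complex_of_real (2 * (cmod (w x))\<^sup>2))"
          by simp
        show "norm (indicator {0..1} x *\<^sub>R (cmod (g x))\<^sup>2)
         \<le> norm (indicator {0..1} x *\<^sub>R (complex_of_real (2 * (cmod (u x))\<^sup>2) * complex_of_real ((Q x)\<^sup>2) + complex_of_real (2 * (cmod (w x))\<^sup>2)))"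
          using le by (auto simp: indicator_def)
      qed
    qed
  qed
  then have dom: "form_dom s u g" using u1 by (simp add: form_dom_def)
  have nonzero: "\<exists>x\<in>{0..1}. u x \<noteq> 0"
  proof (rule ccontr)
    assume "\<not> ?thesis"
    then have "a x = 0" if "x \<in> {0<..<1}" for x
      using that E_positive[of x] by (force simp: u_def)
    from homsol_zero_of_interval[OF h this] nz show False by simp
  qed
  have "t_form Q u g v v' = of_real l * (LINT x:{0..1}|lborel. u x * cnj (v x))" if v: "form_dom s v v'" for v v'
  proof -
    have vi: "set_integrable lborel {0..1} v'"
      and vx: "\<And>x. x \<in> {0..1} \<Longrightarrow> v x = v 0 + (LINT t:{0..x}|lborel. v' t)" and v1: "v 1 = of_real s * v 0"
      using v unfolding form_dom_def H1_01_def by blast+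
    \<comment> \<open>\<open>v'\<close> is known to be integrable on \<open>{0..1}\<close> only,
      while \<open>loc_AC\<close> asks for all compact intervals; the cut-off leaves
      \<open>v\<close> unchanged on the cell.\<close>
    define y' where "y' x = indicator {0..1} x *\<^sub>R v' x" for x
    define y where "y x = v 0 + (LBINT t=ereal 0..ereal x. y' t)" for x
    have y'i: "set_integrable lborel {p..q} y'" for p q
      unfolding set_integrable_def y'_def
      by (rule integrable_mult_indicator) (use vi in \<open>simp_all add: set_integrable_def\<close>)
    have y: "loc_AC y y'" unfolding y_def[abs_def] by (rule loc_AC_indefinite[OF y'i])
    have yv: "y x = v x" if x: "x \<in> {0..1}" for x
    proof -
      have "y x = v 0 + (LINT t:{0..x}|lborel. y' t)" using x by (simp add: y_def interval_integral_Icc)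
      also have "(LINT t:{0..x}|lborel. y' t) = (LINT t:{0..x}|lborel. v' t)"
        by (rule set_lebesgue_integral_cong) (use x in \<open>auto simp: y'_def\<close>)
      finally show ?thesis using vx[OF x] by simp
    qed
    have prod: "loc_AC (\<lambda>x. w x * cnj (y x)) (\<lambda>x. k x * cnj (y x) + w x * cnj (y' x))"
      by (intro loc_AC_mult w loc_AC_cnj y)
    have "w 1 * cnj (y 1) - w 0 * cnj (y 0) = 0"
      using s w1 v1 yv[of 0] yv[of 1] by auto
    then have I0: "(LINT x:{0..1}|lborel. k x * cnj (y x) + w x * cnj (y' x)) = 0"
      using loc_AC_diff[OF prod, of 0 1] by simp
    have cuy: "continuous_on {0..1} (\<lambda>x. z * (u x * cnj (y x)))"
      by (intro continuous_intros cu loc_AC_continuous[OF y])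
    have "t_form Q u g v v' = (LINT x:{0..1}|lborel. (k x * cnj (y x) + w x * cnj (y' x)) + z * (u x * cnj (y x)))"
      unfolding t_form_def
      by (rule set_lebesgue_integral_cong)
        (auto simp: yv y'_def g_def k_def algebra_simps power2_eq_square)
    also have "\<dots> = (LINT x:{0..1}|lborel. z * (u x * cnj (y x)))"
      using set_integral_add(2)[OF loc_AC_int[OF prod] set_integrable_continuous_Icc[OF cuy]] I0 by simp
    also have "\<dots> = z * (LINT x:{0..1}|lborel. u x * cnj (y x))" by simp
    also have "(LINT x:{0..1}|lborel. u x * cnj (y x)) = (LINT x:{0..1}|lborel. u x * cnj (v x))"
      by (rule set_lebesgue_integral_cong) (auto simp: yv)
    finally show ?thesis by (simp add: z_def)
  qed
  then show ?thesis unfolding form_eigenvalue_def using dom nonzero by blast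
qed

end

theorem theorem3p15:
  fixes Q :: "real \<Rightarrow> real"
  assumes "admissible_Q Q"
  shows "S_point_spectrum Q = {} \<and>
    (\<exists>(lam0::real) (lm::nat \<Rightarrow> real) (lp::nat \<Rightarrow> real).
       lam0 < lm 1 \<and>
       (\<forall>k\<ge>1. lm k \<le> lp k \<and> lp k < lm (k + 1)) \<and>
       S_spectrum Q = complex_of_real ` ({lam0..lm 1} \<union> (\<Union>k\<in>{1..}. {lp k..lm (k + 1)})) \<and>
       periodic_eigenvalue Q lam0 \<and>
       (\<forall>k\<ge>1. periodic_eigenvalue Q (lm (2 * k)) \<and> periodic_eigenvalue Q (lp (2 * k))) \<and>
       (\<forall>k\<ge>1. semiperiodic_eigenvalue Q (lm (2 * k - 1)) \<and> semiperiodic_eigenvalue Q (lp (2 * k - 1))))"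
proof -
  interpret potential Q by unfold_locales (rule assms)
  obtain lam0 :: real and lm lp :: "nat \<Rightarrow> real" where
    less: "lam0 < lm 1" "\<And>k. k \<ge> 1 \<Longrightarrow> lm k \<le> lp k" "\<And>k. k \<ge> 1 \<Longrightarrow> lp k < lm (k + 1)"
    and bands: "{l. \<bar>disc l\<bar> \<le> 2} = {lam0..lm 1} \<union> (\<Union>k\<in>{1..}. {lp k..lm (k + 1)})"
    and edges: "disc lam0 = 2" "\<And>k. k \<ge> 1 \<Longrightarrow> disc (lm k) = 2 * (-1) ^ k" "\<And>k. k \<ge> 1 \<Longrightarrow> disc (lp k) = 2 * (-1) ^ k"
    by (rule disc_bands) blast
  have even: "periodic_eigenvalue Q (lm (2 * k)) \<and> periodic_eigenvalue Q (lp (2 * k))" if "k \<ge> 1" for k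
  proof -
    have "disc (lm (2 * k)) = 2 * 1" "disc (lp (2 * k)) = 2 * 1"
      using edges(2,3)[of "2 * k"] that by simp_all
    then show ?thesis by (blast intro: form_eigenvalue_of_disc)
  qed
  have odd: "semiperiodic_eigenvalue Q (lm (2 * k - 1)) \<and> semiperiodic_eigenvalue Q (lp (2 * k - 1))" if "k \<ge> 1" for k
  proof -
    \<comment> \<open>For \<open>k >= 1\<close> the truncated subtraction on naturals is genuine, so
      the index is odd and at least 1.\<close>
    have "odd (2 * k - 1)" "2 * k - 1 \<ge> 1" using that by auto
    then have "disc (lm (2 * k - 1)) = 2 * (-1)" "disc (lp (2 * k - 1)) = 2 * (-1)"
      using edges(2,3)[of "2 * k - 1"] by simp_all
    then show ?thesis by (blast intro: form_eigenvalue_of_disc)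
  qed
  have zero: "periodic_eigenvalue Q lam0"
    by (rule form_eigenvalue_of_disc) (simp_all add: edges(1))
  have spec: "S_spectrum Q = complex_of_real ` ({lam0..lm 1} \<union> (\<Union>k\<in>{1..}. {lp k..lm (k + 1)}))"
    unfolding spectrum_eq bands ..
  show ?thesis
    by (intro conjI exI[of _ lam0] exI[of _ lm] exI[of _ lp] point_spectrum_empty less(1) spec zero allI impI
        less(2,3) even odd) simp_all
qed

end
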